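(* Let $M\ge1$, let $X\subseteq\mathbb{R}$ be an interval, let $\psi(x,s)=e^{-(x-s)^2}$, and let $(P_n)_{n\in\mathbb{N}}$ be a sequence of positive Borel measures on $\mathbb{R}$ with finite total mass. For $y\in\mathbb{R}$ consider the condition $$(\star)_y\qquad \lim_{n\to+\infty}\ \max_{0\le k,\ell\le2M}\ \sup_{x\in X}\left|\int_{\mathbb{R}}x^ks^\ell e^{-(x-s)^2-(y-s)^2}\,dP_n(s)-\int_{\mathbb{R}}x^ks^\ell e^{-(x-s)^2-(y-s)^2}\,ds\right|=0 .$$ i) Let $m_0=\sum_{i=1}^Ma_i\delta_{x_i}$ with $x_1<\dots<x_M$ in the interior of $X$ and $a_i>0$ for all $i$, and assume that $(\star)_{x_i}$ holds for every $i\in\{1,\dots,M\}$. Then, provided $n$ is large enough, $m_0$ satisfies the Non-Degenerate Source Condition for the reconstruction framework defined by $P_n$ and $\psi$. ii) Let $x_0$ be in the interior of $X$ and assume that $(\star)_{x_0}$ holds. Then, provided $n$ is large enough, the point $x_0$ is $(2M-1)$ Non Degenerate for the reconstruction framework defined by $P_n$ and $\psi$.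
   Context: The reconstruction framework defined by a positive measure $P$ on $\mathbb{R}$ and $\psi$ is: $H=L^2(\mathbb{R},P)$ and $\varphi:X\to H$, $\varphi(x)=\psi(x,\cdot)$. $C_0(X)$ is the space of continuous functions $\eta:X\to\mathbb{R}$ such that for every $\varepsilon>0$ there is a compact $K\subset X$ with $|\eta|\le\varepsilon$ on $X\setminus K$. For $k\in\mathbb{N}$, $\mathcal{K}^k(X;H)$ is the set of $\varphi\in C^k(X;H)$ such that $x\mapsto\langle p,\varphi(x)\rangle_H$ belongs to $C_0(X)$ for all $p\in H$ and $\sup_{x\in X}\|\varphi^{(i)}(x)\|_H<\infty$ for $0\le i\le k$. Standing assumption: in every reconstruction framework considered, $\varphi\in\mathcal{K}^k(X;H)$ for some $k\ge2$. For $p\in H$, $(\Phi^*p)(x)=\langle\varphi(x),p\rangle_H$. $\Gamma_x:\mathbb{R}^{2M}\to H$ is $\Gamma_xb=\sum_{i=1}^M(b_{2i-1}\varphi(x_i)+b_{2i}\varphi'(x_i))$. If $\Gamma_x$ has full rank (is injective), $p_V$ is the element of minimal norm of $\{p\in H:(\Phi^*p)(x_i)=1,\ (\Phi^*p)'(x_i)=0,\ 1\le i\le M\}$ and $\eta_V=\Phi^*p_V$. The measure $m_0$ satisfies the Non-Degenerate Source Condition if $\Gamma_x$ has full rank, $\eta_V(x)<1$ for all $x\in X\setminus\{x_1,\dots,x_M\}$, and $\eta_V''(x_i)<0$ for all $1\le i\le M$. $F_{2M-1}:\mathbb{R}^{2M}\to H$ is $F_{2M-1}b=\sum_{k=0}^{2M-1}b_{k+1}\varphi^{(k)}(x_0)$.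 If it has full rank (is injective), $p_W$ is the element of minimal norm of $\{p\in H:(\Phi^*p)(x_0)=1,\ (\Phi^*p)^{(k)}(x_0)=0,\ 1\le k\le2M-1\}$ and $\eta_W=\Phi^*p_W$. The point $x_0$ is $(2M-1)$ Non Degenerate if $\varphi\in\mathcal{K}^{2M}(X;H)$, $F_{2M-1}$ has full rank, $\eta_W^{(2M)}(x_0)<0$, and $\eta_W(x)<1$ for all $x\in X\setminus\{x_0\}$. *)

theory Defs
  imports "HOL-Analysis.Analysis"
begin

(* The Hilbert space L^2(R,P).  Its elements are represented by square integrable functions;
   two representatives denote the same element iff they agree P-almost everywhere.  The inner
   product, the norm and every predicate below are invariant under this identification. *)

definition L2 :: "real measure \<Rightarrow> (real \<Rightarrow> real) set" where
  "L2 P = {f \<in> borel_measurable P. integrable P (\<lambda>s. (f s)\<^sup>2)}"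

definition L2_eq :: "real measure \<Rightarrow> (real \<Rightarrow> real) \<Rightarrow> (real \<Rightarrow> real) \<Rightarrow> bool" where
  "L2_eq P f g \<longleftrightarrow> (AE s in P. f s = g s)"

definition L2_inner :: "real measure \<Rightarrow> (real \<Rightarrow> real) \<Rightarrow> (real \<Rightarrow> real) \<Rightarrow> real" where
  "L2_inner P f g = (\<integral>s. f s * g s \<partial>P)"

definition L2_norm :: "real measure \<Rightarrow> (real \<Rightarrow> real) \<Rightarrow> real" where
  "L2_norm P f = sqrt (L2_inner P f f)"

definition L2_continuous_on :: "real measure \<Rightarrow> real set \<Rightarrow> (real \<Rightarrow> real \<Rightarrow> real) \<Rightarrow> bool" where
  "L2_continuous_on P X f \<longleftrightarrow>
     (\<forall>x\<in>X. f x \<in> L2 P) \<and>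
     (\<forall>x\<in>X. ((\<lambda>y. L2_norm P (\<lambda>s. f y s - f x s)) \<longlongrightarrow> 0) (at x within X))"

(* Strong derivative of a map from X to L^2(R,P).  The values f y are required to lie in L2 P
   because L2_norm is meaningless (the integral defaults to 0) on other functions. *)

definition has_L2_derivative ::
    "real measure \<Rightarrow> real set \<Rightarrow> (real \<Rightarrow> real \<Rightarrow> real) \<Rightarrow> (real \<Rightarrow> real) \<Rightarrow> real \<Rightarrow> bool" where
  "has_L2_derivative P X f f' x \<longleftrightarrow>
     f' \<in> L2 P \<and> (\<forall>y\<in>X. f y \<in> L2 P) \<and>
     ((\<lambda>y. L2_norm P (\<lambda>s. (f y s - f x s) / (y - x) - f' s)) \<longlongrightarrow> 0) (at x within X)"

(* A representative of the derivative; it is unique up to L2_eq when it exists and x is a limit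
   point of X.  The i-th derivative of f on X is (L2_deriv P X ^^ i) f. *)

definition L2_deriv ::
    "real measure \<Rightarrow> real set \<Rightarrow> (real \<Rightarrow> real \<Rightarrow> real) \<Rightarrow> real \<Rightarrow> real \<Rightarrow> real" where
  "L2_deriv P X f x = (SOME f'. has_L2_derivative P X f f' x)"

definition C_L2 :: "nat \<Rightarrow> real set \<Rightarrow> real measure \<Rightarrow> (real \<Rightarrow> real \<Rightarrow> real) set" where
  "C_L2 k X P = {f.
     (\<forall>i<k. \<forall>x\<in>X. \<exists>f'. has_L2_derivative P X ((L2_deriv P X ^^ i) f) f' x) \<and>
     (\<forall>i\<le>k. L2_continuous_on P X ((L2_deriv P X ^^ i) f))}"

definition C0 :: "real set \<Rightarrow> (real \<Rightarrow> real) set" where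
  "C0 X = {\<eta>. continuous_on X \<eta> \<and>
     (\<forall>\<epsilon>>0. \<exists>K. compact K \<and> K \<subseteq> X \<and> (\<forall>x\<in>X - K. \<bar>\<eta> x\<bar> \<le> \<epsilon>))}"

definition K_space :: "nat \<Rightarrow> real set \<Rightarrow> real measure \<Rightarrow> (real \<Rightarrow> real \<Rightarrow> real) set" where
  "K_space k X P = {\<phi> \<in> C_L2 k X P.
     (\<forall>p\<in>L2 P. (\<lambda>x. L2_inner P p (\<phi> x)) \<in> C0 X) \<and>
     (\<forall>i\<le>k. bdd_above ((\<lambda>x. L2_norm P ((L2_deriv P X ^^ i) \<phi> x)) ` X))}"

(* Throughout, a reconstruction framework is given by X, a measure P and the kernel psi; the
   map phi from X to L^2(R,P), phi(x) = psi(x,.), is the curried kernel itself. *)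

definition admissible_framework ::
    "real set \<Rightarrow> real measure \<Rightarrow> (real \<Rightarrow> real \<Rightarrow> real) \<Rightarrow> bool" where
  "admissible_framework X P \<phi> \<longleftrightarrow> (\<exists>k\<ge>2. \<phi> \<in> K_space k X P)"

definition Phi_adj ::
    "real measure \<Rightarrow> (real \<Rightarrow> real \<Rightarrow> real) \<Rightarrow> (real \<Rightarrow> real) \<Rightarrow> real \<Rightarrow> real" where
  "Phi_adj P \<phi> p x = L2_inner P (\<phi> x) p"

(* Vectors of R^(2M) are functions on {1..2*M}; values elsewhere are irrelevant. *)

definition Gamma ::
    "real set \<Rightarrow> real measure \<Rightarrow> (real \<Rightarrow> real \<Rightarrow> real) \<Rightarrow> nat \<Rightarrow> (nat \<Rightarrow> real) \<Rightarrow>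
     (nat \<Rightarrow> real) \<Rightarrow> real \<Rightarrow> real" where
  "Gamma X P \<phi> M x b = (\<lambda>s. \<Sum>i=1..M.
     b (2 * i - 1) * \<phi> (x i) s + b (2 * i) * L2_deriv P X \<phi> (x i) s)"

definition F_map ::
    "real set \<Rightarrow> real measure \<Rightarrow> (real \<Rightarrow> real \<Rightarrow> real) \<Rightarrow> nat \<Rightarrow> real \<Rightarrow>
     (nat \<Rightarrow> real) \<Rightarrow> real \<Rightarrow> real" where
  "F_map X P \<phi> M x0 b = (\<lambda>s. \<Sum>k=0..2 * M - 1.
     b (k + 1) * (L2_deriv P X ^^ k) \<phi> x0 s)"

definition full_rank ::
    "real measure \<Rightarrow> nat \<Rightarrow> ((nat \<Rightarrow> real) \<Rightarrow> real \<Rightarrow> real) \<Rightarrow> bool" where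
  "full_rank P d A \<longleftrightarrow> (\<forall>b c. L2_eq P (A b) (A c) \<longrightarrow> (\<forall>j\<in>{1..d}. b j = c j))"

(* The minimal norm elements are unique up to L2_eq.  The derivatives of Phi_adj P phi p are only
   taken at interior points of X, where they do not depend on phi outside X. *)

definition p_V ::
    "real measure \<Rightarrow> (real \<Rightarrow> real \<Rightarrow> real) \<Rightarrow> nat \<Rightarrow> (nat \<Rightarrow> real) \<Rightarrow> real \<Rightarrow> real" where
  "p_V P \<phi> M x = arg_min (L2_norm P) (\<lambda>p. p \<in> L2 P \<and>
     (\<forall>i\<in>{1..M}. Phi_adj P \<phi> p (x i) = 1 \<and> deriv (Phi_adj P \<phi> p) (x i) = 0))"

definition eta_V ::
    "real measure \<Rightarrow> (real \<Rightarrow> real \<Rightarrow> real) \<Rightarrow> nat \<Rightarrow> (nat \<Rightarrow> real) \<Rightarrow> real \<Rightarrow> real" where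
  "eta_V P \<phi> M x = Phi_adj P \<phi> (p_V P \<phi> M x)"

definition p_W ::
    "real measure \<Rightarrow> (real \<Rightarrow> real \<Rightarrow> real) \<Rightarrow> nat \<Rightarrow> real \<Rightarrow> real \<Rightarrow> real" where
  "p_W P \<phi> M x0 = arg_min (L2_norm P) (\<lambda>p. p \<in> L2 P \<and>
     Phi_adj P \<phi> p x0 = 1 \<and> (\<forall>k\<in>{1..2 * M - 1}. (deriv ^^ k) (Phi_adj P \<phi> p) x0 = 0))"

definition eta_W ::
    "real measure \<Rightarrow> (real \<Rightarrow> real \<Rightarrow> real) \<Rightarrow> nat \<Rightarrow> real \<Rightarrow> real \<Rightarrow> real" where
  "eta_W P \<phi> M x0 = Phi_adj P \<phi> (p_W P \<phi> M x0)"

definition spike_measure :: "nat \<Rightarrow> (nat \<Rightarrow> real) \<Rightarrow> (nat \<Rightarrow> real) \<Rightarrow> real measure" where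
  "spike_measure M a x =
     measure_of UNIV (sets borel) (\<lambda>A. \<Sum>i=1..M. ennreal (a i) * indicator A (x i))"

lemma sets_spike_measure [simp]: "sets (spike_measure M a x) = sets borel"
  unfolding spike_measure_def
  using sets.sigma_sets_eq[of "borel :: real measure"] by (simp add: sets_measure_of_conv)

lemma emeasure_spike_measure:
  assumes "A \<in> sets borel"
  shows "emeasure (spike_measure M a x) A = (\<Sum>i=1..M. ennreal (a i) * indicator A (x i))"
  unfolding spike_measure_def
proof (rule emeasure_measure_of_sigma)
  show "sigma_algebra (UNIV :: real set) (sets borel)"
    using sets.sigma_algebra_axioms[of "borel :: real measure"] by simp
  show "positive (sets borel) (\<lambda>A. \<Sum>i=1..M. ennreal (a i) * indicator A (x i))"
    by (simp add: positive_def)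
  show "countably_additive (sets borel) (\<lambda>A. \<Sum>i=1..M. ennreal (a i) * indicator A (x i))"
  proof (rule countably_additiveI)
    fix B :: "nat \<Rightarrow> real set"
    assume "range B \<subseteq> sets borel" "disjoint_family B" "(\<Union>n. B n) \<in> sets borel"
    then have "(\<Sum>n. (indicator (B n) (x i) :: ennreal)) = indicator (\<Union>n. B n) (x i)" for i
      by (intro suminf_indicator)
    then show "(\<Sum>n. \<Sum>i=1..M. ennreal (a i) * indicator (B n) (x i)) =
        (\<Sum>i=1..M. ennreal (a i) * indicator (\<Union>n. B n) (x i))"
      by (subst suminf_sum) (auto simp: ennreal_suminf_cmult)
  qed
qed (use assms in simp)

(* M, a, x are determined by m0, since the x i are increasing and the a i positive. *)

definition nondegenerate_source_condition ::
    "real set \<Rightarrow> real measure \<Rightarrow> (real \<Rightarrow> real \<Rightarrow> real) \<Rightarrow> real measure \<Rightarrow> bool" where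
  "nondegenerate_source_condition X P \<phi> m0 \<longleftrightarrow>
     (\<exists>M a x. m0 = spike_measure M a x \<and>
        strict_mono_on {1..M} x \<and> (\<forall>i\<in>{1..M}. x i \<in> interior X \<and> 0 < a i) \<and>
        full_rank P (2 * M) (Gamma X P \<phi> M x) \<and>
        (\<forall>y\<in>X - x ` {1..M}. eta_V P \<phi> M x y < 1) \<and>
        (\<forall>i\<in>{1..M}. (deriv ^^ 2) (eta_V P \<phi> M x) (x i) < 0))"

(* For M >= 1: the point x0 is (2M-1) Non Degenerate. *)

definition nondegenerate_point ::
    "real set \<Rightarrow> real measure \<Rightarrow> (real \<Rightarrow> real \<Rightarrow> real) \<Rightarrow> nat \<Rightarrow> real \<Rightarrow> bool" where
  "nondegenerate_point X P \<phi> M x0 \<longleftrightarrow>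
     \<phi> \<in> K_space (2 * M) X P \<and>
     full_rank P (2 * M) (F_map X P \<phi> M x0) \<and>
     (deriv ^^ (2 * M)) (eta_W P \<phi> M x0) x0 < 0 \<and>
     (\<forall>x\<in>X - {x0}. eta_W P \<phi> M x0 x < 1)"

definition gauss :: "real \<Rightarrow> real \<Rightarrow> real" where
  "gauss x s = exp (- (x - s)\<^sup>2)"

definition moment :: "real measure \<Rightarrow> nat \<Rightarrow> nat \<Rightarrow> real \<Rightarrow> real \<Rightarrow> real" where
  "moment Q k l y x = (\<integral>s. x ^ k * s ^ l * exp (- (x - s)\<^sup>2 - (y - s)\<^sup>2) \<partial>Q)"

(* For finite P n and fixed y the suprema are over bounded sets: (x - s)^2 + (y - s)^2 is a
   quadratic in (x, s) with positive definite leading part, so the integrand of moment is bounded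
   in (x, s), and its Lebesgue integral is bounded in x. *)

definition moments_converge ::
    "nat \<Rightarrow> real set \<Rightarrow> (nat \<Rightarrow> real measure) \<Rightarrow> real \<Rightarrow> bool" where
  "moments_converge M X P y \<longleftrightarrow>
     (\<lambda>n. Max ((\<lambda>(k, l). SUP x\<in>X. \<bar>moment (P n) k l y x - moment lborel k l y x\<bar>)
            ` ({0..2 * M} \<times> {0..2 * M}))) \<longlonglongrightarrow> 0"

end

theory Submission
  imports Defs "HOL-Probability.Probability" "Jordan_Normal_Form.Determinant"
    "HOL-Real_Asymp.Real_Asymp"
begin


text \<open>The plan is to settle Lebesgue measure exactly and then perturb. Both parts have the
  same shape: nodes \<open>a\<close> with even multiplicities \<open>\<mu> a\<close> (M nodes of
  multiplicity 2, or one node of multiplicity 2M), and a combination \<eta> of transforms of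
  derivatives of Gaussians centred at the nodes, such that 1 - \<eta> vanishes to order
  \<open>\<mu> a\<close> at each node. It must be shown that \<eta> < 1 elsewhere and that the
  derivative of order \<open>\<mu> a\<close> at \<open>a\<close> is negative.

  For Lebesgue measure, correlations of Gaussians are again Gaussians, so exp(x^2/2) (1 - \<eta>(x))
  = exp(x^2/2) - (sum over the nodes of q_a(x) exp(a x)), where q_a has degree below
  \<open>\<mu> a\<close>. The differential operator with factors (D - a), each taken
  \<open>\<mu> a\<close> times, kills the sum. Since exp(x^2/2) is a constant times the integral of
  exp(2 x s - 2 s^2) ds, the operator inserts there the product of the (2 s - a)^(\<mu> a), which is
  nonnegative; a positive function remains. By Rolle's theorem with multiplicities
  (\<open>diff_chain_zero\<close>), 1 - \<eta> has no more zeros than the order of the operator, and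
  the interpolation conditions already use them all. So there is no other zero and no zero of higher
  order. As \<eta> tends to 0 at infinity and zeros of even order keep the sign,
  \<open>limit_certificate\<close> follows.

  For the perturbation, the moment hypothesis gives uniform convergence on X of the transforms and,
  through a local bound on higher derivatives, pointwise convergence of all their derivatives in the
  interior (\<open>gtrans_dgauss_tendsto\<close>). The Gram matrix for Lebesgue measure is
  nonsingular (\<open>gram_kernel_trivial\<close>), so for large n the interpolation systems of P_n
  are uniquely solvable and their coefficients converge (\<open>eventually_solve_linear\<close>).
  Away from the nodes \<eta> stays below 1 by a fixed margin and uniform convergence suffices; near
  a node a Taylor expansion with uniform control is used
  (\<open>eventually_even_zero_positive\<close>). This is assembled in
  \<open>eventually_certificate\<close>.

  Finally, a feasible element lying in the span of the constraint functions has minimal norm by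
  Pythagoras (\<open>arg_min_L2_norm\<close>), so the combination found is the required minimal norm
  element up to null sets; nonsingularity of the Gram matrix also gives full rank.\<close>

section \<open>Derivatives of the Gaussian and their decay\<close>

primrec hpoly :: "nat \<Rightarrow> real poly" where
  "hpoly 0 = 1"
| "hpoly (Suc k) = pderiv (hpoly k) - [:0, 2:] * hpoly k"

text \<open>The derivative of order \<open>k\<close> of exp(-u^2); thus \<open>hpoly k\<close> is
  (-1)^k times the physicists' Hermite polynomial of degree \<open>k\<close>.\<close>

definition dgauss :: "nat \<Rightarrow> real \<Rightarrow> real" where
  "dgauss k u = poly (hpoly k) u * exp (- u\<^sup>2)"

lemma dgauss_0: "dgauss 0 u = exp (- u\<^sup>2)"
  by (simp add: dgauss_def)

lemma dgauss_1: "dgauss (Suc 0) u = - 2 * u * dgauss 0 u"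
  by (simp add: dgauss_def)

lemma dgauss_deriv: "(dgauss k has_real_derivative dgauss (Suc k) u) (at u)"
  unfolding dgauss_def [abs_def]
  by (auto intro!: derivative_eq_intros poly_DERIV simp: algebra_simps)

lemma continuous_on_dgauss [continuous_intros]:
  "continuous_on S f \<Longrightarrow> continuous_on S (\<lambda>x. dgauss k (f x))"
  unfolding dgauss_def by (intro continuous_intros)

lemma borel_measurable_dgauss [measurable]: "dgauss k \<in> borel_measurable borel"
  by (intro borel_measurable_continuous_onI continuous_intros)

lemma degree_hpoly: "degree (hpoly k) = k"
proof (induction k)
  case (Suc k)
  have nz: "hpoly k \<noteq> 0" using Suc by (cases k) auto
  have "degree ([:0, 2:] * hpoly k) = Suc k"
    using nz Suc by (subst degree_mult_eq) auto
  moreover have "degree (pderiv (hpoly k)) < Suc k"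
    using Suc by (simp add: degree_pderiv)
  ultimately have "degree (- ([:0, 2:] * hpoly k) + pderiv (hpoly k)) = Suc k"
    by (subst degree_add_eq_left) auto
  moreover have "hpoly (Suc k) = - ([:0, 2:] * hpoly k) + pderiv (hpoly k)" by simp
  ultimately show ?case by (simp only:)
qed simp

text \<open>Induction on the coefficients: one half of the exponent \<delta> pays for the induction
  hypothesis, the other half absorbs the extra factor \<open>u\<close>.\<close>

lemma poly_le_exp:
  fixes p :: "real poly"
  assumes "\<delta> > 0"
  shows "\<exists>C>0. \<forall>u. \<bar>poly p u\<bar> \<le> C * exp (\<delta> * \<bar>u\<bar>)"
  using assms
proof (induction p arbitrary: \<delta>)
  case 0
  show ?case by (intro exI[of _ 1]) auto
next
  case (pCons a p)
  obtain C where C: "C > 0" "\<And>u. \<bar>poly p u\<bar> \<le> C * exp (\<delta>/2 * \<bar>u\<bar>)"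
    using pCons.IH[of "\<delta>/2"] pCons.prems by auto
  show ?case
  proof (intro exI[of _ "\<bar>a\<bar> + 2 / \<delta> * C"] conjI allI)
    show "\<bar>a\<bar> + 2 / \<delta> * C > 0" using C pCons.prems by (intro add_nonneg_pos) auto
    fix u
    have u: "\<bar>u\<bar> \<le> 2 / \<delta> * exp (\<delta>/2 * \<bar>u\<bar>)"
      using exp_ge_add_one_self[of "\<delta>/2 * \<bar>u\<bar>"] pCons.prems by (simp add: field_simps)
    have "\<bar>poly (pCons a p) u\<bar> \<le> \<bar>a\<bar> + \<bar>u\<bar> * \<bar>poly p u\<bar>"
      by (simp add: abs_mult[symmetric])
    also have "\<dots> \<le> \<bar>a\<bar> + (2 / \<delta> * exp (\<delta>/2 * \<bar>u\<bar>)) * (C * exp (\<delta>/2 * \<bar>u\<bar>))"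
      using pCons.prems by (intro add_left_mono mult_mono u C(2)) auto
    also have "\<dots> = \<bar>a\<bar> + 2 / \<delta> * C * exp (\<delta> * \<bar>u\<bar>)"
      by (simp add: mult_exp_exp[symmetric] algebra_simps flip: exp_add)
    also have "\<dots> \<le> \<bar>a\<bar> * exp (\<delta> * \<bar>u\<bar>) + 2 / \<delta> * C * exp (\<delta> * \<bar>u\<bar>)"
      using pCons.prems mult_left_mono[of 1 "exp (\<delta> * \<bar>u\<bar>)" "\<bar>a\<bar>"] by simp
    finally show "\<bar>poly (pCons a p) u\<bar> \<le> (\<bar>a\<bar> + 2 / \<delta> * C) * exp (\<delta> * \<bar>u\<bar>)"
      by (simp add: algebra_simps)
  qed
qed

text \<open>A polynomial grows at most like exp |u|, and |u| - u^2 <= 1/2 - u^2/2. The Gaussian left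
  on the right keeps the bound integrable.\<close>

lemma poly_gauss_le:
  fixes p :: "real poly"
  shows "\<exists>C>0. \<forall>u. \<bar>poly p u * exp (- u\<^sup>2)\<bar> \<le> C * exp (- u\<^sup>2 / 2)"
proof -
  obtain C where C: "C > 0" "\<And>u. \<bar>poly p u\<bar> \<le> C * exp (1 * \<bar>u\<bar>)"
    using poly_le_exp[of 1 p] by auto
  show ?thesis
  proof (intro exI[of _ "C * exp (1/2)"] conjI allI)
    fix u :: real
    have "0 \<le> (\<bar>u\<bar> - 1)\<^sup>2" by simp
    then have *: "\<bar>u\<bar> - u\<^sup>2 \<le> 1/2 - u\<^sup>2 / 2" by (simp add: power2_eq_square algebra_simps)
    have "\<bar>poly p u * exp (- u\<^sup>2)\<bar> \<le> C * exp (1 * \<bar>u\<bar>) * exp (- u\<^sup>2)"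
      unfolding abs_mult using C(1) by (intro mult_mono C(2)) auto
    also have "\<dots> = C * exp (\<bar>u\<bar> - u\<^sup>2)" by (simp add: exp_diff exp_minus divide_inverse)
    also have "\<dots> \<le> C * exp (1/2 - u\<^sup>2 / 2)" using C(1) * by simp
    also have "\<dots> = C * exp (1/2) * exp (- u\<^sup>2 / 2)" by (simp flip: exp_add)
    finally show "\<bar>poly p u * exp (- u\<^sup>2)\<bar> \<le> C * exp (1/2) * exp (- u\<^sup>2 / 2)" .
  qed (use C in simp)
qed

lemma dgauss_bounded: "\<exists>C>0. \<forall>u. \<bar>dgauss k u\<bar> \<le> C"
proof -
  obtain C where C: "C > 0" "\<And>u. \<bar>dgauss k u\<bar> \<le> C * exp (- u\<^sup>2 / 2)"
    using poly_gauss_le[of "hpoly k"] unfolding dgauss_def by auto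
  have "\<bar>dgauss k u\<bar> \<le> C" for u
    using C(1) by (intro order_trans[OF C(2)]) (simp add: mult_le_cancel_left2)
  then show ?thesis using C(1) by auto
qed

lemma integrable_poly_gauss:
  "integrable lborel (\<lambda>s. poly p (y - s) * exp (- (y - s)\<^sup>2))" for p :: "real poly"
proof -
  obtain C where C: "C > 0" "\<And>u. \<bar>poly p u * exp (- u\<^sup>2)\<bar> \<le> C * exp (- u\<^sup>2 / 2)"
    using poly_gauss_le[of p] by auto
  have "integrable lborel (\<lambda>s. C * sqrt (2 * pi) * normal_density y 1 s)"
    by (intro integrable_mult_right integrable_normal_density) simp
  then show ?thesis
  proof (rule Bochner_Integration.integrable_bound)
    show "(\<lambda>s. poly p (y - s) * exp (- (y - s)\<^sup>2)) \<in> borel_measurable lborel"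
      by (auto intro!: borel_measurable_continuous_onI continuous_intros)
    show "AE s in lborel. norm (poly p (y - s) * exp (- (y - s)\<^sup>2))
        \<le> norm (C * sqrt (2 * pi) * normal_density y 1 s)"
      using C(1) C(2)[of "y - _"]
      by (auto simp: normal_density_def power2_commute[of y] intro!: AE_I2)
  qed
qed

lemma integrable_dgauss_lborel: "integrable lborel (\<lambda>s. dgauss k (y - s))"
  unfolding dgauss_def by (rule integrable_poly_gauss)

lemma integrable_dgauss_finite:
  assumes "finite_measure Q" "sets Q = sets borel"
  shows "integrable Q (\<lambda>s. dgauss k (y - s))"
proof -
  interpret finite_measure Q by fact
  have [measurable_cong]: "sets Q = sets borel" by fact
  obtain C where "\<And>u. \<bar>dgauss k u\<bar> \<le> C" using dgauss_bounded by blast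
  then show ?thesis by (intro integrable_const_bound[of _ C]) auto
qed

lemma deriv_bound_imp_lipschitz:
  fixes f :: "real \<Rightarrow> real"
  assumes "\<And>x. (f has_real_derivative f' x) (at x)" "\<And>x. \<bar>f' x\<bar> \<le> B"
  shows "\<bar>f x - f y\<bar> \<le> B * \<bar>x - y\<bar>"
  using field_differentiable_bound[of UNIV f f' B x y] assms by simp

lemma deriv_bound_imp_taylor1:
  fixes f :: "real \<Rightarrow> real"
  assumes "\<And>x. (f has_real_derivative f' x) (at x)"
    and "\<And>x. (f' has_real_derivative f'' x) (at x)"
    and "\<And>t. \<bar>t - x\<bar> \<le> \<bar>h\<bar> \<Longrightarrow> \<bar>f'' t\<bar> \<le> B"
  shows "\<bar>f (x + h) - f x - h * f' x\<bar> \<le> B * h\<^sup>2"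
proof (cases "h = 0")
  case False
  define d where "d m = (case m of 0 \<Rightarrow> f | Suc 0 \<Rightarrow> f' | Suc (Suc _) \<Rightarrow> f'')" for m :: nat
  have "\<exists>t. (if x + h < x then x + h < t \<and> t < x else x < t \<and> t < x + h) \<and>
      f (x + h) = (\<Sum>m<2. d m x / fact m * (x + h - x)^m) + d 2 t / fact 2 * (x + h - x)^2"
  proof (rule Taylor)
    show "\<forall>m t. m < 2 \<and> min x (x+h) \<le> t \<and> t \<le> max x (x+h) \<longrightarrow> (d m has_real_derivative d (Suc m) t) (at t)"
      using assms(1,2) by (auto simp: d_def split: nat.splits)
  qed (use False in \<open>auto simp: d_def\<close>)
  then obtain t where t: "\<bar>t - x\<bar> \<le> \<bar>h\<bar>" and
    eq: "f (x + h) = (\<Sum>m<2. d m x / fact m * h^m) + d 2 t / fact 2 * h^2"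
    by (cases "h < 0") force+
  have "f (x + h) - f x - h * f' x = f'' t / 2 * h\<^sup>2"
    using eq by (simp add: d_def numeral_2_eq_2)
  then have "\<bar>f (x + h) - f x - h * f' x\<bar> = \<bar>f'' t\<bar> / 2 * h\<^sup>2" by (simp only: abs_mult) simp
  also have "\<dots> \<le> B * h\<^sup>2"
    using assms(3)[OF t] by (intro mult_right_mono) auto
  finally show ?thesis .
qed simp

section \<open>Gaussian transforms and differentiation under the integral\<close>

text \<open>For integrable \<open>p\<close> this is the derivative of order \<open>k\<close> of
  \<open>Phi_adj Q gauss p\<close>, as an explicit integral. It covers at once square integrable
  \<open>p\<close> on a finite measure and Gaussian combinations on Lebesgue measure.\<close>

definition gtrans :: "real measure \<Rightarrow> (real \<Rightarrow> real) \<Rightarrow> nat \<Rightarrow> real \<Rightarrow> real" where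
  "gtrans Q p k x = (\<integral>s. dgauss k (x - s) * p s \<partial>Q)"

lemma integrable_gtrans:
  assumes "integrable Q p" "sets Q = sets borel"
  shows "integrable Q (\<lambda>s. dgauss k (x - s) * p s)"
proof -
  have [measurable_cong]: "sets Q = sets borel" by fact
  obtain C where C: "C > 0" "\<And>u. \<bar>dgauss k u\<bar> \<le> C" using dgauss_bounded by blast
  have "integrable Q (\<lambda>s. C * p s)" using assms by simp
  then show ?thesis
    using C borel_measurable_integrable[OF assms(1)]
    by (elim Bochner_Integration.integrable_bound) (auto simp: abs_mult intro!: AE_I2 mult_right_mono)
qed

text \<open>A uniform bound on the second derivative of \<open>dgauss k\<close> bounds the
  first-order Taylor remainder of the integrand by a multiple of h^2 |p|, so the error of the
  difference quotient is O(h).\<close>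

lemma gtrans_deriv:
  assumes "integrable Q p" "sets Q = sets borel"
  shows "(gtrans Q p k has_real_derivative gtrans Q p (Suc k) x) (at x)"
proof -
  obtain C where C: "C > 0" "\<And>u. \<bar>dgauss (Suc (Suc k)) u\<bar> \<le> C" using dgauss_bounded by blast
  note int = integrable_gtrans[OF assms]
  define B where "B = C * (\<integral>s. \<bar>p s\<bar> \<partial>Q)"
  have *: "\<bar>gtrans Q p k (x + h) - gtrans Q p k x - h * gtrans Q p (Suc k) x\<bar> \<le> B * h\<^sup>2" for h
  proof -
    have "gtrans Q p k (x + h) - gtrans Q p k x - h * gtrans Q p (Suc k) x
        = (\<integral>s. (dgauss k (x - s + h) - dgauss k (x - s) - h * dgauss (Suc k) (x - s)) * p s \<partial>Q)"
      unfolding gtrans_def using int[of k x] int[of k "x+h"] int[of "Suc k" x]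
      by (simp add: left_diff_distrib mult.assoc add_diff_eq add.commute diff_add_eq)
    also have "\<bar>\<dots>\<bar> \<le> (\<integral>s. C * h\<^sup>2 * \<bar>p s\<bar> \<partial>Q)"
    proof (rule integral_abs_bound_integral)
      show "integrable Q (\<lambda>s. (dgauss k (x - s + h) - dgauss k (x - s) - h * dgauss (Suc k) (x - s)) * p s)"
        using int[of k x] int[of k "x+h"] int[of "Suc k" x]
        by (simp add: left_diff_distrib mult.assoc add_diff_eq add.commute diff_add_eq)
      fix s
      show "\<bar>(dgauss k (x - s + h) - dgauss k (x - s) - h * dgauss (Suc k) (x - s)) * p s\<bar> \<le> C * h\<^sup>2 * \<bar>p s\<bar>"
        unfolding abs_mult using C dgauss_deriv
        by (intro mult_right_mono deriv_bound_imp_taylor1[where f'' = "dgauss (Suc (Suc k))"]) auto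
    qed (use assms in auto)
    also have "\<dots> = B * h\<^sup>2" unfolding B_def by simp
    finally show ?thesis .
  qed
  have "((\<lambda>h. (gtrans Q p k (x + h) - gtrans Q p k x) / h - gtrans Q p (Suc k) x) \<longlongrightarrow> 0) (at 0)"
  proof (rule Lim_null_comparison)
    show "\<forall>\<^sub>F h in at 0. norm ((gtrans Q p k (x + h) - gtrans Q p k x) / h - gtrans Q p (Suc k) x) \<le> B * \<bar>h\<bar>"
      unfolding eventually_at_filter
    proof (intro always_eventually allI impI)
      fix h :: real assume h: "h \<noteq> 0"
      have alg: "(D / h - g) * h = D - h * g" for D g :: real using h by (simp add: left_diff_distrib)
      have "\<bar>(gtrans Q p k (x + h) - gtrans Q p k x) / h - gtrans Q p (Suc k) x\<bar> * \<bar>h\<bar>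
        = \<bar>gtrans Q p k (x + h) - gtrans Q p k x - h * gtrans Q p (Suc k) x\<bar>"
        by (simp only: abs_mult[symmetric] alg)
      also have "\<dots> \<le> (B * \<bar>h\<bar>) * \<bar>h\<bar>" using *[of h] by (simp add: power2_eq_square mult.assoc)
      finally show "norm ((gtrans Q p k (x + h) - gtrans Q p k x) / h - gtrans Q p (Suc k) x) \<le> B * \<bar>h\<bar>"
        using h by simp
    qed
    show "((\<lambda>h. B * \<bar>h\<bar>) \<longlongrightarrow> 0) (at 0)" by (auto intro!: tendsto_eq_intros)
  qed
  then show ?thesis
    unfolding DERIV_def by (rule LIM_zero_cancel)
qed


section \<open>Counting zeros with differential operators\<close>

text \<open>Induction adding the largest point: the mean value theorem gives a zero of
  \<open>g'\<close> between the old maximum and the new point. The clause \<open>b < Max A\<close>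
  keeps it apart from the zeros found before.\<close>

lemma rolle_between:
  fixes g g' :: "real \<Rightarrow> real"
  assumes "finite A" "A \<noteq> {}" and "\<And>x. (g has_real_derivative g' x) (at x)" "\<And>a. a \<in> A \<Longrightarrow> g a = 0"
  shows "\<exists>B. finite B \<and> B \<inter> A = {} \<and> Suc (card B) = card A \<and> (\<forall>b\<in>B. g' b = 0) \<and> (\<forall>b\<in>B. b < Max A)"
  using assms(1,2,4)
proof (induction A rule: finite_linorder_max_induct)
  case (insert b A)
  show ?case
  proof (cases "A = {}")
    case True
    then show ?thesis by (intro exI[of _ "{}"]) auto
  next
    case False
    then obtain B where B: "finite B" "B \<inter> A = {}" "Suc (card B) = card A" "\<forall>b\<in>B. g' b = 0" "\<forall>b\<in>B. b < Max A"
      using insert by auto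
    have MA: "Max A \<in> A" "Max A < b" using insert False by auto
    have "\<exists>z>Max A. z < b \<and> g' z = 0"
    proof -
      have "\<exists>z>Max A. z < b \<and> g b - g (Max A) = (b - Max A) * g' z"
        using MA assms(3) by (intro MVT2) auto
      then show ?thesis using insert.prems MA by auto
    qed
    then obtain z where z: "Max A < z" "z < b" "g' z = 0" by blast
    have "z \<notin> B" using B(5) z by fastforce
    moreover have "z \<notin> A" using z insert.hyps Max_ge[of A z] by linarith
    moreover have "b \<notin> B" using B(5) MA by fastforce
    moreover have "Max (insert b A) = b" using Max_insert[OF insert.hyps(1) False, of b] MA(2) by linarith
    moreover have "b \<notin> A" using insert.hyps by auto
    ultimately show ?thesis
      using B z MA insert.hyps(1)
      by (intro exI[of _ "insert z B"]) auto
  qed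
qed simp

text \<open>\<open>F (Suc j)\<close> is \<open>(D - c j)\<close> applied to \<open>F j\<close>; for
  \<open>c = 0\<close> this is the sequence of ordinary derivatives. Stating it through the
  derivative of \<open>F j\<close> includes the smoothness of all members.\<close>

definition diff_chain :: "(nat \<Rightarrow> real) \<Rightarrow> (nat \<Rightarrow> real \<Rightarrow> real) \<Rightarrow> bool" where
  "diff_chain c F \<longleftrightarrow> (\<forall>j x. (F j has_real_derivative F (Suc j) x + c j * F j x) (at x))"

lemma diff_chainD: "diff_chain c F \<Longrightarrow> (F j has_real_derivative F (Suc j) x + c j * F j x) (at x)"
  by (simp add: diff_chain_def)

lemma diff_chain_Suc: "diff_chain c F \<Longrightarrow> diff_chain (\<lambda>j. c (Suc j)) (\<lambda>j. F (Suc j))"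
  by (simp add: diff_chain_def)

lemma diff_chain_diff:
  assumes "diff_chain c F" "diff_chain c G"
  shows "diff_chain c (\<lambda>j x. F j x - G j x)"
  unfolding diff_chain_def
  by (auto intro!: derivative_eq_intros diff_chainD[OF assms(1)] diff_chainD[OF assms(2)] simp: algebra_simps)

lemma diff_chain_cmult:
  assumes "diff_chain c F"
  shows "diff_chain c (\<lambda>j x. a * F j x)"
  unfolding diff_chain_def
  by (auto intro!: derivative_eq_intros diff_chainD[OF assms] simp: algebra_simps)

lemma diff_chain_sum:
  assumes "\<And>i. i \<in> I \<Longrightarrow> diff_chain c (F i)"
  shows "diff_chain c (\<lambda>j x. \<Sum>i\<in>I. F i j x)"
  unfolding diff_chain_def
  by (auto intro!: derivative_eq_intros diff_chainD[OF assms] simp: sum.distrib sum_distrib_left)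

text \<open>Rolle's theorem with multiplicities, applied to \<open>exp (- c x) * F j x\<close>: each step of the
  chain loses at most one zero.\<close>

lemma diff_chain_zero:
  assumes "diff_chain c F" "finite A" "\<And>a j. a \<in> A \<Longrightarrow> j < \<mu> a \<Longrightarrow> F j a = 0" "(\<Sum>a\<in>A. \<mu> a) > N"
  shows "\<exists>x. F N x = 0"
  using assms
proof (induction N arbitrary: c F A \<mu>)
  case 0
  then obtain a where "a \<in> A" "\<mu> a > 0" by (auto simp: sum_eq_0_iff neq0_conv[symmetric] simp del: neq0_conv)
  then show ?case using 0 by blast
next
  case (Suc N)
  \<comment> \<open>Nodes of multiplicity 0 are discarded, so that the natural number
    \<open>\<mu> a - 1\<close> below is a true difference.\<close>
  define A' where "A' = {a\<in>A. \<mu> a > 0}"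
  have A': "finite A'" "A' \<subseteq> A" using Suc.prems by (auto simp: A'_def)
  have sumA': "(\<Sum>a\<in>A'. \<mu> a) = (\<Sum>a\<in>A. \<mu> a)"
    using Suc.prems by (intro sum.mono_neutral_left) (auto simp: A'_def)
  have ne: "A' \<noteq> {}" using sumA' Suc.prems by auto
  have "((\<lambda>x. exp (- c 0 * x) * F 0 x) has_real_derivative exp (- c 0 * x) * F (Suc 0) x) (at x)" for x
    by (auto intro!: derivative_eq_intros diff_chainD[OF Suc.prems(1)] simp: algebra_simps)
  moreover have "exp (- c 0 * a) * F 0 a = 0" if "a \<in> A'" for a
    using that Suc.prems(3)[of a 0] by (auto simp: A'_def)
  ultimately obtain B where B: "finite B" "B \<inter> A' = {}" "Suc (card B) = card A'"
      "\<forall>b\<in>B. exp (- c 0 * b) * F (Suc 0) b = 0"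
    using rolle_between[OF A'(1) ne, of "\<lambda>x. exp (- c 0 * x) * F 0 x" "\<lambda>x. exp (- c 0 * x) * F (Suc 0) x"]
    by blast
  \<comment> \<open>Old zeros lose one order and each Rolle point brings one. There is one Rolle
    point fewer than old zeros, so the total drops by exactly one.\<close>
  define \<nu> where "\<nu> a = (if a \<in> A' then \<mu> a - 1 else 1)" for a
  show ?case
  proof (rule Suc.IH[OF diff_chain_Suc[OF Suc.prems(1)], of "A' \<union> B" \<nu>])
    show "finite (A' \<union> B)" using A' B by simp
    show "F (Suc j) a = 0" if "a \<in> A' \<union> B" "j < \<nu> a" for a j
      using that B(4) Suc.prems(3)[of a "Suc j"] A'(2) by (auto simp: \<nu>_def split: if_splits)
    have "(\<Sum>a\<in>A' \<union> B. \<nu> a) = (\<Sum>a\<in>A'. \<nu> a) + (\<Sum>a\<in>B. \<nu> a)"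
      using A' B by (intro sum.union_disjoint) auto
    also have "(\<Sum>a\<in>B. \<nu> a) = (\<Sum>a\<in>B. 1)"
      using B by (intro sum.cong) (auto simp: \<nu>_def)
    also have "(\<Sum>a\<in>A'. \<nu> a) = (\<Sum>a\<in>A'. \<mu> a - 1)"
      by (intro sum.cong) (auto simp: \<nu>_def)
    also have "(\<Sum>a\<in>A'. \<mu> a) = (\<Sum>a\<in>A'. (\<mu> a - 1) + 1)"
      by (intro sum.cong) (auto simp: A'_def)
    then have "(\<Sum>a\<in>A'. \<mu> a) = (\<Sum>a\<in>A'. \<mu> a - 1) + card A'"
      by (simp add: sum.distrib del: One_nat_def)
    ultimately have "(\<Sum>a\<in>A' \<union> B. \<nu> a) + 1 = (\<Sum>a\<in>A'. \<mu> a)"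
      using B(3) by simp
    then show "N < (\<Sum>a\<in>A' \<union> B. \<nu> a)" using sumA' Suc.prems(4) by simp
  qed
qed

text \<open>By the product rule each \<open>D - c j\<close> turns exp(x^2/2) times a polynomial
  combination of derivatives of \<open>E 0\<close> into another such expression, using one more
  derivative. Zeros of \<open>E 0\<close> therefore pass to the twisted chain with their
  order.\<close>

lemma diff_chain_mult_coeffs:
  fixes u :: "real \<Rightarrow> real"
  assumes F: "diff_chain c F" and E: "diff_chain (\<lambda>_. 0) E"
    and F0: "\<And>x. F 0 x = exp (x\<^sup>2 / 2) * E 0 x"
  shows "\<exists>q. \<forall>x. F j x = exp (x\<^sup>2 / 2) * (\<Sum>i\<le>j. poly (q i) x * E i x)"
proof (induction j)
  case 0
  show ?case using F0 by (intro exI[of _ "\<lambda>_. 1"]) auto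
next
  case (Suc j)
  then obtain q where q: "\<And>x. F j x = exp (x\<^sup>2 / 2) * (\<Sum>i\<le>j. poly (q i) x * E i x)" by blast
  \<comment> \<open>The factor \<open>x\<close> from differentiating exp(x^2/2) combines with
    \<open>- c j\<close> to the multiplier \<open>x - c j\<close>; the shifted term
    \<open>q (i - 1)\<close> comes from differentiating \<open>E (i - 1)\<close>.\<close>
  define r where "r i = (if i \<le> j then pderiv (q i) + [:- c j, 1:] * q i else 0) + (if i = 0 then 0 else q (i - 1))" for i
  have "F (Suc j) x = exp (x\<^sup>2 / 2) * (\<Sum>i\<le>Suc j. poly (r i) x * E i x)" for x
  proof -
    have E': "(E i has_real_derivative E (Suc i) x) (at x)" for i using diff_chainD[OF E, of i x] by simp
    have "((\<lambda>x. exp (x\<^sup>2 / 2) * (\<Sum>i\<le>j. poly (q i) x * E i x)) has_real_derivative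
        exp (x\<^sup>2 / 2) * x * (\<Sum>i\<le>j. poly (q i) x * E i x) + exp (x\<^sup>2 / 2) *
        (\<Sum>i\<le>j. poly (pderiv (q i)) x * E i x + poly (q i) x * E (Suc i) x)) (at x)"
      by (auto intro!: derivative_eq_intros poly_DERIV E' simp: algebra_simps sum.distrib)
    then have "(F j has_real_derivative
        exp (x\<^sup>2 / 2) * x * (\<Sum>i\<le>j. poly (q i) x * E i x) + exp (x\<^sup>2 / 2) *
        (\<Sum>i\<le>j. poly (pderiv (q i)) x * E i x + poly (q i) x * E (Suc i) x)) (at x)"
      by (simp only: q[abs_def])
    then have "F (Suc j) x + c j * F j x = exp (x\<^sup>2 / 2) * x * (\<Sum>i\<le>j. poly (q i) x * E i x) + exp (x\<^sup>2 / 2) *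
        (\<Sum>i\<le>j. poly (pderiv (q i)) x * E i x + poly (q i) x * E (Suc i) x)"
      using DERIV_unique[OF diff_chainD[OF F, of j x]] by blast
    then have "F (Suc j) x = exp (x\<^sup>2 / 2) * ((x - c j) * (\<Sum>i\<le>j. poly (q i) x * E i x) +
        (\<Sum>i\<le>j. poly (pderiv (q i)) x * E i x + poly (q i) x * E (Suc i) x))"
      by (simp add: q algebra_simps)
    also have "(x - c j) * (\<Sum>i\<le>j. poly (q i) x * E i x) +
        (\<Sum>i\<le>j. poly (pderiv (q i)) x * E i x + poly (q i) x * E (Suc i) x)
       = (\<Sum>i\<le>j. poly (pderiv (q i) + [:- c j, 1:] * q i) x * E i x) + (\<Sum>i\<le>j. poly (q i) x * E (Suc i) x)"
      by (simp add: sum_distrib_left sum.distrib sum_subtractf algebra_simps)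
    also have "(\<Sum>i\<le>j. poly (q i) x * E (Suc i) x) = (\<Sum>i\<le>Suc j. poly (if i = 0 then 0 else q (i - 1)) x * E i x)"
      by (simp add: sum.atMost_Suc_shift del: sum.atMost_Suc)
    also have "(\<Sum>i\<le>j. poly (pderiv (q i) + [:- c j, 1:] * q i) x * E i x)
       = (\<Sum>i\<le>Suc j. poly (if i \<le> j then pderiv (q i) + [:- c j, 1:] * q i else 0) x * E i x)"
      by simp
    also have "\<dots> + (\<Sum>i\<le>Suc j. poly (if i = 0 then 0 else q (i - 1)) x * E i x) = (\<Sum>i\<le>Suc j. poly (r i) x * E i x)"
      unfolding r_def poly_add sum.distrib[symmetric] distrib_right ..
    finally show ?thesis .
  qed
  then show ?case by blast
qed

lemma diff_chain_mult_zero: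
  assumes "diff_chain c F" "diff_chain (\<lambda>_. 0) E" "\<And>x. F 0 x = exp (x\<^sup>2 / 2) * E 0 x"
    and "\<And>i. i < m \<Longrightarrow> E i a = 0" "j < m"
  shows "F j a = 0"
proof -
  obtain q where "\<And>x. F j x = exp (x\<^sup>2 / 2) * (\<Sum>i\<le>j. poly (q i) x * E i x)"
    using diff_chain_mult_coeffs[OF assms(1-3)] by blast
  then show ?thesis using assms(4,5) by simp
qed

text \<open>Exponential polynomials: \<open>D - c\<close> maps \<open>q(x) exp (\<xi> x)\<close> to \<open>(q' + (\<xi> - c) q)(x) exp (\<xi> x)\<close>.\<close>

primrec exppoly_coeff :: "(nat \<Rightarrow> real) \<Rightarrow> real \<Rightarrow> real poly \<Rightarrow> nat \<Rightarrow> real poly" where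
  "exppoly_coeff c \<xi> q 0 = q"
| "exppoly_coeff c \<xi> q (Suc j) =
     pderiv (exppoly_coeff c \<xi> q j) + Polynomial.smult (\<xi> - c j) (exppoly_coeff c \<xi> q j)"

lemma diff_chain_exppoly: "diff_chain c (\<lambda>j x. poly (exppoly_coeff c \<xi> q j) x * exp (\<xi> * x))"
  unfolding diff_chain_def
  by (auto intro!: derivative_eq_intros poly_DERIV simp: algebra_simps)

text \<open>A step with \<open>c j = \<xi>\<close> is a plain derivative of the coefficient and
  lowers its degree (or kills it); any other step does not raise the degree.\<close>

lemma degree_exppoly_coeff:
  assumes "exppoly_coeff c \<xi> q j \<noteq> 0"
  shows "degree (exppoly_coeff c \<xi> q j) + card {i. i < j \<and> c i = \<xi>} \<le> degree q"
  using assms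
proof (induction j)
  case (Suc j)
  let ?r = "exppoly_coeff c \<xi> q j"
  have "?r \<noteq> 0" using Suc.prems by auto
  then have IH: "degree ?r + card {i. i < j \<and> c i = \<xi>} \<le> degree q" using Suc.IH by blast
  show ?case
  proof (cases "c j = \<xi>")
    case True
    have "{i. i < Suc j \<and> c i = \<xi>} = insert j {i. i < j \<and> c i = \<xi>}" using True by (auto simp: less_Suc_eq)
    then have "card {i. i < Suc j \<and> c i = \<xi>} = Suc (card {i. i < j \<and> c i = \<xi>})" by simp
    moreover have "degree ?r \<noteq> 0" using Suc.prems True pderiv_eq_0_iff by auto
    ultimately show ?thesis using IH True by (simp add: degree_pderiv)
  next
    case False
    have "{i. i < Suc j \<and> c i = \<xi>} = {i. i < j \<and> c i = \<xi>}" using False by (auto simp: less_Suc_eq)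
    moreover have "degree (exppoly_coeff c \<xi> q (Suc j)) \<le> degree ?r"
      by (auto intro!: degree_add_le degree_smult_le simp: degree_pderiv)
    ultimately show ?thesis using IH by simp
  qed
qed simp

lemma exppoly_coeff_eq_0:
  assumes "degree q < card {i. i < j \<and> c i = \<xi>}"
  shows "exppoly_coeff c \<xi> q j = 0"
  using degree_exppoly_coeff[of c \<xi> q j] assms by linarith

text \<open>Lists the nodes with repetition as the roots of the differential operator. The count of
  occurrences serves to annihilate exponential polynomials, the product formula to find the sign of
  what remains.\<close>

lemma node_list_exists:
  fixes A :: "real set"
  assumes "finite A"
  shows "\<exists>c. (\<forall>a\<in>A. card {i. i < sum \<mu> A \<and> c i = a} = \<mu> a) \<and>
      (\<forall>s. (\<Prod>i<sum \<mu> A. s - c i) = (\<Prod>a\<in>A. (s - a) ^ \<mu> a))"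
  using assms
proof (induction A)
  case (insert a A)
  then obtain c where c: "\<And>b. b \<in> A \<Longrightarrow> card {i. i < sum \<mu> A \<and> c i = b} = \<mu> b"
      "\<And>s. (\<Prod>i<sum \<mu> A. s - c i) = (\<Prod>a\<in>A. (s - a) ^ \<mu> a)" by blast
  define d where "d i = (if i < sum \<mu> A then c i else a)" for i
  have sum: "sum \<mu> (insert a A) = sum \<mu> A + \<mu> a" using insert.hyps by simp
  have "card {i. i < sum \<mu> A + \<mu> a \<and> d i = b} = \<mu> b" if b: "b \<in> insert a A" for b
  proof (cases "b = a")
    case True
    \<comment> \<open>The product over the old nodes is nonzero at the new node \<open>a\<close>,
      hence \<open>a\<close> is not yet in the list.\<close>
    have "c i \<noteq> a" if "i < sum \<mu> A" for i
    proof
      assume "c i = a"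
      then have "(\<Prod>j<sum \<mu> A. a - c j) = 0" using that by (intro prod_zero) auto
      then show False using c(2)[of a] insert.hyps by auto
    qed
    then have "{i. i < sum \<mu> A + \<mu> a \<and> d i = b} = {sum \<mu> A..<sum \<mu> A + \<mu> a}"
      using True by (auto simp: d_def)
    then show ?thesis using True by simp
  next
    case False
    then have "{i. i < sum \<mu> A + \<mu> a \<and> d i = b} = {i. i < sum \<mu> A \<and> c i = b}"
      by (auto simp: d_def)
    then show ?thesis using c(1)[of b] False b by simp
  qed
  moreover have "(\<Prod>i<sum \<mu> A + \<mu> a. s - d i) = (\<Prod>a\<in>insert a A. (s - a) ^ \<mu> a)" for s
  proof -
    have "(\<Prod>i<sum \<mu> A + k. s - d i) = (\<Prod>i<sum \<mu> A. s - c i) * (s - a) ^ k" for k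
      by (induction k) (auto simp: d_def intro!: prod.cong)
    then show ?thesis using insert.hyps c(2) by (simp add: mult.commute)
  qed
  ultimately show ?case unfolding sum by blast
qed simp


section \<open>Linear systems under perturbation\<close>

lemma tendsto_det_mat:
  fixes g :: "nat \<Rightarrow> nat \<Rightarrow> real"
  assumes "\<And>r s. r < m \<Longrightarrow> s < m \<Longrightarrow> ((\<lambda>n. gn n r s) \<longlongrightarrow> g r s) F"
  shows "((\<lambda>n. Determinant.det (Matrix.mat m m (\<lambda>(r, s). gn n r s)))
    \<longlongrightarrow> Determinant.det (Matrix.mat m m (\<lambda>(r, s). g r s))) F"
proof -
  have eq: "Determinant.det (Matrix.mat m m (\<lambda>(r, s). h r s)) =
      (\<Sum>p\<in>{p. p permutes {0..<m}}. signof p * (\<Prod>i = 0..<m. h i (p i)))" for h :: "nat \<Rightarrow> nat \<Rightarrow> real"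
    by (subst Determinant.det_def'[of _ m]) (auto intro!: sum.cong prod.cong simp: permutes_in_image)
  show ?thesis
    unfolding eq
    by (intro tendsto_sum tendsto_mult tendsto_const tendsto_prod assms)
      (auto simp: permutes_in_image)
qed

text \<open>Cramer's rule: the determinant and the entries of the adjugate are polynomials in the
  matrix entries. A trivial kernel makes the limit determinant nonzero, so it is nonzero eventually,
  and the quotients giving the solution converge.\<close>

lemma eventually_solve_linear:
  fixes G :: "'i \<Rightarrow> 'i \<Rightarrow> real" and Gn :: "nat \<Rightarrow> 'i \<Rightarrow> 'i \<Rightarrow> real"
  assumes fin: "finite I"
    and lim: "\<And>i j. i \<in> I \<Longrightarrow> j \<in> I \<Longrightarrow> (\<lambda>n. Gn n i j) \<longlonglongrightarrow> G i j"
    and ker: "\<And>b. (\<And>i. i \<in> I \<Longrightarrow> (\<Sum>j\<in>I. G i j * b j) = 0) \<Longrightarrow> (\<forall>j\<in>I. b j = 0)"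
  shows "\<exists>b bn. (\<forall>i\<in>I. (\<Sum>j\<in>I. G i j * b j) = v i) \<and> (\<forall>j\<in>I. (\<lambda>n. bn n j) \<longlonglongrightarrow> b j) \<and>
     (\<forall>\<^sub>F n in sequentially. (\<forall>i\<in>I. (\<Sum>j\<in>I. Gn n i j * bn n j) = v i) \<and>
       (\<forall>c. (\<forall>i\<in>I. (\<Sum>j\<in>I. Gn n i j * c j) = 0) \<longrightarrow> (\<forall>j\<in>I. c j = 0)))"
proof -
  define d where "d = card I"
  obtain e where e: "bij_betw e {0..<d} I" using ex_bij_betw_nat_finite[OF fin] d_def by blast
  define k where "k = the_inv_into {0..<d} e"
  have ke: "k (e r) = r" if "r < d" for r
    using e that unfolding k_def by (auto simp: bij_betw_def intro!: the_inv_into_f_f)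
  have ek: "e (k i) = i" "k i < d" if "i \<in> I" for i
    using that f_the_inv_into_f_bij_betw[OF e] bij_betw_apply[OF bij_betw_the_inv_into[OF e]]
    unfolding k_def by auto
  have eI: "e r \<in> I" if "r < d" for r using e that by (auto simp: bij_betw_def)
  have sumI: "(\<Sum>j\<in>I. f j) = (\<Sum>s = 0..<d. f (e s))" for f :: "'i \<Rightarrow> real"
    using sum.reindex_bij_betw[OF e, of f] by simp
  define MM where "MM g = Matrix.mat d d (\<lambda>(r, s). g (e r) (e s))" for g :: "'i \<Rightarrow> 'i \<Rightarrow> real"
  have MM: "MM g \<in> carrier_mat d d" for g by (simp add: MM_def)
  define D where "D g = Determinant.det (MM g)" for g
  define C where "C g r s = index_mat (adj_mat (MM g)) (r, s)" for g r s
  have adj1: "(\<Sum>s = 0..<d. g (e r) (e s) * C g s t) = (if r = t then D g else 0)" if "r < d" "t < d" for g r t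
  proof -
    have "index_mat (MM g * adj_mat (MM g)) (r, t) = (\<Sum>s = 0..<d. g (e r) (e s) * C g s t)"
      using that adj_mat(1)[OF MM, of g] by (auto simp: MM_def C_def scalar_prod_def intro!: sum.cong)
    then show ?thesis using that unfolding adj_mat(2)[OF MM] by (auto simp: D_def)
  qed
  have adj2: "(\<Sum>s = 0..<d. C g r s * g (e s) (e t)) = (if r = t then D g else 0)" if "r < d" "t < d" for g r t
  proof -
    have "index_mat (adj_mat (MM g) * MM g) (r, t) = (\<Sum>s = 0..<d. C g r s * g (e s) (e t))"
      using that adj_mat(1)[OF MM, of g] by (auto simp: MM_def C_def scalar_prod_def intro!: sum.cong)
    then show ?thesis using that unfolding adj_mat(3)[OF MM] by (auto simp: D_def)
  qed
  define sol where "sol g i = (\<Sum>r = 0..<d. C g (k i) r * v (e r)) / D g" for g i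
  have solves: "(\<Sum>j\<in>I. g i j * sol g j) = v i" if "D g \<noteq> 0" "i \<in> I" for g i
  proof -
    have "sol g i * D g = (\<Sum>r = 0..<d. C g (k i) r * v (e r))" for i
      using that by (simp add: sol_def)
    then have "(\<Sum>j\<in>I. g i j * sol g j) * D g = (\<Sum>s = 0..<d. \<Sum>r = 0..<d. g i (e s) * C g s r * v (e r))"
      unfolding sumI using ke
      by (auto simp: sum_distrib_left sum_distrib_right mult.assoc intro!: sum.cong)
    also have "\<dots> = (\<Sum>r = 0..<d. (\<Sum>s = 0..<d. g (e (k i)) (e s) * C g s r) * v (e r))"
      using ek[OF that(2)] by (subst sum.swap) (simp add: sum_distrib_right)
    also have "\<dots> = (\<Sum>r = 0..<d. (if k i = r then D g else 0) * v (e r))"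
      using ek[OF that(2)] by (intro sum.cong refl arg_cong2[where f = "(*)"] adj1) auto
    also have "\<dots> = D g * v i"
      using ek[OF that(2)] by (simp add: if_distrib[of "\<lambda>x. x * _"] cong: if_cong)
    finally show ?thesis using that by simp
  qed
  have unique: "c j = 0" if "D g \<noteq> 0" "\<And>i. i \<in> I \<Longrightarrow> (\<Sum>j\<in>I. g i j * c j) = 0" "j \<in> I" for g c j
  proof -
    have "0 = (\<Sum>s = 0..<d. C g (k j) s * (\<Sum>j\<in>I. g (e s) j * c j))"
      using that(2) eI by simp
    also have "\<dots> = (\<Sum>t = 0..<d. (\<Sum>s = 0..<d. C g (k j) s * g (e s) (e t)) * c (e t))"
      unfolding sumI sum_distrib_left sum_distrib_right
      by (subst sum.swap) (simp add: mult.assoc)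
    also have "\<dots> = (\<Sum>t = 0..<d. (if k j = t then D g else 0) * c (e t))"
      using ek[OF that(3)] by (intro sum.cong refl arg_cong2[where f = "(*)"] adj2) auto
    also have "\<dots> = D g * c j"
      using ek[OF that(3)] by (simp add: if_distrib[of "\<lambda>x. x * _"] cong: if_cong)
    finally show ?thesis using that(1) by simp
  qed
  have DG: "D G \<noteq> 0"
  proof
    assume "D G = 0"
    then obtain w where w: "w \<in> carrier_vec d" "w \<noteq> 0\<^sub>v d" "MM G *\<^sub>v w = 0\<^sub>v d"
      using det_0_iff_vec_prod_zero[OF MM, of G] by (auto simp: D_def)
    have "\<forall>j\<in>I. vec_index w (k j) = 0"
    proof (rule ker)
      fix i assume i: "i \<in> I"
      have "0 = vec_index (MM G *\<^sub>v w) (k i)" using w(3) ek[OF i] by simp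
      also have "\<dots> = (\<Sum>s = 0..<d. G (e (k i)) (e s) * vec_index w s)"
        using ek[OF i] w(1) by (auto simp: MM_def scalar_prod_def intro!: sum.cong)
      also have "\<dots> = (\<Sum>j\<in>I. G i j * vec_index w (k j))"
        unfolding sumI using ek[OF i] ke by (auto intro!: sum.cong)
      finally show "(\<Sum>j\<in>I. G i j * vec_index w (k j)) = 0" by simp
    qed
    then have "vec_index w r = 0" if "r < d" for r using eI[OF that] ke[OF that] by metis
    then have "w = 0\<^sub>v d" using w(1) by (intro eq_vecI) auto
    with w(2) show False by blast
  qed
  have limD: "(\<lambda>n. D (Gn n)) \<longlonglongrightarrow> D G"
    unfolding D_def MM_def by (intro tendsto_det_mat lim eI)
  have limC: "(\<lambda>n. C (Gn n) r s) \<longlonglongrightarrow> C G r s" if "r < d" "s < d" for r s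
  proof -
    \<comment> \<open>\<open>i a j\<close> numbers the rows or columns that remain once index
      \<open>j\<close> is deleted, so that the cofactor becomes the determinant of an explicit
      matrix.\<close>
    define i where "i a j = (if a < j then a else Suc a)" for a j :: nat
    have i: "i a j < d" if "a < d - 1" for a j using that by (auto simp: i_def)
    have "C g r s = (-1) ^ (s + r) *
        Determinant.det (Matrix.mat (d - 1) (d - 1) (\<lambda>(a, b). g (e (i a s)) (e (i b r))))" for g
    proof -
      have "mat_delete (MM g) s r = Matrix.mat (d - 1) (d - 1) (\<lambda>(a, b). g (e (i a s)) (e (i b r)))"
        using that by (intro eq_matI) (auto simp: mat_delete_def MM_def i_def)
      then show ?thesis
        using that MM[of g] by (simp add: C_def adj_mat_def cofactor_def)
    qed
    then show ?thesis
      by (simp only:) (intro tendsto_mult tendsto_const tendsto_det_mat lim eI i)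
  qed
  have "\<forall>\<^sub>F n in sequentially. D (Gn n) \<noteq> 0"
    using tendsto_imp_eventually_ne[OF limD DG] .
  then have "\<forall>\<^sub>F n in sequentially. (\<forall>i\<in>I. (\<Sum>j\<in>I. Gn n i j * sol (Gn n) j) = v i) \<and>
       (\<forall>c. (\<forall>i\<in>I. (\<Sum>j\<in>I. Gn n i j * c j) = 0) \<longrightarrow> (\<forall>j\<in>I. c j = 0))"
    by eventually_elim (use solves unique in blast)
  moreover have "(\<lambda>n. sol (Gn n) j) \<longlonglongrightarrow> sol G j" if "j \<in> I" for j
    unfolding sol_def using ek[OF that] DG
    by (intro tendsto_divide tendsto_sum tendsto_mult limC limD tendsto_const) auto
  ultimately show ?thesis
    using solves[OF DG] by (intro exI[of _ "sol G"] exI[of _ "\<lambda>n. sol (Gn n)"]) blast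
qed


section \<open>The kernel in the space of square integrable functions\<close>

lemma L2_measurable: "f \<in> L2 Q \<Longrightarrow> f \<in> borel_measurable Q"
  by (simp add: L2_def)

lemma L2_mult_integrable:
  assumes "f \<in> L2 Q" "g \<in> L2 Q"
  shows "integrable Q (\<lambda>s. f s * g s)"
proof (rule Bochner_Integration.integrable_bound)
  show "integrable Q (\<lambda>s. (f s)\<^sup>2 + (g s)\<^sup>2)" using assms by (simp add: L2_def)
  show "(\<lambda>s. f s * g s) \<in> borel_measurable Q" using assms[THEN L2_measurable] by measurable
  show "AE s in Q. norm (f s * g s) \<le> norm ((f s)\<^sup>2 + (g s)\<^sup>2)"
  proof (intro AE_I2)
    fix s
    have "2 * \<bar>f s * g s\<bar> \<le> (f s)\<^sup>2 + (g s)\<^sup>2"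
      using sum_squares_bound[of "\<bar>f s\<bar>" "\<bar>g s\<bar>"] by (simp add: abs_mult)
    then have "\<bar>f s * g s\<bar> \<le> (f s)\<^sup>2 + (g s)\<^sup>2" by (smt (verit) abs_ge_zero)
    then show "norm (f s * g s) \<le> norm ((f s)\<^sup>2 + (g s)\<^sup>2)" by simp
  qed
qed

lemma L2_add: "f \<in> L2 Q \<Longrightarrow> g \<in> L2 Q \<Longrightarrow> (\<lambda>s. f s + g s) \<in> L2 Q"
  using L2_mult_integrable[of f Q g]
  by (auto simp: L2_def power2_sum mult.assoc intro!: borel_measurable_add Bochner_Integration.integrable_add)

lemma L2_cmult: "f \<in> L2 Q \<Longrightarrow> (\<lambda>s. c * f s) \<in> L2 Q"
  by (auto simp: L2_def power_mult_distrib)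

lemma L2_diff: "f \<in> L2 Q \<Longrightarrow> g \<in> L2 Q \<Longrightarrow> (\<lambda>s. f s - g s) \<in> L2 Q"
  using L2_add[of f Q "\<lambda>s. (-1) * g s"] L2_cmult[of g Q "-1"] by simp

lemma L2_sum: "(\<And>i. i \<in> I \<Longrightarrow> f i \<in> L2 Q) \<Longrightarrow> (\<lambda>s. \<Sum>i\<in>I. f i s) \<in> L2 Q"
proof (induction I rule: infinite_finite_induct)
  case (insert i I)
  then show ?case using L2_add[of "f i" Q "\<lambda>s. \<Sum>i\<in>I. f i s"] by simp
qed (simp_all add: L2_def)

lemma L2_eq_if_integral_le_0:
  assumes "f \<in> L2 Q" "g \<in> L2 Q" "(\<integral>s. (f s - g s)\<^sup>2 \<partial>Q) \<le> 0"
  shows "L2_eq Q f g"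
proof -
  have "integrable Q (\<lambda>s. (f s - g s)\<^sup>2)" using L2_diff[OF assms(1,2)] by (simp add: L2_def)
  moreover have "(\<integral>s. (f s - g s)\<^sup>2 \<partial>Q) = 0" using assms(3) by (intro antisym) auto
  ultimately have "AE s in Q. (f s - g s)\<^sup>2 = 0"
    using integral_nonneg_eq_0_iff_AE[of Q "\<lambda>s. (f s - g s)\<^sup>2"] by simp
  then show ?thesis unfolding L2_eq_def by simp
qed

lemma L2_norm_power2: "(L2_norm Q f)\<^sup>2 = (\<integral>s. (f s)\<^sup>2 \<partial>Q)"
  unfolding L2_norm_def L2_inner_def by (simp add: power2_eq_square)

lemma L2_imp_integrable:
  assumes "finite_measure Q" "f \<in> L2 Q"
  shows "integrable Q f"
proof -
  interpret finite_measure Q by fact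
  have "(\<lambda>_. 1) \<in> L2 Q" by (simp add: L2_def)
  from L2_mult_integrable[OF this assms(2)] show ?thesis by simp
qed

lemma L2_norm_le_bound:
  assumes "finite_measure Q" "AE s in Q. \<bar>f s\<bar> \<le> B" "0 \<le> B"
  shows "L2_norm Q f \<le> B * sqrt (measure Q (space Q))"
proof -
  interpret finite_measure Q by fact
  have "(\<integral>s. f s * f s \<partial>Q) \<le> B\<^sup>2 * measure Q (space Q)"
  proof (cases "integrable Q (\<lambda>s. f s * f s)")
    case True
    have "(\<integral>s. f s * f s \<partial>Q) \<le> (\<integral>s. B\<^sup>2 \<partial>Q)"
      using True assms(2)
    proof (intro integral_mono_AE)
      show "AE s in Q. f s * f s \<le> B\<^sup>2" using assms(2)
        by eventually_elim (metis abs_ge_zero abs_mult_self_eq power2_eq_square power_mono)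
    qed auto
    then show ?thesis by (simp add: mult.commute)
  next
    \<comment> \<open>The integral of a nonintegrable function is 0 by convention, so the bound is
      trivial.\<close>
    case False
    then show ?thesis by (simp add: not_integrable_integral_eq)
  qed
  then have "L2_norm Q f \<le> sqrt (B\<^sup>2 * measure Q (space Q))"
    unfolding L2_norm_def L2_inner_def by simp
  also have "\<dots> = B * sqrt (measure Q (space Q))" using assms(3) by (simp add: real_sqrt_mult)
  finally show ?thesis .
qed

text \<open>With \<open>q\<close> the difference quotient, the squared distance of the two
  derivatives is at most twice the sum of their squared distances to \<open>q\<close>, which tends
  to 0. The limit says something only because \<open>x\<close> is a limit point of
  \<open>X\<close>.\<close>

lemma has_L2_derivative_unique:
  assumes "has_L2_derivative Q X f f' x" "has_L2_derivative Q X f g' x" "x \<in> X" "at x within X \<noteq> bot"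
  shows "L2_eq Q f' g'"
proof -
  define q where "q y s = (f y s - f x s) / (y - x)" for y s
  have L2: "f' \<in> L2 Q" "g' \<in> L2 Q" "\<And>y. y \<in> X \<Longrightarrow> f y \<in> L2 Q"
    using assms by (auto simp: has_L2_derivative_def)
  have q: "q y \<in> L2 Q" if "y \<in> X" for y
    using L2_cmult[OF L2_diff[OF L2(3)[OF that] L2(3)[OF assms(3)]], of "1 / (y - x)"]
    by (simp add: q_def[abs_def])
  define N where "N y = 2 * (L2_norm Q (\<lambda>s. q y s - f' s))\<^sup>2 + 2 * (L2_norm Q (\<lambda>s. q y s - g' s))\<^sup>2" for y
  have "(N \<longlongrightarrow> 2 * 0\<^sup>2 + 2 * 0\<^sup>2) (at x within X)"
    unfolding N_def q_def using assms
    by (intro tendsto_add tendsto_mult tendsto_const tendsto_power) (auto simp: has_L2_derivative_def)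
  then have "(N \<longlongrightarrow> 0) (at x within X)" by simp
  moreover have "\<forall>\<^sub>F y in at x within X. (\<integral>s. (f' s - g' s)\<^sup>2 \<partial>Q) \<le> N y"
    unfolding eventually_at_filter
  proof (intro always_eventually allI impI)
    fix y assume "y \<noteq> x" "y \<in> X"
    note qy = q[OF \<open>y \<in> X\<close>]
    have int: "integrable Q (\<lambda>s. (q y s - f' s)\<^sup>2)" "integrable Q (\<lambda>s. (q y s - g' s)\<^sup>2)"
      using L2_diff[OF qy L2(1)] L2_diff[OF qy L2(2)] by (auto simp: L2_def)
    have "(\<integral>s. (f' s - g' s)\<^sup>2 \<partial>Q) \<le> (\<integral>s. 2 * (q y s - f' s)\<^sup>2 + 2 * (q y s - g' s)\<^sup>2 \<partial>Q)"
    proof (rule integral_mono)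
      show "integrable Q (\<lambda>s. (f' s - g' s)\<^sup>2)" using L2_diff[OF L2(1,2)] by (auto simp: L2_def)
      show "(f' s - g' s)\<^sup>2 \<le> 2 * (q y s - f' s)\<^sup>2 + 2 * (q y s - g' s)\<^sup>2" for s
        using zero_le_power2[of "(q y s - f' s) + (q y s - g' s)"]
        by (simp add: power2_eq_square algebra_simps)
    qed (use int in auto)
    also have "\<dots> = N y" using int by (simp add: N_def L2_norm_power2)
    finally show "(\<integral>s. (f' s - g' s)\<^sup>2 \<partial>Q) \<le> N y" .
  qed
  ultimately have "(\<integral>s. (f' s - g' s)\<^sup>2 \<partial>Q) \<le> 0"
    using assms(4) tendsto_lowerbound by blast
  then show ?thesis using L2 by (intro L2_eq_if_integral_le_0)
qed

lemma dgauss_L2: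
  assumes "finite_measure Q" "sets Q = sets borel"
  shows "(\<lambda>s. dgauss k (x - s)) \<in> L2 Q"
proof -
  interpret finite_measure Q by fact
  have [measurable_cong]: "sets Q = sets borel" by fact
  obtain C where "\<And>u. \<bar>dgauss k u\<bar> \<le> C" using dgauss_bounded by blast
  then have C: "\<And>u. \<bar>dgauss k u\<bar> \<le> \<bar>C\<bar>" by (meson abs_ge_self order_trans)
  have "integrable Q (\<lambda>s. (dgauss k (x - s))\<^sup>2)"
    using C by (intro integrable_const_bound[of _ "C\<^sup>2"])
      (auto intro!: AE_I2 simp: abs_le_square_iff[symmetric])
  then show ?thesis by (simp add: L2_def)
qed

text \<open>The function is only asked to agree with the Gaussian derivative almost everywhere,
  because iterated values of \<open>L2_deriv\<close> are known only up to null sets.\<close>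

lemma has_L2_derivative_dgauss:
  assumes Q: "finite_measure Q" "sets Q = sets borel"
    and f: "\<And>y. y \<in> X \<Longrightarrow> f y \<in> L2 Q" "\<And>y. y \<in> X \<Longrightarrow> L2_eq Q (f y) (\<lambda>s. dgauss k (y - s))"
    and x: "x \<in> X"
  shows "has_L2_derivative Q X f (\<lambda>s. dgauss (Suc k) (x - s)) x"
proof -
  obtain C where C: "C > 0" "\<And>u. \<bar>dgauss (Suc (Suc k)) u\<bar> \<le> C" using dgauss_bounded by blast
  have bound: "L2_norm Q (\<lambda>s. (f y s - f x s) / (y - x) - dgauss (Suc k) (x - s))
      \<le> C * \<bar>y - x\<bar> * sqrt (measure Q (space Q))" if y: "y \<noteq> x" "y \<in> X" for y
  proof (rule L2_norm_le_bound)
    have "AE s in Q. f y s = dgauss k (y - s)" "AE s in Q. f x s = dgauss k (x - s)"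
      using f(2) y x by (auto simp: L2_eq_def)
    then show "AE s in Q. \<bar>(f y s - f x s) / (y - x) - dgauss (Suc k) (x - s)\<bar> \<le> C * \<bar>y - x\<bar>"
    proof eventually_elim
      case (elim s)
      have alg: "(a / h - g) * h = a - h * g" if "h \<noteq> 0" for a h g :: real
        using that by (simp add: left_diff_distrib)
      define D where "D = (f y s - f x s) / (y - x) - dgauss (Suc k) (x - s)"
      have "D * (y - x) = dgauss k (x - s + (y - x)) - dgauss k (x - s) - (y - x) * dgauss (Suc k) (x - s)"
        using alg[of "y - x"] y elim by (simp add: D_def)
      then have "\<bar>D * (y - x)\<bar> \<le> C * (y - x)\<^sup>2"
        using C dgauss_deriv deriv_bound_imp_taylor1[of "dgauss k" "dgauss (Suc k)" "dgauss (Suc (Suc k))" "x - s" "y - x" C]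
        by auto
      then have "\<bar>D\<bar> * \<bar>y - x\<bar> \<le> (C * \<bar>y - x\<bar>) * \<bar>y - x\<bar>"
        by (simp add: abs_mult power2_eq_square)
      then show ?case using y unfolding D_def by (simp add: mult_le_cancel_right)
    qed
  qed (use Q C in auto)
  have "((\<lambda>y. L2_norm Q (\<lambda>s. (f y s - f x s) / (y - x) - dgauss (Suc k) (x - s))) \<longlongrightarrow> 0) (at x within X)"
  proof (rule Lim_null_comparison)
    show "((\<lambda>y. C * \<bar>y - x\<bar> * sqrt (measure Q (space Q))) \<longlongrightarrow> 0) (at x within X)"
      by (auto intro!: tendsto_eq_intros)
    show "\<forall>\<^sub>F y in at x within X. norm (L2_norm Q (\<lambda>s. (f y s - f x s) / (y - x) - dgauss (Suc k) (x - s)))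
        \<le> C * \<bar>y - x\<bar> * sqrt (measure Q (space Q))"
      unfolding eventually_at_filter using bound
      by (intro always_eventually allI impI) (simp add: L2_norm_def L2_inner_def)
  qed
  then show ?thesis
    using f dgauss_L2[OF Q] by (simp add: has_L2_derivative_def)
qed

lemma gauss_eq_dgauss: "gauss x = (\<lambda>s. dgauss 0 (x - s))"
  by (simp add: gauss_def dgauss_0 fun_eq_iff)

text \<open>\<open>L2_deriv\<close> chooses some representative; existence of the pointwise
  derivative and uniqueness determine it up to null sets, at every order.\<close>

lemma L2_deriv_gauss:
  assumes Q: "finite_measure Q" "sets Q = sets borel" and lim: "\<And>x. x \<in> X \<Longrightarrow> at x within X \<noteq> bot"
    and x: "x \<in> X"
  shows "(L2_deriv Q X ^^ k) gauss x \<in> L2 Q \<and> L2_eq Q ((L2_deriv Q X ^^ k) gauss x) (\<lambda>s. dgauss k (x - s))"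
  using x
proof (induction k arbitrary: x)
  case 0
  then show ?case using dgauss_L2[OF Q, of 0 x] by (simp add: gauss_eq_dgauss L2_eq_def)
next
  case (Suc k)
  let ?f = "(L2_deriv Q X ^^ k) gauss"
  have D: "has_L2_derivative Q X ?f (\<lambda>s. dgauss (Suc k) (x - s)) x"
    using Suc by (intro has_L2_derivative_dgauss[OF Q]) auto
  then have S: "has_L2_derivative Q X ?f (L2_deriv Q X ?f x) x"
    unfolding L2_deriv_def[of Q X ?f x] by (rule someI[where P = "\<lambda>f'. has_L2_derivative Q X ?f f' x"])
  show ?case
    using has_L2_derivative_unique[OF S D Suc.prems lim[OF Suc.prems]] S
    by (simp add: has_L2_derivative_def)
qed

lemma gauss_in_C_L2:
  assumes Q: "finite_measure Q" "sets Q = sets borel" and lim: "\<And>x. x \<in> X \<Longrightarrow> at x within X \<noteq> bot"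
  shows "gauss \<in> C_L2 k X Q"
proof -
  note L = L2_deriv_gauss[OF Q lim]
  have "\<exists>f'. has_L2_derivative Q X ((L2_deriv Q X ^^ i) gauss) f' x" if "x \<in> X" for i x
    using has_L2_derivative_dgauss[OF Q, of X "(L2_deriv Q X ^^ i) gauss" i x] L that by blast
  moreover have "L2_continuous_on Q X ((L2_deriv Q X ^^ i) gauss)" for i
    unfolding L2_continuous_on_def
  proof (intro conjI ballI)
    let ?f = "(L2_deriv Q X ^^ i) gauss"
    fix x assume x: "x \<in> X"
    then show "?f x \<in> L2 Q" using L by blast
    obtain C where C: "C > 0" "\<And>u. \<bar>dgauss (Suc i) u\<bar> \<le> C" using dgauss_bounded by blast
    have bound: "L2_norm Q (\<lambda>s. ?f y s - ?f x s) \<le> C * \<bar>y - x\<bar> * sqrt (measure Q (space Q))" if "y \<in> X" for y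
    proof (rule L2_norm_le_bound)
      have "AE s in Q. ?f y s = dgauss i (y - s)" "AE s in Q. ?f x s = dgauss i (x - s)"
        using L that x by (auto simp: L2_eq_def)
      then show "AE s in Q. \<bar>?f y s - ?f x s\<bar> \<le> C * \<bar>y - x\<bar>"
      proof eventually_elim
        case (elim s)
        then show ?case
          using deriv_bound_imp_lipschitz[of "dgauss i" "dgauss (Suc i)" C "y - s" "x - s"] C dgauss_deriv
          by auto
      qed
    qed (use Q C in auto)
    show "((\<lambda>y. L2_norm Q (\<lambda>s. ?f y s - ?f x s)) \<longlongrightarrow> 0) (at x within X)"
    proof (rule Lim_null_comparison)
      show "((\<lambda>y. C * \<bar>y - x\<bar> * sqrt (measure Q (space Q))) \<longlongrightarrow> 0) (at x within X)"
        by (auto intro!: tendsto_eq_intros)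
      show "\<forall>\<^sub>F y in at x within X. norm (L2_norm Q (\<lambda>s. ?f y s - ?f x s))
          \<le> C * \<bar>y - x\<bar> * sqrt (measure Q (space Q))"
        unfolding eventually_at_filter using bound
        by (intro always_eventually allI impI) (simp add: L2_norm_def L2_inner_def)
    qed
  qed
  ultimately show ?thesis by (simp add: C_L2_def)
qed

text \<open>The decay condition does not mention the order \<open>k\<close>, so it is inherited from
  admissibility; smoothness and bounded derivatives hold for the Gaussian at every order.\<close>

lemma gauss_in_K_space:
  assumes Q: "finite_measure Q" "sets Q = sets borel" and lim: "\<And>x. x \<in> X \<Longrightarrow> at x within X \<noteq> bot"
    and adm: "admissible_framework X Q gauss"
  shows "gauss \<in> K_space k X Q"
proof -
  note L = L2_deriv_gauss[OF Q lim]
  have "bdd_above ((\<lambda>x. L2_norm Q ((L2_deriv Q X ^^ i) gauss x)) ` X)" for i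
  proof -
    obtain C where C: "C > 0" "\<And>u. \<bar>dgauss i u\<bar> \<le> C" using dgauss_bounded by blast
    have "L2_norm Q ((L2_deriv Q X ^^ i) gauss x) \<le> C * sqrt (measure Q (space Q))" if "x \<in> X" for x
    proof (rule L2_norm_le_bound)
      have "AE s in Q. (L2_deriv Q X ^^ i) gauss x s = dgauss i (x - s)"
        using L[OF _ that] by (auto simp: L2_eq_def)
      then show "AE s in Q. \<bar>(L2_deriv Q X ^^ i) gauss x s\<bar> \<le> C"
        by eventually_elim (use C in auto)
    qed (use Q C in auto)
    then show ?thesis by (rule bdd_aboveI2)
  qed
  then show ?thesis
    using adm gauss_in_C_L2[OF Q lim] by (auto simp: K_space_def admissible_framework_def)
qed

lemma higher_deriv_Phi_adj:
  assumes Q: "finite_measure Q" "sets Q = sets borel" and p: "p \<in> L2 Q"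
  shows "(deriv ^^ k) (Phi_adj Q gauss p) = gtrans Q p k"
proof (induction k)
  case 0
  show ?case by (simp add: fun_eq_iff Phi_adj_def L2_inner_def gtrans_def gauss_eq_dgauss)
next
  case (Suc k)
  show ?case
    using gtrans_deriv[OF L2_imp_integrable[OF Q(1) p] Q(2)] by (intro ext) (simp add: Suc DERIV_imp_deriv)
qed

text \<open>\<open>p\<close> lies in the span of the constraint functions, and the difference of two
  feasible elements is orthogonal to that span. Pythagoras then makes \<open>p\<close> minimal and
  every minimiser equal to it almost everywhere.\<close>

lemma arg_min_L2_norm:
  fixes b :: "'i \<Rightarrow> real"
  assumes f: "\<And>i. i \<in> I \<Longrightarrow> f i \<in> L2 Q"
    and p: "p = (\<lambda>s. \<Sum>i\<in>I. b i * f i s)" "\<And>i. i \<in> I \<Longrightarrow> L2_inner Q (f i) p = v i"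
    and R: "\<And>q. R q \<longleftrightarrow> q \<in> L2 Q \<and> (\<forall>i\<in>I. L2_inner Q (f i) q = v i)"
  shows "arg_min (L2_norm Q) R \<in> L2 Q \<and> L2_eq Q (arg_min (L2_norm Q) R) p"
proof -
  have pL2: "p \<in> L2 Q" unfolding p(1) by (intro L2_sum L2_cmult f)
  have pyth: "(\<integral>s. (q s)\<^sup>2 \<partial>Q) = (\<integral>s. (p s)\<^sup>2 \<partial>Q) + (\<integral>s. (q s - p s)\<^sup>2 \<partial>Q)" if "R q" for q
  proof -
    have q: "q \<in> L2 Q" "\<And>i. i \<in> I \<Longrightarrow> L2_inner Q (f i) q = v i" using that R by auto
    have ps: "p s * r = (\<Sum>i\<in>I. b i * (f i s * r))" for s r
      by (subst p(1)) (simp add: sum_distrib_right mult.assoc)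
    have "(\<integral>s. p s * q s - p s * p s \<partial>Q) = (\<integral>s. (\<Sum>i\<in>I. b i * (f i s * q s)) - (\<Sum>i\<in>I. b i * (f i s * p s)) \<partial>Q)"
      by (simp only: ps)
    also have "\<dots> = (\<Sum>i\<in>I. b i * (\<integral>s. f i s * q s \<partial>Q)) - (\<Sum>i\<in>I. b i * (\<integral>s. f i s * p s \<partial>Q))"
      using L2_mult_integrable[OF f q(1)] L2_mult_integrable[OF f pL2] by simp
    also have "\<dots> = 0" using q(2) p(2) by (simp add: L2_inner_def)
    finally have 0: "(\<integral>s. p s * q s - p s * p s \<partial>Q) = 0" .
    have "(\<integral>s. (q s)\<^sup>2 \<partial>Q) = (\<integral>s. (p s)\<^sup>2 + (q s - p s)\<^sup>2 + 2 * (p s * q s - p s * p s) \<partial>Q)"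
      by (intro Bochner_Integration.integral_cong) (auto simp: power2_eq_square algebra_simps)
    also have "\<dots> = (\<integral>s. (p s)\<^sup>2 \<partial>Q) + (\<integral>s. (q s - p s)\<^sup>2 \<partial>Q) + 2 * (\<integral>s. p s * q s - p s * p s \<partial>Q)"
      using pL2 L2_diff[OF q(1) pL2] L2_mult_integrable[OF pL2 q(1)] L2_mult_integrable[OF pL2 pL2]
      by (simp add: L2_def)
    finally show ?thesis using 0 by simp
  qed
  have Rp: "R p" using R pL2 p(2) by simp
  have norm_le: "L2_norm Q p \<le> L2_norm Q q" if "R q" for q
    unfolding L2_norm_def L2_inner_def using pyth[OF that] by (simp add: power2_eq_square)
  have "is_arg_min (L2_norm Q) R p"
    using Rp norm_le by (auto simp: is_arg_min_def not_less)
  then have min: "is_arg_min (L2_norm Q) R (arg_min (L2_norm Q) R)" (is "is_arg_min _ _ ?q")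
    unfolding arg_min_def by (rule someI[where P = "is_arg_min (L2_norm Q) R"])
  then have Rq: "R ?q" and "\<not> L2_norm Q p < L2_norm Q ?q"
    using Rp by (auto simp: is_arg_min_def)
  then have "(\<integral>s. (?q s)\<^sup>2 \<partial>Q) \<le> (\<integral>s. (p s)\<^sup>2 \<partial>Q)"
    by (simp add: L2_norm_def L2_inner_def power2_eq_square)
  then have "(\<integral>s. (?q s - p s)\<^sup>2 \<partial>Q) \<le> 0" using pyth[OF Rq] by simp
  then show ?thesis using Rq R pL2 L2_eq_if_integral_le_0 by blast
qed


section \<open>The Lebesgue measure\<close>

lemma AE_lborel_continuous_eq_0:
  fixes f :: "real \<Rightarrow> real"
  assumes "continuous_on UNIV f" "AE s in lborel. f s = 0"
  shows "f a = 0"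
proof (rule ccontr)
  assume "f a \<noteq> 0"
  have "open (f -` (- {0}))" using assms(1) by (intro open_vimage) auto
  then obtain \<delta> where \<delta>: "\<delta> > 0" "\<And>s. dist s a < \<delta> \<Longrightarrow> f s \<noteq> 0"
    using \<open>f a \<noteq> 0\<close> unfolding open_dist by blast
  have "AE s in lborel. s \<notin> {a - \<delta><..<a + \<delta>}"
    using assms(2) by eventually_elim (use \<delta>(2) in \<open>force simp: dist_real_def\<close>)
  then have "{a - \<delta><..<a + \<delta>} \<in> null_sets lborel"
    by (subst AE_iff_null_sets) auto
  then show False using \<delta>(1) by (auto simp: null_sets_def)
qed

lemma integral_lborel_pos:
  fixes f :: "real \<Rightarrow> real"
  assumes "continuous_on UNIV f" "\<And>s. f s \<ge> 0" "integrable lborel f" "f a \<noteq> 0"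
  shows "(\<integral>s. f s \<partial>lborel) > 0"
proof (rule ccontr)
  assume "\<not> ?thesis"
  then have "(\<integral>s. f s \<partial>lborel) = 0"
    using integral_nonneg_AE[of f lborel] assms(2) by (simp add: not_less antisym)
  then have "AE s in lborel. f s = 0"
    using integral_nonneg_eq_0_iff_AE[OF assms(3)] assms(2) by simp
  with assms(1,4) show False using AE_lborel_continuous_eq_0 by blast
qed

lemma poly_times_exp_tendsto_0:
  fixes p :: "real poly"
  assumes "\<delta> > 0"
  shows "((\<lambda>s. poly p s * exp (- \<delta> * s)) \<longlongrightarrow> 0) at_top"
proof -
  obtain C where C: "\<And>u. \<bar>poly p u\<bar> \<le> C * exp (\<delta> / 2 * \<bar>u\<bar>)"
    using poly_le_exp[of "\<delta> / 2" p] assms by auto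
  show ?thesis
  proof (rule Lim_null_comparison)
    show "\<forall>\<^sub>F s in at_top. norm (poly p s * exp (- \<delta> * s)) \<le> C * exp (- (\<delta> / 2) * s)"
      using eventually_ge_at_top[of 0]
    proof eventually_elim
      case (elim s)
      have "\<bar>poly p s\<bar> * exp (- \<delta> * s) \<le> C * exp (\<delta> / 2 * s) * exp (- \<delta> * s)"
        using C[of s] elim by (intro mult_right_mono) auto
      also have "\<dots> = C * exp (- (\<delta> / 2) * s)" by (simp flip: exp_add)
      finally show ?case by (simp add: abs_mult)
    qed
    show "((\<lambda>s. C * exp (- (\<delta> / 2) * s)) \<longlongrightarrow> 0) at_top" using assms by real_asymp
  qed
qed

lemma poly_tendsto_0_imp_0:
  fixes p :: "real poly"
  assumes "(poly p \<longlongrightarrow> 0) at_top"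
  shows "p = 0"
proof (rule ccontr)
  assume p: "p \<noteq> 0"
  have *: False if q: "(poly q \<longlongrightarrow> 0) at_top" "lead_coeff q > 0" for q :: "real poly"
  proof -
    obtain n where n: "\<And>x. x \<ge> n \<Longrightarrow> poly q x \<ge> lead_coeff q" using poly_pinfty_gt_lc[OF q(2)] by blast
    have "\<forall>\<^sub>F x in at_top. poly q x \<ge> lead_coeff q"
      using eventually_ge_at_top[of n] by eventually_elim (rule n)
    then have "lead_coeff q \<le> 0" by (rule tendsto_lowerbound[OF q(1)]) auto
    with q(2) show False by simp
  qed
  show False
  proof (cases "lead_coeff p > 0")
    case True then show ?thesis using * assms by blast
  next
    case False
    then have "lead_coeff (- p) > 0" using p by (simp add: degree_minus less_le)
    moreover have "poly (- p) = (\<lambda>x. - poly p x)" by auto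
    then have "(poly (- p) \<longlongrightarrow> 0) at_top" using tendsto_minus[OF assms] by (simp only: minus_zero)
    ultimately show ?thesis using * by blast
  qed
qed

section \<open>Linear independence of translated Gaussian derivatives\<close>

text \<open>Divide by the exponential with the largest exponent and let \<open>s\<close> tend to
  infinity: its polynomial coefficient tends to 0, hence is 0. The factor 2 is the one produced by
  expanding exp(-(a - s)^2).\<close>

lemma exppoly_independent:
  fixes A :: "real set"
  assumes "finite A" "\<And>s. (\<Sum>a\<in>A. poly (q a) s * exp (2 * a * s)) = 0"
  shows "\<forall>a\<in>A. q a = 0"
  using assms
proof (induction A rule: finite_linorder_max_induct)
  case (insert b A)
  have b: "b \<notin> A" using insert.hyps by auto
  have "poly (q b) s = - (\<Sum>a\<in>A. poly (q a) s * exp (- (2 * (b - a)) * s))" for s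
  proof -
    have "(poly (q b) s * exp (2 * b * s) + (\<Sum>a\<in>A. poly (q a) s * exp (2 * a * s))) * exp (- 2 * b * s) = 0"
      using insert.prems[of s] insert.hyps b by simp
    then have "poly (q b) s * (exp (2 * b * s) * exp (- 2 * b * s))
        + (\<Sum>a\<in>A. poly (q a) s * (exp (2 * a * s) * exp (- 2 * b * s))) = 0"
      by (simp add: distrib_right sum_distrib_right mult.assoc)
    moreover have "exp (2 * a * s) * exp (- 2 * b * s) = exp (- (2 * (b - a)) * s)" for a
      by (simp add: algebra_simps flip: exp_add)
    ultimately show ?thesis by simp
  qed
  moreover have "((\<lambda>s. - (\<Sum>a\<in>A. poly (q a) s * exp (- (2 * (b - a)) * s))) \<longlongrightarrow> - (\<Sum>a\<in>A. 0)) at_top"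
    using insert.hyps by (intro tendsto_minus tendsto_sum poly_times_exp_tendsto_0) auto
  ultimately have "(poly (q b) \<longlongrightarrow> 0) at_top"
    by (subst filterlim_cong[OF refl refl always_eventually]) auto
  then have qb: "q b = 0" by (rule poly_tendsto_0_imp_0)
  then have "\<forall>a\<in>A. q a = 0"
    using insert.prems insert.hyps b by (intro insert.IH) simp
  then show ?case using qb by simp
qed simp

text \<open>Compare top coefficients: \<open>hpoly k\<close> has degree exactly
  \<open>k\<close>.\<close>

lemma hpoly_independent:
  assumes "\<And>u. (\<Sum>k<m. b k * poly (hpoly k) u) = 0"
  shows "\<forall>k<m. b k = 0"
  using assms
proof (induction m)
  case (Suc m)
  have "poly (\<Sum>k<Suc m. Polynomial.smult (b k) (hpoly k)) = poly 0"
    using Suc.prems by (intro ext) (simp add: poly_sum)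
  then have "(\<Sum>k<Suc m. Polynomial.smult (b k) (hpoly k)) = 0" by (simp only: poly_eq_poly_eq_iff)
  then have "coeff (\<Sum>k<Suc m. Polynomial.smult (b k) (hpoly k)) m = 0" by (simp only: coeff_0)
  then have "(\<Sum>k<Suc m. b k * coeff (hpoly k) m) = 0"
    by (simp only: coeff_sum coeff_smult)
  moreover have "(\<Sum>k<m. b k * coeff (hpoly k) m) = 0"
    by (intro sum.neutral) (auto simp: coeff_eq_0 degree_hpoly)
  moreover have "coeff (hpoly m) m \<noteq> 0"
    using degree_hpoly[of m] leading_coeff_0_iff[of "hpoly m"] by (cases m) auto
  ultimately have "b m = 0" by simp
  then show ?case using Suc by (auto simp: less_Suc_eq)
qed simp

text \<open>After removal of the common factor exp(-s^2), each centre \<open>a\<close> contributes a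
  polynomial times exp(2 a s). These polynomials vanish separately, and each is a combination of
  \<open>hpoly k\<close> at \<open>a - s\<close>.\<close>

lemma dgauss_translates_independent:
  fixes A :: "real set"
  assumes A: "finite A" and 0: "\<And>s. (\<Sum>(a, k)\<in>Sigma A (\<lambda>a. {..<\<mu> a}). b (a, k) * dgauss k (a - s)) = 0"
  shows "\<forall>i\<in>Sigma A (\<lambda>a. {..<\<mu> a}). b i = 0"
proof -
  define q where "q a = Polynomial.smult (exp (- a\<^sup>2)) (\<Sum>k<\<mu> a. Polynomial.smult (b (a, k)) (pcompose (hpoly k) [:a, -1:]))" for a
  have "(\<Sum>a\<in>A. poly (q a) s * exp (2 * a * s)) = 0" for s
  proof -
    have exp: "exp (- (a - s)\<^sup>2) = exp (- s\<^sup>2) * (exp (- a\<^sup>2) * exp (2 * a * s))" for a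
      by (simp add: power2_eq_square algebra_simps flip: exp_add)
    have "0 = (\<Sum>a\<in>A. \<Sum>k<\<mu> a. b (a, k) * dgauss k (a - s))"
      using 0[of s] A by (simp add: sum.Sigma)
    also have "\<dots> = exp (- s\<^sup>2) * (\<Sum>a\<in>A. poly (q a) s * exp (2 * a * s))"
      by (simp add: dgauss_def exp q_def poly_sum poly_pcompose sum_distrib_left sum_distrib_right mult_ac)
    finally show ?thesis by simp
  qed
  then have q0: "\<forall>a\<in>A. q a = 0" by (rule exppoly_independent[OF A])
  have "b (a, k) = 0" if "a \<in> A" "k < \<mu> a" for a k
  proof -
    have "(\<Sum>k<\<mu> a. b (a, k) * poly (hpoly k) u) = 0" for u
    proof -
      have "poly (q a) (a - u) = 0" using q0 that by simp
      then show ?thesis by (simp add: q_def poly_sum poly_pcompose)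
    qed
    then show ?thesis using hpoly_independent[where m = "\<mu> a" and b = "\<lambda>k. b (a, k)"] that by blast
  qed
  then show ?thesis by auto
qed

section \<open>Gaussian integrals against Lebesgue measure\<close>

text \<open>The number sqrt(pi/2); its positivity allows dividing by it.\<close>

definition gauss_const :: real where
  "gauss_const = (\<integral>s. exp (- 2 * s\<^sup>2) \<partial>lborel)"

text \<open>The probabilists' Hermite polynomials: \<open>cpoly k\<close> at
  \<open>x - \<xi>\<close> is the polynomial factor of the derivative of order \<open>k\<close> in
  \<xi> of exp(-(x - \<xi>)^2/2).\<close>

primrec cpoly :: "nat \<Rightarrow> real poly" where
  "cpoly 0 = 1"
| "cpoly (Suc k) = [:0, 1:] * cpoly k - pderiv (cpoly k)"

lemma degree_cpoly: "degree (cpoly k) \<le> k"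
proof (induction k)
  case (Suc k)
  have "degree ([:0, 1:] * cpoly k) \<le> Suc k" using Suc by (intro order_trans[OF degree_mult_le]) simp
  moreover have "degree (pderiv (cpoly k)) \<le> Suc k" using Suc by (simp add: degree_pderiv)
  ultimately show ?case unfolding cpoly.simps by (rule degree_diff_le)
qed simp

text \<open>Completing the square around the midpoint \<open>t\<close>: (\<xi> - s)^2 + (x - s)^2 =
  2 (s - t)^2 + (x - \<xi>)^2/2.\<close>

lemma gtrans_dgauss_0:
  "gtrans lborel (\<lambda>s. dgauss 0 (x - s)) 0 \<xi> = gauss_const * exp (- (x - \<xi>)\<^sup>2 / 2)"
proof -
  define t where "t = (x + \<xi>) / 2"
  have "dgauss 0 (\<xi> - s) * dgauss 0 (x - s) = exp (- (x - \<xi>)\<^sup>2 / 2) * exp (- 2 * (s - t)\<^sup>2)" for s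
    unfolding dgauss_0 t_def by (simp add: power2_eq_square field_simps flip: exp_add)
  then have "gtrans lborel (\<lambda>s. dgauss 0 (x - s)) 0 \<xi> = exp (- (x - \<xi>)\<^sup>2 / 2) * (\<integral>s. exp (- 2 * (s - t)\<^sup>2) \<partial>lborel)"
    unfolding gtrans_def by simp
  also have "(\<integral>s. exp (- 2 * (s - t)\<^sup>2) \<partial>lborel) = gauss_const"
    using lborel_integral_real_affine[of 1 "\<lambda>s. exp (- 2 * (s - t)\<^sup>2)" t]
    by (simp add: gauss_const_def)
  finally show ?thesis by simp
qed

lemma gtrans_dgauss:
  "gtrans lborel (\<lambda>s. dgauss 0 (x - s)) k \<xi> = gauss_const * poly (cpoly k) (x - \<xi>) * exp (- (x - \<xi>)\<^sup>2 / 2)"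
proof (induction k arbitrary: \<xi>)
  case 0
  then show ?case by (simp add: gtrans_dgauss_0)
next
  case (Suc k)
  let ?r = "\<lambda>\<xi>. gauss_const * poly (cpoly k) (x - \<xi>) * exp (- (x - \<xi>)\<^sup>2 / 2)"
  have "(gtrans lborel (\<lambda>s. dgauss 0 (x - s)) k has_real_derivative
      gtrans lborel (\<lambda>s. dgauss 0 (x - s)) (Suc k) \<xi>) (at \<xi>)"
    by (intro gtrans_deriv integrable_dgauss_lborel) simp
  moreover have "gtrans lborel (\<lambda>s. dgauss 0 (x - s)) k = ?r" using Suc by blast
  ultimately have "(?r has_real_derivative gtrans lborel (\<lambda>s. dgauss 0 (x - s)) (Suc k) \<xi>) (at \<xi>)" by simp
  moreover have "(?r has_real_derivative gauss_const * poly (cpoly (Suc k)) (x - \<xi>) * exp (- (x - \<xi>)\<^sup>2 / 2)) (at \<xi>)"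
    by (auto intro!: derivative_eq_intros DERIV_chain'[OF _ poly_DERIV] simp: field_simps)
  ultimately show ?case by (rule DERIV_unique)
qed

lemma gauss_const_pos: "gauss_const > 0"
proof -
  have eq: "exp (- 2 * s\<^sup>2) = dgauss 0 (0 - s) * dgauss 0 (0 - s)" for s :: real
    by (simp add: dgauss_0 flip: exp_add)
  have "integrable lborel (\<lambda>s :: real. exp (- 2 * s\<^sup>2))"
    unfolding eq by (intro integrable_gtrans integrable_dgauss_lborel) simp
  then show ?thesis
    unfolding gauss_const_def by (intro integral_lborel_pos[of _ 0]) (auto intro!: continuous_intros)
qed

lemma integrable_poly_gauss_0:
  fixes p :: "real poly"
  shows "integrable lborel (\<lambda>s. poly p s * exp (- s\<^sup>2))"
  using integrable_poly_gauss[where p = "pcompose p [:0, -1:]" and y = 0] by (simp add: poly_pcompose)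

text \<open>Up to a constant \<open>exp (x\<^sup>2 / 2)\<close> is \<open>\<integral> exp (2 x s - 2 s\<^sup>2) ds\<close>, so \<open>D - c\<close> amounts to a
  multiplication by \<open>2 s - c\<close> under the integral sign.\<close>

definition gauss_chain :: "(nat \<Rightarrow> real) \<Rightarrow> nat \<Rightarrow> real \<Rightarrow> real" where
  "gauss_chain c j x = exp (x\<^sup>2) * gtrans lborel (\<lambda>s. (\<Prod>i<j. 2 * s - c i) * exp (- s\<^sup>2)) 0 x"

lemma integrable_gauss_chain:
  fixes c :: "nat \<Rightarrow> real"
  shows "integrable lborel (\<lambda>s. (\<Prod>i<j. 2 * s - c i) * exp (- s\<^sup>2))"
  using integrable_poly_gauss_0[of "\<Prod>i<j. [:- c i, 2:]"] by (simp add: poly_prod mult.commute)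

lemma diff_chain_gauss_chain: "diff_chain c (gauss_chain c)"
  unfolding diff_chain_def
proof (intro allI)
  fix j x
  define r where "r s = (\<Prod>i<j. 2 * s - c i) * exp (- s\<^sup>2)" for s
  have int: "integrable lborel r" unfolding r_def by (rule integrable_gauss_chain)
  \<comment> \<open>The factor -2 (x - s) is split as (2 s - c j) + (c j - 2 x); the part -2 x is
    cancelled by the derivative of exp(x^2).\<close>
  have "gtrans lborel r (Suc 0) x = (\<integral>s. dgauss 0 (x - s) * ((2 * s - c j) * r s) + (c j - 2 * x) * (dgauss 0 (x - s) * r s) \<partial>lborel)"
    unfolding gtrans_def dgauss_1 by (intro Bochner_Integration.integral_cong) (auto simp: algebra_simps)
  also have "\<dots> = gtrans lborel (\<lambda>s. (2 * s - c j) * r s) 0 x + (c j - 2 * x) * gtrans lborel r 0 x"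
  proof -
    have "integrable lborel (\<lambda>s. (2 * s - c j) * r s)"
      using integrable_gauss_chain[where j = "Suc j" and c = c] by (simp add: r_def mult_ac)
    then show ?thesis
      using integrable_gtrans[of lborel r 0 x] integrable_gtrans[of lborel "\<lambda>s. (2 * s - c j) * r s" 0 x] int
      by (simp add: gtrans_def)
  qed
  finally have 1: "gtrans lborel r (Suc 0) x = gtrans lborel (\<lambda>s. (2 * s - c j) * r s) 0 x + (c j - 2 * x) * gtrans lborel r 0 x" .
  have 2: "gauss_chain c j = (\<lambda>x. exp (x\<^sup>2) * gtrans lborel r 0 x)"
    "gauss_chain c (Suc j) x = exp (x\<^sup>2) * gtrans lborel (\<lambda>s. (2 * s - c j) * r s) 0 x"
    by (auto simp: gauss_chain_def r_def[abs_def] fun_eq_iff mult_ac)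
  show "(gauss_chain c j has_real_derivative gauss_chain c (Suc j) x + c j * gauss_chain c j x) (at x)"
    unfolding 2
    by (auto intro!: derivative_eq_intros gtrans_deriv[OF int] simp: 1 algebra_simps)
qed

lemma gauss_chain_0: "gauss_chain c 0 x = gauss_const * exp (x\<^sup>2 / 2)"
proof -
  have "gauss_chain c 0 x = exp (x\<^sup>2) * gtrans lborel (\<lambda>s. dgauss 0 (0 - s)) 0 x"
    by (simp add: gauss_chain_def dgauss_0)
  also have "\<dots> = gauss_const * exp (x\<^sup>2 / 2)"
    unfolding gtrans_dgauss_0 by (simp flip: exp_add)
  finally show ?thesis .
qed

text \<open>Even multiplicities make the inserted product nonnegative, so a nonnegative continuous
  function that is not identically 0 is integrated.\<close>

lemma gauss_chain_pos:
  assumes "finite A" "\<And>a. a \<in> A \<Longrightarrow> even (\<mu> a)" "\<And>s. (\<Prod>i<d. s - c i) = (\<Prod>a\<in>A. (s - a) ^ \<mu> a)"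
  shows "gauss_chain c d x > 0"
proof -
  \<comment> \<open>At \<open>s = t / 2\<close> the factors \<open>2 * s - a\<close> are
    \<open>t - a\<close>, none of which vanishes.\<close>
  obtain t where t: "t \<notin> A" using assms(1) ex_new_if_finite infinite_UNIV_char_0 by blast
  have "(\<Prod>a\<in>A. (2 * (t / 2) - a) ^ \<mu> a) \<noteq> 0" using t assms(1) by (auto simp: prod_zero_iff)
  moreover have "(\<Prod>a\<in>A. (2 * s - a) ^ \<mu> a) \<ge> 0" for s
    using assms(2) by (intro prod_nonneg) (auto simp: zero_le_even_power)
  moreover have "continuous_on UNIV (\<lambda>s. dgauss 0 (x - s) * ((\<Prod>i<d. 2 * s - c i) * exp (- s\<^sup>2)))"
    by (intro continuous_intros)
  moreover have "integrable lborel (\<lambda>s. dgauss 0 (x - s) * ((\<Prod>i<d. 2 * s - c i) * exp (- s\<^sup>2)))"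
    by (intro integrable_gtrans integrable_gauss_chain) simp
  ultimately have "gtrans lborel (\<lambda>s. (\<Prod>i<d. 2 * s - c i) * exp (- s\<^sup>2)) 0 x > 0"
    unfolding gtrans_def
    by (intro integral_lborel_pos[of _ "t / 2"]) (simp_all add: assms(3) dgauss_0)
  then show ?thesis by (simp add: gauss_chain_def)
qed

section \<open>Signs around zeros of even order\<close>

lemma diff_chain_0_taylor:
  assumes E: "diff_chain (\<lambda>_. 0) E" and "\<And>i. i < m \<Longrightarrow> E i a = 0" and "m > 0"
  shows "\<exists>t. \<bar>t - a\<bar> \<le> \<bar>x - a\<bar> \<and> E 0 x = E m t / fact m * (x - a) ^ m"
proof (cases "x = a")
  case True
  then show ?thesis using assms(2)[of 0] assms(3) by (intro exI[of _ a]) auto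
next
  case False
  have "\<exists>t. (if x < a then x < t \<and> t < a else a < t \<and> t < x) \<and>
      E 0 x = (\<Sum>i<m. E i a / fact i * (x - a)^i) + E m t / fact m * (x - a)^m"
    using False diff_chainD[OF E] assms(3)
    by (intro Taylor[of m E "E 0" "min x a" "max x a" a x]) auto
  then show ?thesis using assms(2) by (force split: if_splits)
qed

text \<open>By Taylor, \<open>E 0 x\<close> is (x - a)^m / m! times a value of \<open>E m\<close>
  near \<open>a\<close>, and the even power is positive off \<open>a\<close>.\<close>

lemma even_zero_sign:
  assumes E: "diff_chain (\<lambda>_. 0) E" and 0: "\<And>i. i < m \<Longrightarrow> E i a = 0" and m: "m > 0" "even m"
    and ne: "E m a \<noteq> 0"
  shows "\<exists>\<delta>>0. \<forall>x. 0 < \<bar>x - a\<bar> \<and> \<bar>x - a\<bar> < \<delta> \<longrightarrow> E 0 x * E m a > 0"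
proof -
  have "continuous (at a) (E m)" using diff_chainD[OF E, of m a] DERIV_isCont by blast
  then have "((\<lambda>t. E m t * E m a) \<longlongrightarrow> E m a * E m a) (at a)"
    by (intro tendsto_mult tendsto_const) (simp add: continuous_at)
  moreover have "E m a * E m a > 0" using ne by (auto simp: zero_less_mult_iff)
  ultimately have "\<forall>\<^sub>F t in at a. E m t * E m a > 0" by (simp add: order_tendsto_iff)
  then obtain \<delta> where \<delta>: "\<delta> > 0" "\<And>t. t \<noteq> a \<Longrightarrow> \<bar>t - a\<bar> < \<delta> \<Longrightarrow> E m t * E m a > 0"
    unfolding eventually_at dist_real_def by auto
  have "E 0 x * E m a > 0" if x: "0 < \<bar>x - a\<bar>" "\<bar>x - a\<bar> < \<delta>" for x
  proof -
    obtain t where t: "\<bar>t - a\<bar> \<le> \<bar>x - a\<bar>" "E 0 x = E m t / fact m * (x - a) ^ m"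
      using diff_chain_0_taylor[OF E 0 m(1)] by blast
    have "E m t * E m a > 0"
      using \<delta>(2)[of t] t(1) x \<open>E m a * E m a > 0\<close> by (cases "t = a") auto
    moreover have "(x - a) ^ m > 0" using x m by (simp add: zero_less_power_eq)
    moreover have "E 0 x * E m a = (E m t * E m a) * ((x - a) ^ m / fact m)" unfolding t(2) by simp
    ultimately show ?thesis by simp
  qed
  then show ?thesis using \<delta>(1) by blast
qed

text \<open>At an even zero the function keeps its sign, so the sign at infinity propagates to the left.\<close>

lemma even_zeros_positive:
  assumes E: "diff_chain (\<lambda>_. 0) E" and A: "finite A"
    and m: "\<And>a. a \<in> A \<Longrightarrow> \<mu> a > 0 \<and> even (\<mu> a)"
    and 0: "\<And>a i. a \<in> A \<Longrightarrow> i < \<mu> a \<Longrightarrow> E i a = 0"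
    and ne: "\<And>a. a \<in> A \<Longrightarrow> E (\<mu> a) a \<noteq> 0" "\<And>x. x \<notin> A \<Longrightarrow> E 0 x \<noteq> 0"
    and inf: "\<forall>\<^sub>F x in at_top. E 0 x > 0"
  shows "(\<forall>x. x \<notin> A \<longrightarrow> E 0 x > 0) \<and> (\<forall>a\<in>A. E (\<mu> a) a > 0)"
proof -
  have sign: "\<exists>\<delta>>0. \<forall>x. 0 < \<bar>x - a\<bar> \<and> \<bar>x - a\<bar> < \<delta> \<longrightarrow> E 0 x * E (\<mu> a) a > 0" if "a \<in> A" for a
    using m[OF that] 0[OF that] ne(1)[OF that] by (intro even_zero_sign[OF E]) auto
  have pos: "E 0 y > 0" if y: "y \<notin> A" for y
  proof (rule ccontr)
    assume "\<not> ?thesis"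
    then have Ey: "E 0 y < 0" using ne(2)[OF y] by simp
    define S where "S = {x. y \<le> x \<and> E 0 x > 0}"
    obtain x0 where "\<And>x. x \<ge> x0 \<Longrightarrow> E 0 x > 0" using inf unfolding eventually_at_top_linorder by blast
    then have S: "S \<noteq> {}" "bdd_below S" by (auto simp: S_def intro!: exI[of _ "max x0 y"] bdd_belowI[of _ y])
    \<comment> \<open>The left end of the positive set beyond \<open>y\<close>. By
      \<open>no_right\<close>, positive values occur at or arbitrarily close after \<open>z\<close>;
      by \<open>no_left\<close>, they cannot fill a left neighbourhood of \<open>z\<close>. A
      constant sign around \<open>z\<close> violates one of the two.\<close>
    define z where "z = Inf S"
    have zy: "y \<le> z" unfolding z_def using S by (intro cInf_greatest) (auto simp: S_def)
    have below: "x \<notin> S" if "x < z" for x using that S unfolding z_def by (meson cInf_lower not_le)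
    have no_right: False if "\<delta> > 0" "\<And>x. z \<le> x \<Longrightarrow> x < z + \<delta> \<Longrightarrow> E 0 x \<le> 0" for \<delta>
    proof -
      have "z + \<delta> \<le> x" if "x \<in> S" for x
        using below[of x] \<open>x \<in> S\<close> \<open>\<And>x. z \<le> x \<Longrightarrow> x < z + \<delta> \<Longrightarrow> E 0 x \<le> 0\<close>[of x]
        by (force simp: S_def)
      then have "z + \<delta> \<le> z" unfolding z_def using S(1) by (intro cInf_greatest)
      then show False using \<open>\<delta> > 0\<close> by simp
    qed
    have no_left: False if "\<delta> > 0" "\<And>x. z - \<delta> < x \<Longrightarrow> x < z \<Longrightarrow> E 0 x > 0" "y < z" for \<delta>
    proof -
      define x where "x = max y (z - \<delta> / 2)"
      have "x < z" "z - \<delta> < x" "y \<le> x" using that by (auto simp: x_def)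
      then show False using that(2)[of x] below[of x] by (simp add: S_def)
    qed
    show False
    proof (cases "z \<in> A")
      case True
      then have "y < z" using y zy by (cases "y = z") auto
      obtain \<delta> where \<delta>: "\<delta> > 0" "\<And>x. 0 < \<bar>x - z\<bar> \<Longrightarrow> \<bar>x - z\<bar> < \<delta> \<Longrightarrow> E 0 x * E (\<mu> z) z > 0"
        using sign[OF True] by blast
      show False
      proof (cases "E (\<mu> z) z > 0")
        case pz: True
        have "E 0 x > 0" if "z - \<delta> < x" "x < z" for x
          using \<delta>(2)[of x] that pz by (auto simp: zero_less_mult_iff)
        then show False using no_left[OF \<delta>(1)] \<open>y < z\<close> by blast
      next
        case pz: False
        have "E 0 x \<le> 0" if "z \<le> x" "x < z + \<delta>" for x
          using \<delta>(2)[of x] that pz 0[OF True, of 0] m[OF True] by (cases "x = z") (auto simp: zero_less_mult_iff)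
        then show False using no_right[OF \<delta>(1)] by blast
      qed
    next
      case False
      have "continuous (at z) (E 0)" using diff_chainD[OF E, of 0 z] DERIV_isCont by blast
      then have "((\<lambda>t. E 0 t * E 0 z) \<longlongrightarrow> E 0 z * E 0 z) (at z)"
        by (intro tendsto_mult tendsto_const) (simp add: continuous_at)
      moreover have Ez: "E 0 z * E 0 z > 0" using ne(2)[OF False] by (auto simp: zero_less_mult_iff)
      ultimately have "\<forall>\<^sub>F t in at z. E 0 t * E 0 z > 0" by (simp add: order_tendsto_iff)
      then obtain \<delta> where \<delta>: "\<delta> > 0" "\<And>t. t \<noteq> z \<Longrightarrow> \<bar>t - z\<bar> < \<delta> \<Longrightarrow> E 0 t * E 0 z > 0"
        unfolding eventually_at dist_real_def by auto
      show False
      proof (cases "E 0 z > 0")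
        case True
        then have "y < z" using Ey zy by (cases "y = z") auto
        have "E 0 x > 0" if "z - \<delta> < x" "x < z" for x
          using \<delta>(2)[of x] that True by (auto simp: zero_less_mult_iff)
        then show False using no_left[OF \<delta>(1)] \<open>y < z\<close> by blast
      next
        case pz: False
        have "E 0 x \<le> 0" if "z \<le> x" "x < z + \<delta>" for x
          using \<delta>(2)[of x] that pz by (cases "x = z") (auto simp: zero_less_mult_iff)
        then show False using no_right[OF \<delta>(1)] by blast
      qed
    qed
  qed
  moreover have "E (\<mu> a) a > 0" if a: "a \<in> A" for a
  proof (rule ccontr)
    assume "\<not> ?thesis"
    obtain \<delta> where \<delta>: "\<delta> > 0" "\<And>x. 0 < \<bar>x - a\<bar> \<Longrightarrow> \<bar>x - a\<bar> < \<delta> \<Longrightarrow> E 0 x * E (\<mu> a) a > 0"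
      using sign[OF a] by blast
    \<comment> \<open>If the leading derivative were not positive, \<open>E 0\<close> would be
      negative just to the right of \<open>a\<close>; positivity off \<open>A\<close> would put a
      whole interval into the finite set \<open>A\<close>.\<close>
    have "{a<..<a + \<delta>} \<subseteq> A"
    proof
      fix x assume "x \<in> {a<..<a + \<delta>}"
      then have "E 0 x * E (\<mu> a) a > 0" by (intro \<delta>(2)) auto
      then show "x \<in> A" using pos[of x] \<open>\<not> E (\<mu> a) a > 0\<close> by (auto simp: zero_less_mult_iff)
    qed
    then have "finite {a<..<a + \<delta>}" using A finite_subset by blast
    then show False using \<delta>(1) infinite_Ioo[of a "a + \<delta>"] by simp
  qed
  ultimately show ?thesis by blast
qed

section \<open>The certificate for Lebesgue measure\<close>

text \<open>One setting for both parts: M nodes of multiplicity 2, and a single node of multiplicity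
  2M.\<close>

locale gauss_nodes =
  fixes A :: "real set" and \<mu> :: "real \<Rightarrow> nat"
  assumes finite_A: "finite A" and \<mu>: "\<And>a. a \<in> A \<Longrightarrow> \<mu> a > 0 \<and> even (\<mu> a)"
begin

definition idx :: "(real \<times> nat) set" where
  "idx = Sigma A (\<lambda>a. {..<\<mu> a})"

definition comb :: "(real \<times> nat \<Rightarrow> real) \<Rightarrow> real \<Rightarrow> real" where
  "comb b s = (\<Sum>i\<in>idx. b i * dgauss (snd i) (fst i - s))"

lemma finite_idx: "finite idx"
  unfolding idx_def using finite_A by auto

lemma idx_iff: "i \<in> idx \<longleftrightarrow> fst i \<in> A \<and> snd i < \<mu> (fst i)"
  by (cases i) (simp add: idx_def)

lemma integrable_comb: "integrable lborel (comb b)"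
  unfolding comb_def[abs_def] by (intro Bochner_Integration.integrable_sum integrable_mult_right integrable_dgauss_lborel)

lemma gtrans_comb:
  assumes "\<And>k y. integrable Q (\<lambda>s. dgauss k (y - s))" "sets Q = sets borel"
  shows "gtrans Q (comb b) k x = (\<Sum>i\<in>idx. b i * gtrans Q (\<lambda>s. dgauss (snd i) (fst i - s)) k x)"
proof -
  have "gtrans Q (comb b) k x = (\<integral>s. (\<Sum>i\<in>idx. b i * (dgauss k (x - s) * dgauss (snd i) (fst i - s))) \<partial>Q)"
    unfolding gtrans_def comb_def by (simp add: sum_distrib_left mult_ac)
  also have "\<dots> = (\<Sum>i\<in>idx. b i * gtrans Q (\<lambda>s. dgauss (snd i) (fst i - s)) k x)"
    using integrable_gtrans[OF assms] by (simp add: gtrans_def)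
  finally show ?thesis .
qed

text \<open>The two Gaussian factors play symmetric roles, so derivatives may be moved from the
  evaluation point to the centre.\<close>

lemma gtrans_lborel_dgauss:
  "gtrans lborel (\<lambda>s. dgauss k (\<xi> - s)) 0 x = gauss_const * poly (cpoly k) (x - \<xi>) * exp (- (x - \<xi>)\<^sup>2 / 2)"
  using gtrans_dgauss[of x k \<xi>] by (simp add: gtrans_def mult.commute)

lemma gtrans_comb_tendsto_0:
  "(gtrans lborel (comb b) 0 \<longlongrightarrow> 0) at_infinity"
proof -
  have "((\<lambda>x. poly q (x - \<xi>) * exp (- (x - \<xi>)\<^sup>2 / 2)) \<longlongrightarrow> 0) at_infinity" for q and \<xi> :: real
  proof -
    obtain C where C: "\<And>u. \<bar>poly q u\<bar> \<le> C * exp (1 * \<bar>u\<bar>)" using poly_le_exp[of 1 q] by auto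
    have lim: "((\<lambda>u. poly q u * exp (- u\<^sup>2 / 2)) \<longlongrightarrow> 0) F" if "F = at_top \<or> F = at_bot" for F
    proof (rule Lim_null_comparison)
      show "\<forall>\<^sub>F u in F. norm (poly q u * exp (- u\<^sup>2 / 2)) \<le> C * exp \<bar>u\<bar> * exp (- u\<^sup>2 / 2)"
        using C by (intro always_eventually allI) (auto simp: abs_mult intro!: mult_right_mono)
      show "((\<lambda>u. C * exp \<bar>u\<bar> * exp (- u\<^sup>2 / 2)) \<longlongrightarrow> 0) F"
        using that by (elim disjE; simp only:; real_asymp)
    qed
    have "filterlim (\<lambda>x. x - \<xi>) at_top at_top" "filterlim (\<lambda>x. x - \<xi>) at_bot at_bot" by real_asymp+
    then show ?thesis
      unfolding at_infinity_eq_at_top_bot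
      by (intro filterlim_sup filterlim_compose[OF lim[OF disjI1[OF refl]]] filterlim_compose[OF lim[OF disjI2[OF refl]]])
  qed
  then have "((\<lambda>x. \<Sum>i\<in>idx. b i * (gauss_const * (poly (cpoly (snd i)) (x - fst i) * exp (- (x - fst i)\<^sup>2 / 2)))) \<longlongrightarrow>
      (\<Sum>i\<in>idx. b i * (gauss_const * 0))) at_infinity"
    by (intro tendsto_sum tendsto_mult tendsto_const)
  then show ?thesis
    by (subst filterlim_cong[OF refl refl always_eventually])
      (auto simp: gtrans_comb[OF integrable_dgauss_lborel] gtrans_lborel_dgauss mult.assoc)
qed

text \<open>Zero counting for exp(x^2/2) (1 - \<eta>): the differential operator with the nodes as
  roots turns it into a positive function, so no zero can be added to the prescribed ones. The decay
  of \<eta> at infinity then fixes the sign.\<close>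

theorem limit_certificate:
  assumes interp: "\<And>a k. a \<in> A \<Longrightarrow> k < \<mu> a \<Longrightarrow> gtrans lborel (comb b) k a = (if k = 0 then 1 else 0)"
  shows "(\<forall>x. x \<notin> A \<longrightarrow> gtrans lborel (comb b) 0 x < 1) \<and> (\<forall>a\<in>A. gtrans lborel (comb b) (\<mu> a) a < 0)"
proof -
  let ?d = "sum \<mu> A"
  obtain c where c: "\<And>a. a \<in> A \<Longrightarrow> card {i. i < ?d \<and> c i = a} = \<mu> a"
      "\<And>s. (\<Prod>i<?d. s - c i) = (\<Prod>a\<in>A. (s - a) ^ \<mu> a)"
    using node_list_exists[OF finite_A, of \<mu>] by blast
  define E where "E j x = (if j = 0 then 1 else 0) - gtrans lborel (comb b) j x" for j x
  have E: "diff_chain (\<lambda>_. 0) E"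
    unfolding diff_chain_def E_def
    by (auto intro!: derivative_eq_intros gtrans_deriv integrable_comb)
  \<comment> \<open>exp(x^2/2) times the transform of the basis function \<open>i\<close> is
    \<open>Q i\<close> times exp(fst i * x), as the quadratic exponents cancel.\<close>
  define Q where "Q i = Polynomial.smult (gauss_const * exp (- (fst i)\<^sup>2 / 2)) (pcompose (cpoly (snd i)) [:- fst i, 1:])" for i :: "real \<times> nat"
  define F where "F j x = 1 / gauss_const * gauss_chain c j x -
      (\<Sum>i\<in>idx. b i * (poly (exppoly_coeff c (fst i) (Q i) j) x * exp (fst i * x)))" for j x
  have F: "diff_chain c F"
    unfolding F_def
    by (intro diff_chain_diff diff_chain_cmult diff_chain_sum diff_chain_gauss_chain diff_chain_exppoly)
  have "poly (Q i) x * exp (fst i * x) = exp (x\<^sup>2 / 2) * gtrans lborel (\<lambda>s. dgauss (snd i) (fst i - s)) 0 x" for i x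
  proof -
    have "exp (- (fst i)\<^sup>2 / 2) * exp (fst i * x) = exp (x\<^sup>2 / 2) * exp (- (x - fst i)\<^sup>2 / 2)"
      by (simp add: power2_eq_square field_simps flip: exp_add)
    then show ?thesis by (simp add: Q_def gtrans_lborel_dgauss poly_pcompose)
  qed
  then have F0: "F 0 x = exp (x\<^sup>2 / 2) * E 0 x" for x
    using gauss_const_pos
    by (simp add: F_def E_def gauss_chain_0 gtrans_comb[OF integrable_dgauss_lborel] right_diff_distrib sum_distrib_left mult_ac)
  have Q0: "exppoly_coeff c (fst i) (Q i) ?d = 0" if "i \<in> idx" for i
  proof (rule exppoly_coeff_eq_0)
    have "degree (Q i) \<le> degree (pcompose (cpoly (snd i)) [:- fst i, 1:])" unfolding Q_def by (rule degree_smult_le)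
    also have "\<dots> \<le> snd i" using degree_pcompose_le[of "cpoly (snd i)" "[:- fst i, 1:]"] degree_cpoly[of "snd i"] by simp
    also have "\<dots> < card {j. j < ?d \<and> c j = fst i}" using that c(1)[of "fst i"] by (simp add: idx_iff)
    finally show "degree (Q i) < card {j. j < ?d \<and> c j = fst i}" .
  qed
  have Fd: "F ?d x > 0" for x
    using gauss_chain_pos[OF finite_A _ c(2), of x] \<mu> Q0 gauss_const_pos by (simp add: F_def)
  \<comment> \<open>More than \<open>?d\<close> zeros of \<open>E 0\<close>, counted with
    multiplicity, would leave a zero of the positive function \<open>F ?d\<close>.\<close>
  have no_zero: False if "finite B" "\<And>a i. a \<in> B \<Longrightarrow> i < \<nu> a \<Longrightarrow> E i a = 0" "sum \<nu> B > ?d" for B \<nu>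
  proof -
    have "\<exists>x. F ?d x = 0"
      using that diff_chain_mult_zero[OF F E F0] by (intro diff_chain_zero[OF F, of B \<nu>]) blast+
    then show False using Fd by (metis less_irrefl)
  qed
  have E0: "E i a = 0" if "a \<in> A" "i < \<mu> a" for a i using interp[OF that] by (simp add: E_def)
  have ne1: "E (\<mu> a) a \<noteq> 0" if a: "a \<in> A" for a
  proof
    assume z: "E (\<mu> a) a = 0"
    show False
    \<comment> \<open>A vanishing derivative of order \<open>\<mu> a\<close> would raise the
      multiplicity at \<open>a\<close>, hence the total, by one.\<close>
    proof (rule no_zero[of A "\<mu>(a := Suc (\<mu> a))"])
      show "E i a' = 0" if "a' \<in> A" "i < (\<mu>(a := Suc (\<mu> a))) a'" for a' i
        using that E0 z by (auto simp: less_Suc_eq split: if_splits)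
      have "sum (\<mu>(a := Suc (\<mu> a))) A = Suc (\<mu> a) + sum \<mu> (A - {a})"
        using finite_A a by (subst sum.remove[of _ a]) (auto intro!: sum.cong)
      also have "\<dots> = Suc ?d" using finite_A a by (simp add: sum.remove[of A a \<mu>])
      finally show "?d < sum (\<mu>(a := Suc (\<mu> a))) A" by simp
    qed (rule finite_A)
  qed
  have ne2: "E 0 x \<noteq> 0" if x: "x \<notin> A" for x
  proof
    assume z: "E 0 x = 0"
    show False
    proof (rule no_zero[of "insert x A" "\<mu>(x := 1)"])
      show "E i a = 0" if "a \<in> insert x A" "i < (\<mu>(x := 1)) a" for a i
        using that E0 z x by (auto split: if_splits)
      have "sum (\<mu>(x := 1)) A = ?d" using x by (intro sum.cong) auto
      then show "?d < sum (\<mu>(x := 1)) (insert x A)" using finite_A x by simp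
    qed (use finite_A in simp)
  qed
  have "(gtrans lborel (comb b) 0 \<longlongrightarrow> 0) at_top"
    using tendsto_mono[OF at_top_le_at_infinity gtrans_comb_tendsto_0] .
  then have "\<forall>\<^sub>F x in at_top. gtrans lborel (comb b) 0 x < 1" by (rule order_tendstoD) simp
  then have "\<forall>\<^sub>F x in at_top. E 0 x > 0" by eventually_elim (simp add: E_def)
  then have "(\<forall>x. x \<notin> A \<longrightarrow> E 0 x > 0) \<and> (\<forall>a\<in>A. E (\<mu> a) a > 0)"
    using even_zeros_positive[OF E finite_A \<mu> E0 ne1 ne2] by blast
  moreover have "E (\<mu> a) a = - gtrans lborel (comb b) (\<mu> a) a" if "a \<in> A" for a
    using \<mu>[OF that] by (simp add: E_def)
  ultimately show ?thesis by (auto simp: E_def)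
qed

text \<open>A Gram matrix: pairing its product with \<open>b\<close> against \<open>b\<close> gives
  the integral of \<open>(comb b s)\<^sup>2\<close>. So \<open>comb b\<close> is 0 almost
  everywhere, by continuity everywhere, and linear independence applies.\<close>

lemma gram_kernel_trivial:
  assumes "\<And>i. i \<in> idx \<Longrightarrow> gtrans lborel (comb b) (snd i) (fst i) = 0"
  shows "\<forall>i\<in>idx. b i = 0"
proof -
  have meas: "comb b \<in> borel_measurable lborel" using integrable_comb by (rule borel_measurable_integrable)
  have int: "integrable lborel (\<lambda>s. dgauss k (y - s) * comb b s)" for k y
    by (intro integrable_gtrans integrable_comb) simp
  have sq: "(comb b s)\<^sup>2 = (\<Sum>i\<in>idx. b i * (dgauss (snd i) (fst i - s) * comb b s))" for s
    by (simp add: power2_eq_square comb_def[of b s] sum_distrib_right mult.assoc)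
  have "(\<integral>s. (comb b s)\<^sup>2 \<partial>lborel) = (\<Sum>i\<in>idx. b i * gtrans lborel (comb b) (snd i) (fst i))"
    unfolding sq gtrans_def using int by simp
  also have "\<dots> = 0" using assms by simp
  finally have "(\<integral>s. (comb b s)\<^sup>2 \<partial>lborel) = 0" .
  moreover have "integrable lborel (\<lambda>s. (comb b s)\<^sup>2)" unfolding sq using int by simp
  ultimately have "AE s in lborel. (comb b s)\<^sup>2 = 0"
    using integral_nonneg_eq_0_iff_AE[of lborel "\<lambda>s. (comb b s)\<^sup>2"] by simp
  then have ae: "AE s in lborel. comb b s = 0" by simp
  have cont: "continuous_on UNIV (comb b)" unfolding comb_def[abs_def] by (intro continuous_intros)
  have "comb b s = 0" for s using AE_lborel_continuous_eq_0[OF cont ae] .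
  then have "(\<Sum>(a, k)\<in>Sigma A (\<lambda>a. {..<\<mu> a}). b (a, k) * dgauss k (a - s)) = 0" for s
    by (simp add: comb_def idx_def case_prod_unfold)
  then show ?thesis
    unfolding idx_def by (rule dgauss_translates_independent[OF finite_A])
qed

end


section \<open>Convergence of the moments\<close>

lemma uniform_limit_sum:
  fixes f :: "'i \<Rightarrow> 'n \<Rightarrow> 'a \<Rightarrow> real"
  assumes "\<And>i. i \<in> I \<Longrightarrow> uniform_limit X (f i) (l i) F"
  shows "uniform_limit X (\<lambda>n x. \<Sum>i\<in>I. f i n x) (\<lambda>x. \<Sum>i\<in>I. l i x) F"
  using assms
proof (induction I rule: infinite_finite_induct)
  case (insert i I)
  then show ?case by (auto intro!: uniform_limit_add)
qed (simp_all add: uniform_limit_const)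

lemma uniform_limit_cmult_seq:
  fixes f :: "'n \<Rightarrow> 'a \<Rightarrow> real"
  assumes "(a \<longlongrightarrow> b) F" "uniform_limit X f l F" "bounded (l ` X)"
  shows "uniform_limit X (\<lambda>n x. a n * f n x) (\<lambda>x. b * l x) F"
proof -
  have "uniform_limit X (\<lambda>n x. a n) (\<lambda>x. b) F"
    using tendstoD[OF assms(1)] by (intro uniform_limitI) (auto elim: eventually_mono)
  then show ?thesis
    using assms(2,3) by (intro uniform_lim_mult) (auto simp: image_constant_conv)
qed

lemma gtrans_abs_le:
  assumes "integrable Q p" "sets Q = sets borel"
  shows "\<exists>B. \<forall>x. \<bar>gtrans Q p k x\<bar> \<le> B"
proof -
  obtain C where C: "C > 0" "\<And>u. \<bar>dgauss k u\<bar> \<le> C" using dgauss_bounded by blast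
  have "\<bar>gtrans Q p k x\<bar> \<le> (\<integral>s. C * \<bar>p s\<bar> \<partial>Q)" for x
    unfolding gtrans_def using C assms integrable_gtrans[OF assms]
    by (intro integral_abs_bound_integral) (auto simp: abs_mult intro!: mult_right_mono)
  then show ?thesis by blast
qed

lemma integrable_poly_gauss_finite:
  fixes p :: "real poly"
  assumes "finite_measure Q" "sets Q = sets borel"
  shows "integrable Q (\<lambda>s. poly p (y - s) * exp (- (y - s)\<^sup>2))"
proof -
  interpret finite_measure Q by fact
  have [measurable_cong]: "sets Q = sets borel" by fact
  obtain C where C: "C > 0" "\<And>u. \<bar>poly p u * exp (- u\<^sup>2)\<bar> \<le> C * exp (- u\<^sup>2 / 2)"
    using poly_gauss_le[of p] by auto
  have "\<bar>poly p u * exp (- u\<^sup>2)\<bar> \<le> C" for u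
    using C(1) by (intro order_trans[OF C(2)]) (simp add: mult_le_cancel_left2)
  then show ?thesis
    by (intro integrable_const_bound[of _ C])
      (auto intro!: borel_measurable_continuous_onI continuous_intros simp: measurable_cong_sets[OF assms(2) refl])
qed

text \<open>This is s^l exp(-(y - s)^2). The power is written as a polynomial in
  \<open>y - s\<close> to fit the integrability lemmas.\<close>

definition pgauss :: "nat \<Rightarrow> real \<Rightarrow> real \<Rightarrow> real" where
  "pgauss l y s = poly ([:y, -1:] ^ l) (y - s) * exp (- (y - s)\<^sup>2)"

lemma integrable_pgauss: "integrable lborel (pgauss l y)"
  unfolding pgauss_def[abs_def] by (rule integrable_poly_gauss)

lemma integrable_pgauss_finite:
  "finite_measure Q \<Longrightarrow> sets Q = sets borel \<Longrightarrow> integrable Q (pgauss l y)"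
  unfolding pgauss_def[abs_def] by (rule integrable_poly_gauss_finite)

lemma moment_eq_gtrans: "moment Q 0 l y x = gtrans Q (pgauss l y) 0 x"
  unfolding moment_def gtrans_def pgauss_def
  by (intro Bochner_Integration.integral_cong) (auto simp: dgauss_0 exp_diff exp_minus field_simps)

lemma moments_converge_uniform:
  assumes P: "\<And>n. sets (P n) = sets borel" "\<And>n. finite_measure (P n)"
    and conv: "moments_converge M X P y" and l: "l \<le> 2 * M"
  shows "uniform_limit X (\<lambda>n. gtrans (P n) (pgauss l y) 0) (gtrans lborel (pgauss l y) 0) sequentially"
proof (rule uniform_limitI)
  fix e :: real assume "e > 0"
  define D where "D n k l x = \<bar>moment (P n) k l y x - moment lborel k l y x\<bar>" for n k l x
  define m where "m n = Max ((\<lambda>(k, l). SUP x\<in>X. D n k l x) ` ({0..2 * M} \<times> {0..2 * M}))" for n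
  have "m \<longlonglongrightarrow> 0" using conv by (simp add: moments_converge_def m_def[abs_def] D_def)
  then have "\<forall>\<^sub>F n in sequentially. m n < e" using \<open>e > 0\<close> by (rule order_tendstoD)
  then show "\<forall>\<^sub>F n in sequentially. \<forall>x\<in>X. dist (gtrans (P n) (pgauss l y) 0 x) (gtrans lborel (pgauss l y) 0 x) < e"
  proof eventually_elim
    case (elim n)
    show ?case
    proof
      fix x assume x: "x \<in> X"
      have "integrable (P n) (pgauss l y)" "integrable lborel (pgauss l y)"
        using P by (auto intro!: integrable_pgauss integrable_pgauss_finite)
      then obtain B1 B2 where B: "\<And>x. \<bar>gtrans (P n) (pgauss l y) 0 x\<bar> \<le> B1" "\<And>x. \<bar>gtrans lborel (pgauss l y) 0 x\<bar> \<le> B2"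
        using gtrans_abs_le[of "P n"] gtrans_abs_le[of lborel] P by (metis sets_lborel)
      have "D n 0 l x \<le> B1 + B2" for x
        unfolding D_def moment_eq_gtrans using B(1)[of x] B(2)[of x] by linarith
      \<comment> \<open>A supremum over an unbounded set of reals carries no information, so
        boundedness comes before \<open>cSUP_upper\<close>.\<close>
      then have "bdd_above (D n 0 l ` X)" by (intro bdd_aboveI2)
      then have "D n 0 l x \<le> (SUP x\<in>X. D n 0 l x)" using x by (intro cSUP_upper)
      also have "\<dots> \<le> m n" unfolding m_def using l by (intro Max_ge) (auto intro!: rev_image_eqI[of "(0, l)"])
      also have "\<dots> < e" by fact
      finally show "dist (gtrans (P n) (pgauss l y) 0 x) (gtrans lborel (pgauss l y) 0 x) < e"
        by (simp add: D_def moment_eq_gtrans dist_real_def)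
    qed
  qed
qed

lemma dgauss_eq_sum_pgauss:
  "dgauss k (y - s) = (\<Sum>l\<le>k. coeff (pcompose (hpoly k) [:y, -1:]) l * pgauss l y s)"
proof -
  have "degree (pcompose (hpoly k) [:y, -1:]) \<le> k"
    using degree_pcompose_le[of "hpoly k" "[:y, -1:]"] by (simp add: degree_hpoly)
  then have "poly (pcompose (hpoly k) [:y, -1:]) s = (\<Sum>l\<le>k. coeff (pcompose (hpoly k) [:y, -1:]) l * s ^ l)"
    by (simp only: poly_altdef) (rule sum.mono_neutral_left, auto simp: coeff_eq_0)
  then show ?thesis
    by (simp add: dgauss_def pgauss_def poly_pcompose sum_distrib_right mult.assoc)
qed

text \<open>Expanding \<open>hpoly k\<close> at \<open>y - s\<close> in powers of \<open>s\<close>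
  involves only exponents up to \<open>k\<close>, all within the range of the moment
  hypothesis.\<close>

lemma gtrans_dgauss_uniform_limit:
  assumes P: "\<And>n. sets (P n) = sets borel" "\<And>n. finite_measure (P n)"
    and conv: "moments_converge M X P y" and k: "k \<le> 2 * M"
  shows "uniform_limit X (\<lambda>n. gtrans (P n) (\<lambda>s. dgauss k (y - s)) 0) (gtrans lborel (\<lambda>s. dgauss k (y - s)) 0) sequentially"
proof -
  define a where "a = coeff (pcompose (hpoly k) [:y, -1:])"
  have int: "integrable (P n) (pgauss l y)" "integrable lborel (pgauss l y)" for n l
    using P by (auto intro!: integrable_pgauss integrable_pgauss_finite)
  have eq: "gtrans Q (\<lambda>s. dgauss k (y - s)) 0 x = (\<Sum>l\<le>k. a l * gtrans Q (pgauss l y) 0 x)"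
    if "sets Q = sets borel" "\<And>l. integrable Q (pgauss l y)" for Q x
  proof -
    have "gtrans Q (\<lambda>s. dgauss k (y - s)) 0 x = (\<integral>s. (\<Sum>l\<le>k. a l * (dgauss 0 (x - s) * pgauss l y s)) \<partial>Q)"
      unfolding gtrans_def dgauss_eq_sum_pgauss[of k y] a_def by (simp add: sum_distrib_left mult_ac)
    also have "\<dots> = (\<Sum>l\<le>k. a l * gtrans Q (pgauss l y) 0 x)"
      using integrable_gtrans[OF that(2,1)] by (simp add: gtrans_def)
    finally show ?thesis .
  qed
  have "uniform_limit X (\<lambda>n x. \<Sum>l\<le>k. a l * gtrans (P n) (pgauss l y) 0 x) (\<lambda>x. \<Sum>l\<le>k. a l * gtrans lborel (pgauss l y) 0 x) sequentially"
  proof (intro uniform_limit_sum uniform_limit_cmult_seq tendsto_const)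
    fix l assume "l \<in> {..k}"
    then show "uniform_limit X (\<lambda>n. gtrans (P n) (pgauss l y) 0) (gtrans lborel (pgauss l y) 0) sequentially"
      using k by (intro moments_converge_uniform[OF P conv]) auto
    show "bounded (gtrans lborel (pgauss l y) 0 ` X)"
      using gtrans_abs_le[OF int(2)[of l], of 0] by (auto simp: bounded_iff)
  qed
  moreover have "gtrans (P n) (\<lambda>s. dgauss k (y - s)) 0 = (\<lambda>x. \<Sum>l\<le>k. a l * gtrans (P n) (pgauss l y) 0 x)" for n
    using eq[OF P(1) int(1)] by blast
  moreover have "gtrans lborel (\<lambda>s. dgauss k (y - s)) 0 = (\<lambda>x. \<Sum>l\<le>k. a l * gtrans lborel (pgauss l y) 0 x)"
    using eq[OF sets_lborel int(2)] by blast
  ultimately show ?thesis by simp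
qed

text \<open>Taylor over a step \<open>t\<close> bounds |h'(x)| by (|h(x + t)| + |h(x)|)/t + |B| t:
  first \<open>t\<close> is taken small, then \<open>n\<close> large.\<close>

lemma deriv_tendsto_0:
  fixes h h' h'' :: "nat \<Rightarrow> real \<Rightarrow> real"
  assumes "\<And>n x. (h n has_real_derivative h' n x) (at x)" "\<And>n x. (h' n has_real_derivative h'' n x) (at x)"
    and \<delta>: "\<delta> > 0" and bound: "\<forall>\<^sub>F n in sequentially. \<forall>t. \<bar>t - x\<bar> \<le> \<delta> \<longrightarrow> \<bar>h'' n t\<bar> \<le> B"
    and lim: "\<And>t. \<bar>t - x\<bar> \<le> \<delta> \<Longrightarrow> (\<lambda>n. h n t) \<longlonglongrightarrow> 0"
  shows "(\<lambda>n. h' n x) \<longlonglongrightarrow> 0"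
proof (rule tendstoI)
  fix e :: real assume e: "e > 0"
  \<comment> \<open>Chosen so that the remainder is at most a quarter of \<open>t * e\<close>; two
    further quarters come from \<open>h n (x + t)\<close> and \<open>h n x\<close>.\<close>
  define t where "t = min \<delta> (e / (4 * (\<bar>B\<bar> + 1)))"
  have t: "t > 0" "t \<le> \<delta>" using e \<delta> by (auto simp: t_def)
  have "(\<bar>B\<bar> + 1) * t \<le> (\<bar>B\<bar> + 1) * (e / (4 * (\<bar>B\<bar> + 1)))" by (intro mult_left_mono) (auto simp: t_def)
  also have "\<dots> = e / 4" by (simp add: field_simps)
  finally have Bt: "\<bar>B\<bar> * t \<le> e / 4" using t(1) by (simp add: distrib_right)
  have "\<forall>\<^sub>F n in sequentially. dist (h n (x + t)) 0 < t * e / 4" "\<forall>\<^sub>F n in sequentially. dist (h n x) 0 < t * e / 4"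
    using t e \<delta> by (intro tendstoD lim; simp)+
  then show "\<forall>\<^sub>F n in sequentially. dist (h' n x) 0 < e"
    using bound
  proof eventually_elim
    case (elim n)
    have "\<bar>h n (x + t) - h n x - t * h' n x\<bar> \<le> \<bar>B\<bar> * t\<^sup>2"
      using assms(1,2)
    proof (rule deriv_bound_imp_taylor1)
      fix t' assume "\<bar>t' - x\<bar> \<le> \<bar>t\<bar>"
      then have "\<bar>h'' n t'\<bar> \<le> B" using elim(3) t by auto
      then show "\<bar>h'' n t'\<bar> \<le> \<bar>B\<bar>" by linarith
    qed
    moreover have "\<bar>B\<bar> * t\<^sup>2 \<le> t * e / 4"
      using mult_right_mono[OF Bt, of t] t by (simp add: power2_eq_square mult_ac)
    ultimately have "\<bar>t * h' n x\<bar> < t * e" using elim(1,2) t e by (simp add: dist_real_def)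
    then have "t * \<bar>h' n x\<bar> < t * e" using t by (simp add: abs_mult)
    then show ?case using t by simp
  qed
qed

text \<open>Polynomial factors cost at most exp(2 r |x - s|), which merely shifts the Gaussian by r
  to either side. Transforms of any order are thus dominated by those of order 0 at
  \<open>x + r\<close> and \<open>x - r\<close>.\<close>

lemma dgauss_mult_le:
  assumes r: "r > 0"
  shows "\<exists>C>0. \<forall>x s. \<bar>x - x0\<bar> \<le> r \<longrightarrow> \<bar>dgauss k (x - s) * dgauss l (y - s)\<bar>
    \<le> C * (dgauss 0 (x + r - s) * dgauss 0 (y - s) + dgauss 0 (x - r - s) * dgauss 0 (y - s))"
proof -
  obtain C1 where C1: "C1 > 0" "\<And>u. \<bar>poly (hpoly k) u\<bar> \<le> C1 * exp (r * \<bar>u\<bar>)"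
    using poly_le_exp[OF r] by blast
  obtain C2 where C2: "C2 > 0" "\<And>u. \<bar>poly (hpoly l) u\<bar> \<le> C2 * exp (r * \<bar>u\<bar>)"
    using poly_le_exp[OF r] by blast
  define R where "R = exp (r * (\<bar>y - x0\<bar> + r))"
  define C where "C = C1 * C2 * R * exp (r\<^sup>2)"
  have "\<bar>dgauss k (x - s) * dgauss l (y - s)\<bar>
    \<le> C * (dgauss 0 (x + r - s) * dgauss 0 (y - s) + dgauss 0 (x - r - s) * dgauss 0 (y - s))"
    if x: "\<bar>x - x0\<bar> \<le> r" for x s
  proof -
    define u where "u = x - s"
    have "r * \<bar>y - s\<bar> \<le> r * \<bar>u\<bar> + r * (\<bar>y - x0\<bar> + r)"
      unfolding distrib_left[symmetric] using x r by (intro mult_left_mono) (auto simp: u_def)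
    then have "exp (r * \<bar>y - s\<bar>) \<le> exp (r * \<bar>u\<bar>) * R" unfolding R_def exp_add[symmetric] by simp
    then have "\<bar>poly (hpoly l) (y - s)\<bar> \<le> C2 * (exp (r * \<bar>u\<bar>) * R)"
      using C2 by (meson mult_left_mono order_trans less_imp_le)
    then have "\<bar>poly (hpoly k) u\<bar> * \<bar>poly (hpoly l) (y - s)\<bar> \<le> (C1 * exp (r * \<bar>u\<bar>)) * (C2 * (exp (r * \<bar>u\<bar>) * R))"
      using C1 by (intro mult_mono) auto
    then have le: "(\<bar>poly (hpoly k) u\<bar> * \<bar>poly (hpoly l) (y - s)\<bar>) * (exp (- u\<^sup>2) * exp (- (y - s)\<^sup>2))
        \<le> ((C1 * exp (r * \<bar>u\<bar>)) * (C2 * (exp (r * \<bar>u\<bar>) * R))) * (exp (- u\<^sup>2) * exp (- (y - s)\<^sup>2))"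
      by (intro mult_right_mono) auto
    have "\<bar>dgauss k u * dgauss l (y - s)\<bar> \<le> C1 * C2 * R * (exp (2 * r * \<bar>u\<bar>) * exp (- u\<^sup>2)) * exp (- (y - s)\<^sup>2)"
    proof -
      have "exp (2 * r * \<bar>u\<bar>) = exp (r * \<bar>u\<bar>) * exp (r * \<bar>u\<bar>)" by (simp flip: exp_add)
      then have "C1 * exp (r * \<bar>u\<bar>) * (C2 * (exp (r * \<bar>u\<bar>) * R)) * (exp (- u\<^sup>2) * exp (- (y - s)\<^sup>2))
        = C1 * C2 * R * (exp (2 * r * \<bar>u\<bar>) * exp (- u\<^sup>2)) * exp (- (y - s)\<^sup>2)"
        by (simp only: mult_ac)
      moreover have "\<bar>dgauss k u * dgauss l (y - s)\<bar>
          = \<bar>poly (hpoly k) u\<bar> * \<bar>poly (hpoly l) (y - s)\<bar> * (exp (- u\<^sup>2) * exp (- (y - s)\<^sup>2))"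
        by (simp only: dgauss_def abs_mult abs_exp_cancel mult_ac)
      ultimately show ?thesis using le by (simp only:)
    qed
    also have "exp (2 * r * \<bar>u\<bar>) * exp (- u\<^sup>2) \<le> exp (r\<^sup>2) * (exp (- (u + r)\<^sup>2) + exp (- (u - r)\<^sup>2))"
    proof -
      \<comment> \<open>Completing the square in |u|; the sign of \<open>u\<close> decides which of
        the two shifted Gaussians is met.\<close>
      have "exp (2 * r * \<bar>u\<bar>) * exp (- u\<^sup>2) = exp (r\<^sup>2) * exp (- (\<bar>u\<bar> - r)\<^sup>2)"
        unfolding exp_add[symmetric] by (simp add: power2_eq_square algebra_simps flip: abs_mult)
      also have "exp (- (\<bar>u\<bar> - r)\<^sup>2) \<le> exp (- (u + r)\<^sup>2) + exp (- (u - r)\<^sup>2)"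
      proof (cases "u \<ge> 0")
        case False
        then have "(\<bar>u\<bar> - r)\<^sup>2 = (u + r)\<^sup>2" by (simp add: power2_eq_square algebra_simps)
        then show ?thesis by simp
      qed simp
      finally show ?thesis by simp
    qed
    finally show ?thesis
      using C1 C2 by (simp add: C_def u_def dgauss_0 algebra_simps R_def)
  qed
  moreover have "C > 0" using C1 C2 by (simp add: C_def R_def)
  ultimately show ?thesis by blast
qed

text \<open>The points \<open>x + r\<close> and \<open>x - r\<close> stay within
  \<open>2 * r\<close> of \<open>x0\<close>, hence in \<open>X\<close>, where the dominating
  transforms of order 0 converge uniformly to a bounded limit.\<close>

lemma gtrans_dgauss_eventually_bounded:
  assumes P: "\<And>n. sets (P n) = sets borel" "\<And>n. finite_measure (P n)"
    and conv: "moments_converge M X P y" and r: "r > 0" "\<And>x. \<bar>x - x0\<bar> \<le> 2 * r \<Longrightarrow> x \<in> X"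
  shows "\<exists>B. \<forall>\<^sub>F n in sequentially. \<forall>x. \<bar>x - x0\<bar> \<le> r \<longrightarrow> \<bar>gtrans (P n) (\<lambda>s. dgauss l (y - s)) k x\<bar> \<le> B"
proof -
  let ?g = "\<lambda>s. dgauss 0 (y - s)"
  obtain C where C: "C > 0" "\<And>x s. \<bar>x - x0\<bar> \<le> r \<Longrightarrow> \<bar>dgauss k (x - s) * dgauss l (y - s)\<bar>
    \<le> C * (dgauss 0 (x + r - s) * ?g s + dgauss 0 (x - r - s) * ?g s)"
    using dgauss_mult_le[OF r(1)] by blast
  obtain B where B: "\<And>x. \<bar>gtrans lborel ?g 0 x\<bar> \<le> B"
    using gtrans_abs_le[OF integrable_dgauss_lborel] by (metis sets_lborel)
  have "\<forall>\<^sub>F n in sequentially. \<forall>x\<in>X. dist (gtrans (P n) ?g 0 x) (gtrans lborel ?g 0 x) < 1"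
    by (intro uniform_limitD[OF gtrans_dgauss_uniform_limit[OF P conv]]) auto
  then have "\<forall>\<^sub>F n in sequentially. \<forall>x. \<bar>x - x0\<bar> \<le> r \<longrightarrow> \<bar>gtrans (P n) (\<lambda>s. dgauss l (y - s)) k x\<bar> \<le> C * (2 * (B + 1))"
  proof eventually_elim
    case (elim n)
    show ?case
    proof (intro allI impI)
      fix x assume x: "\<bar>x - x0\<bar> \<le> r"
      have int: "integrable (P n) (\<lambda>s. dgauss k (x - s) * dgauss l (y - s))" for k l x
        using P by (intro integrable_gtrans integrable_dgauss_finite) auto
      have le: "gtrans (P n) ?g 0 z \<le> B + 1" if "z \<in> X" for z
        using elim that B[of z] by (force simp: dist_real_def)
      have "\<bar>gtrans (P n) (\<lambda>s. dgauss l (y - s)) k x\<bar> \<le>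
          (\<integral>s. C * (dgauss 0 (x + r - s) * ?g s + dgauss 0 (x - r - s) * ?g s) \<partial>P n)"
        unfolding gtrans_def using int C(2)[OF x] by (intro integral_abs_bound_integral) auto
      also have "\<dots> = C * (gtrans (P n) ?g 0 (x + r) + gtrans (P n) ?g 0 (x - r))"
        using int by (simp add: gtrans_def)
      also have "\<dots> \<le> C * ((B + 1) + (B + 1))"
        using C(1) x by (intro mult_left_mono add_mono le r(2)) auto
      finally show "\<bar>gtrans (P n) (\<lambda>s. dgauss l (y - s)) k x\<bar> \<le> C * (2 * (B + 1))" by simp
    qed
  qed
  then show ?thesis by blast
qed

lemma interior_radius:
  fixes X :: "real set"
  assumes "x0 \<in> interior X"
  shows "\<exists>r>0. \<forall>x. \<bar>x - x0\<bar> \<le> 2 * r \<longrightarrow> x \<in> interior X"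
proof -
  obtain e where e: "e > 0" "ball x0 e \<subseteq> interior X" using assms open_contains_ball open_interior by blast
  then have "\<forall>x. \<bar>x - x0\<bar> \<le> 2 * (e / 4) \<longrightarrow> x \<in> interior X"
    by (auto simp: subset_eq dist_real_def abs_minus_commute)
  then show ?thesis using e(1) by (intro exI[of _ "e / 4"]) auto
qed

text \<open>The hypothesis only controls powers \<open>s ^ l\<close> with \<open>l \<le> 2 * M\<close>. Derivatives in \<open>x\<close> involve higher
  powers; they converge because a sequence that tends to \<open>0\<close> pointwise and has locally bounded second
  derivatives also has derivatives tending to \<open>0\<close>.\<close>

lemma gtrans_dgauss_tendsto:
  assumes P: "\<And>n. sets (P n) = sets borel" "\<And>n. finite_measure (P n)"
    and conv: "moments_converge M X P y" and l: "l \<le> 2 * M" and x: "x \<in> interior X"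
  shows "(\<lambda>n. gtrans (P n) (\<lambda>s. dgauss l (y - s)) k x) \<longlonglongrightarrow> gtrans lborel (\<lambda>s. dgauss l (y - s)) k x"
  using x
proof (induction k arbitrary: x)
  case 0
  then show ?case
    using tendsto_uniform_limitI[OF gtrans_dgauss_uniform_limit[OF P conv l]] interior_subset by blast
next
  case (Suc k)
  let ?f = "\<lambda>s. dgauss l (y - s)"
  define h where "h n k x = gtrans (P n) ?f k x - gtrans lborel ?f k x" for n k x
  obtain r where r: "r > 0" "\<And>t. \<bar>t - x\<bar> \<le> 2 * r \<Longrightarrow> t \<in> interior X"
    using interior_radius[OF Suc.prems] by blast
  have h: "(h n k has_real_derivative h n (Suc k) x) (at x)" for n k x
    unfolding h_def using P
    by (auto intro!: derivative_eq_intros gtrans_deriv integrable_dgauss_finite integrable_dgauss_lborel)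
  have "\<exists>B. \<forall>\<^sub>F n in sequentially. \<forall>t. \<bar>t - x\<bar> \<le> r \<longrightarrow> \<bar>gtrans (P n) ?f (Suc (Suc k)) t\<bar> \<le> B"
    using r interior_subset by (intro gtrans_dgauss_eventually_bounded[OF P conv]) blast+
  then obtain B where B: "\<forall>\<^sub>F n in sequentially. \<forall>t. \<bar>t - x\<bar> \<le> r \<longrightarrow> \<bar>gtrans (P n) ?f (Suc (Suc k)) t\<bar> \<le> B" by blast
  obtain B' where B': "\<And>x. \<bar>gtrans lborel ?f (Suc (Suc k)) x\<bar> \<le> B'"
    using gtrans_abs_le[OF integrable_dgauss_lborel] by (metis sets_lborel)
  have "(\<lambda>n. h n (Suc k) x) \<longlonglongrightarrow> 0"
  proof (rule deriv_tendsto_0[OF h h r(1)])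
    show "\<forall>\<^sub>F n in sequentially. \<forall>t. \<bar>t - x\<bar> \<le> r \<longrightarrow> \<bar>h n (Suc (Suc k)) t\<bar> \<le> B + B'"
      using B by eventually_elim (use B' in \<open>force simp: h_def intro: order_trans[OF abs_triangle_ineq4] add_mono\<close>)
    show "(\<lambda>n. h n k t) \<longlonglongrightarrow> 0" if "\<bar>t - x\<bar> \<le> r" for t
      using Suc.IH[OF r(2), of t] that r(1) by (auto simp: h_def LIM_zero)
  qed
  then show ?case unfolding h_def by (rule LIM_zero_cancel)
qed


section \<open>Transfer of the certificate to large n\<close>

text \<open>Decay at infinity leaves a compact set, on which the maximum is attained off
  \<open>A\<close> and is therefore below 1. The margin \<open>e\<close> is what uniform convergence
  will consume.\<close>

lemma below_one_outside_nbhds: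
  fixes f :: "real \<Rightarrow> real"
  assumes cont: "continuous_on UNIV f" and lim: "(f \<longlongrightarrow> 0) at_infinity"
    and less: "\<And>x. x \<notin> A \<Longrightarrow> f x < 1" and \<delta>: "\<And>a. a \<in> A \<Longrightarrow> \<delta> a > 0"
  shows "\<exists>e>0. \<forall>x. (\<forall>a\<in>A. \<delta> a \<le> \<bar>x - a\<bar>) \<longrightarrow> f x \<le> 1 - e"
proof -
  have "\<forall>\<^sub>F x in at_infinity. f x < 1 / 2" using lim by (rule order_tendstoD) simp
  then obtain R where R: "\<And>x. \<bar>x\<bar> \<ge> R \<Longrightarrow> f x < 1 / 2" unfolding eventually_at_infinity by auto
  define K where "K = {- R..R} \<inter> (\<Inter>a\<in>A. {x. \<delta> a \<le> \<bar>x - a\<bar>})"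
  have "closed (\<Inter>a\<in>A. {x. \<delta> a \<le> \<bar>x - a\<bar>})"
    by (intro closed_INT ballI closed_Collect_le continuous_intros)
  then have "compact K" unfolding K_def by (intro compact_Int_closed) auto
  obtain e where e: "e > 0" "\<And>x. x \<in> K \<Longrightarrow> f x \<le> 1 - e"
  proof (cases "K = {}")
    case True
    then show ?thesis using that[of 1] by simp
  next
    case False
    obtain x0 where x0: "x0 \<in> K" "\<And>x. x \<in> K \<Longrightarrow> f x \<le> f x0"
      using continuous_attains_sup[OF \<open>compact K\<close> False continuous_on_subset[OF cont]] by blast
    have "x0 \<notin> A" using x0(1) \<delta> by (force simp: K_def)
    then show ?thesis using that[of "1 - f x0"] x0 less by simp
  qed
  have "f x \<le> 1 - min e (1 / 2)" if x: "\<forall>a\<in>A. \<delta> a \<le> \<bar>x - a\<bar>" for x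
  proof (cases "\<bar>x\<bar> \<ge> R")
    case True
    then show ?thesis using R[of x] by linarith
  next
    case False
    then have "x \<in> K" using x by (auto simp: K_def)
    then show ?thesis using e(2)[of x] by linarith
  qed
  then show ?thesis using e(1) by (intro exI[of _ "min e (1 / 2)"]) auto
qed

text \<open>Taylor at the zero as in \<open>even_zero_sign\<close>, with a radius independent of
  \<open>n\<close>: the derivative of order \<open>m\<close> at \<open>a\<close> is near a positive
  limit and varies at a rate bounded uniformly in \<open>n\<close>.\<close>

lemma eventually_even_zero_positive:
  assumes E: "\<And>n. diff_chain (\<lambda>_. 0) (E n)" and m: "m > 0" "even m"
    and zero: "\<forall>\<^sub>F n in sequentially. \<forall>i<m. E n i a = 0"
    and lim: "(\<lambda>n. E n m a) \<longlonglongrightarrow> e" "e > 0"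
    and bound: "r > 0" "\<forall>\<^sub>F n in sequentially. \<forall>x. \<bar>x - a\<bar> \<le> r \<longrightarrow> \<bar>E n (Suc m) x\<bar> \<le> B"
  shows "\<exists>\<delta>>0. \<forall>\<^sub>F n in sequentially. \<forall>x. 0 < \<bar>x - a\<bar> \<and> \<bar>x - a\<bar> < \<delta> \<longrightarrow> E n 0 x > 0"
proof -
  \<comment> \<open>Within this radius \<open>E n m\<close> varies by at most \<open>e / 2\<close>,
    while eventually its value at \<open>a\<close> exceeds \<open>e / 2\<close>.\<close>
  define \<delta> where "\<delta> = min r (e / (2 * (\<bar>B\<bar> + 1)))"
  have \<delta>: "\<delta> > 0" using bound(1) lim(2) by (simp add: \<delta>_def)
  have "\<bar>B\<bar> * \<delta> \<le> (\<bar>B\<bar> + 1) * (e / (2 * (\<bar>B\<bar> + 1)))"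
    using \<delta> by (intro mult_mono) (auto simp: \<delta>_def)
  also have "\<dots> = e / 2" by (simp add: field_simps)
  finally have B\<delta>: "\<bar>B\<bar> * \<delta> \<le> e / 2" .
  have "\<forall>\<^sub>F n in sequentially. E n m a > e / 2" using lim by (intro order_tendstoD) auto
  then have "\<forall>\<^sub>F n in sequentially. \<forall>x. 0 < \<bar>x - a\<bar> \<and> \<bar>x - a\<bar> < \<delta> \<longrightarrow> E n 0 x > 0"
    using zero bound(2)
  proof eventually_elim
    case (elim n)
    show ?case
    proof (intro allI impI, elim conjE)
      fix x assume x: "0 < \<bar>x - a\<bar>" "\<bar>x - a\<bar> < \<delta>"
      obtain t where t: "\<bar>t - a\<bar> \<le> \<bar>x - a\<bar>" "E n 0 x = E n m t / fact m * (x - a) ^ m"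
        using diff_chain_0_taylor[OF E, of m n a x] elim(2) m by blast
      have tr: "\<bar>t - a\<bar> < \<delta>" "\<bar>t - a\<bar> \<le> r" using t(1) x by (auto simp: \<delta>_def)
      have "norm (E n m t - E n m a) \<le> \<bar>B\<bar> * norm (t - a)"
      proof (rule field_differentiable_bound[of "{a - r..a + r}" "E n m" "E n (Suc m)"])
        show "(E n m has_field_derivative E n (Suc m) z) (at z within {a - r..a + r})" for z
          using diff_chainD[OF E, of n m z] by (auto intro: has_field_derivative_at_within)
        show "norm (E n (Suc m) z) \<le> \<bar>B\<bar>" if "z \<in> {a - r..a + r}" for z
        proof -
          have "\<bar>E n (Suc m) z\<bar> \<le> B" using elim(3) that by (auto simp: abs_le_iff)
          then show ?thesis by simp
        qed
      qed (use tr bound(1) in \<open>auto simp: abs_le_iff\<close>)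
      also have "\<dots> \<le> \<bar>B\<bar> * \<delta>" using tr by (intro mult_left_mono) auto
      finally have "\<bar>E n m t - E n m a\<bar> \<le> e / 2" using B\<delta> by simp
      then have "E n m t > 0" using elim(1) by linarith
      moreover have "(x - a) ^ m > 0" using x m by (simp add: zero_less_power_eq)
      ultimately show "E n 0 x > 0" unfolding t(2) by simp
    qed
  qed
  then show ?thesis using \<delta> by blast
qed

context gauss_nodes
begin

text \<open>The systems for \<open>P n\<close> converge to the nonsingular one for Lebesgue measure,
  hence so do the coefficients. Off small neighbourhoods of the nodes the margin of the limit
  decides, inside them the Taylor argument.\<close>

theorem eventually_certificate:
  assumes P: "\<And>n. sets (P n) = sets borel" "\<And>n. finite_measure (P n)"
    and A: "\<And>a. a \<in> A \<Longrightarrow> a \<in> interior X" "\<And>a. a \<in> A \<Longrightarrow> moments_converge M X P a"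
    and M: "\<And>a. a \<in> A \<Longrightarrow> \<mu> a \<le> 2 * M"
  shows "\<forall>\<^sub>F n in sequentially.
     (\<forall>e. (\<forall>i\<in>idx. gtrans (P n) (comb e) (snd i) (fst i) = 0) \<longrightarrow> (\<forall>i\<in>idx. e i = 0)) \<and>
     (\<exists>b. (\<forall>i\<in>idx. gtrans (P n) (comb b) (snd i) (fst i) = (if snd i = 0 then 1 else 0)) \<and>
          (\<forall>x\<in>X - A. gtrans (P n) (comb b) 0 x < 1) \<and>
          (\<forall>a\<in>A. gtrans (P n) (comb b) (\<mu> a) a < 0))"
proof -
  define f where "f i s = dgauss (snd i) (fst i - s)" for i :: "real \<times> nat" and s
  have combP: "gtrans (P n) (comb b) k x = (\<Sum>i\<in>idx. b i * gtrans (P n) (f i) k x)" for n b k x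
    using gtrans_comb[of "P n"] integrable_dgauss_finite P by (simp add: f_def[abs_def])
  have combL: "gtrans lborel (comb b) k x = (\<Sum>i\<in>idx. b i * gtrans lborel (f i) k x)" for b k x
    using gtrans_comb[OF integrable_dgauss_lborel] by (simp add: f_def[abs_def])
  have lim: "(\<lambda>n. gtrans (P n) (f i) k x) \<longlonglongrightarrow> gtrans lborel (f i) k x" if "i \<in> idx" "x \<in> interior X" for i k x
    using that A M[of "fst i"] unfolding f_def[abs_def]
    by (intro gtrans_dgauss_tendsto[OF P, of M X]) (auto simp: idx_iff)
  obtain b bn where b: "\<And>i. i \<in> idx \<Longrightarrow> gtrans lborel (comb b) (snd i) (fst i) = (if snd i = 0 then 1 else 0)"
    and bn: "\<And>i. i \<in> idx \<Longrightarrow> (\<lambda>n. bn n i) \<longlonglongrightarrow> b i"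
    and ev: "\<forall>\<^sub>F n in sequentially. (\<forall>i\<in>idx. gtrans (P n) (comb (bn n)) (snd i) (fst i) = (if snd i = 0 then 1 else 0)) \<and>
       (\<forall>e. (\<forall>i\<in>idx. gtrans (P n) (comb e) (snd i) (fst i) = 0) \<longrightarrow> (\<forall>i\<in>idx. e i = 0))"
  proof -
    have "\<exists>b bn. (\<forall>i\<in>idx. (\<Sum>j\<in>idx. gtrans lborel (f j) (snd i) (fst i) * b j) = (if snd i = 0 then 1 else 0)) \<and>
      (\<forall>j\<in>idx. (\<lambda>n. bn n j) \<longlonglongrightarrow> b j) \<and>
      (\<forall>\<^sub>F n in sequentially. (\<forall>i\<in>idx. (\<Sum>j\<in>idx. gtrans (P n) (f j) (snd i) (fst i) * bn n j) = (if snd i = 0 then 1 else 0)) \<and>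
       (\<forall>c. (\<forall>i\<in>idx. (\<Sum>j\<in>idx. gtrans (P n) (f j) (snd i) (fst i) * c j) = 0) \<longrightarrow> (\<forall>j\<in>idx. c j = 0)))"
    proof (rule eventually_solve_linear[OF finite_idx])
      show "(\<lambda>n. gtrans (P n) (f j) (snd i) (fst i)) \<longlonglongrightarrow> gtrans lborel (f j) (snd i) (fst i)"
        if "i \<in> idx" "j \<in> idx" for i j
        using that A(1) by (intro lim) (auto simp: idx_iff)
      show "\<forall>j\<in>idx. b j = 0" if "\<And>i. i \<in> idx \<Longrightarrow> (\<Sum>j\<in>idx. gtrans lborel (f j) (snd i) (fst i) * b j) = 0" for b
        using that by (intro gram_kernel_trivial) (simp add: combL mult.commute)
    qed
    then obtain b bn where *: "\<forall>i\<in>idx. gtrans lborel (comb b) (snd i) (fst i) = (if snd i = 0 then 1 else 0)"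
      "\<forall>j\<in>idx. (\<lambda>n. bn n j) \<longlonglongrightarrow> b j"
      "\<forall>\<^sub>F n in sequentially. (\<forall>i\<in>idx. gtrans (P n) (comb (bn n)) (snd i) (fst i) = (if snd i = 0 then 1 else 0)) \<and>
       (\<forall>e. (\<forall>i\<in>idx. gtrans (P n) (comb e) (snd i) (fst i) = 0) \<longrightarrow> (\<forall>i\<in>idx. e i = 0))"
      unfolding combP combL by (simp only: mult.commute) blast
    then show ?thesis by (intro that[of b bn]) blast+
  qed
  define \<eta> where "\<eta> = gtrans lborel (comb b) 0"
  have cert: "\<And>x. x \<notin> A \<Longrightarrow> \<eta> x < 1" "\<And>a. a \<in> A \<Longrightarrow> gtrans lborel (comb b) (\<mu> a) a < 0"
    using limit_certificate[of b] b unfolding \<eta>_def by (auto simp: idx_iff)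
  have lim_deriv: "(\<lambda>n. gtrans (P n) (comb (bn n)) k x) \<longlonglongrightarrow> gtrans lborel (comb b) k x" if "x \<in> interior X" for k x
    unfolding combP combL using that by (intro tendsto_sum tendsto_mult bn lim)
  have unif: "uniform_limit X (\<lambda>n. gtrans (P n) (comb (bn n)) 0) \<eta> sequentially"
    unfolding \<eta>_def combP[abs_def] combL[abs_def]
  proof (intro uniform_limit_sum uniform_limit_cmult_seq bn)
    fix i assume i: "i \<in> idx"
    then show "uniform_limit X (\<lambda>n. gtrans (P n) (f i) 0) (gtrans lborel (f i) 0) sequentially"
      using A(2) M[of "fst i"] unfolding f_def[abs_def]
      by (intro gtrans_dgauss_uniform_limit[OF P, of M]) (auto simp: idx_iff)
    show "bounded (gtrans lborel (f i) 0 ` X)"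
      using gtrans_abs_le[OF integrable_dgauss_lborel sets_lborel, of "snd i" "fst i" 0]
      by (auto simp: bounded_iff f_def[abs_def])
  qed
  have neg: "\<forall>\<^sub>F n in sequentially. \<forall>a\<in>A. gtrans (P n) (comb (bn n)) (\<mu> a) a < 0"
    using finite_A A(1) cert(2) by (intro eventually_ball_finite ballI order_tendstoD[OF lim_deriv]) auto
  have local: "\<exists>\<delta>>0. \<forall>\<^sub>F n in sequentially. \<forall>x. 0 < \<bar>x - a\<bar> \<and> \<bar>x - a\<bar> < \<delta> \<longrightarrow> gtrans (P n) (comb (bn n)) 0 x < 1"
    if a: "a \<in> A" for a
  proof -
    \<comment> \<open>The derivatives of 1 minus the certificate of \<open>P n\<close>. The one of
      order \<open>Suc (\<mu> a)\<close> is bounded near \<open>a\<close> uniformly in large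
      \<open>n\<close>, since the coefficients are eventually within 1 of their limits in absolute
      value.\<close>
    define E where "E n j x = (if j = 0 then 1 else 0) - gtrans (P n) (comb (bn n)) j x" for n j x
    have int: "integrable (P n) (comb (bn n))" for n
      unfolding comb_def[abs_def] using integrable_dgauss_finite P by auto
    have E: "diff_chain (\<lambda>_. 0) (E n)" for n
      unfolding diff_chain_def E_def using P by (auto intro!: derivative_eq_intros gtrans_deriv int)
    obtain r where r: "r > 0" "\<And>x. \<bar>x - a\<bar> \<le> 2 * r \<Longrightarrow> x \<in> X"
      using interior_radius[OF A(1)[OF a]] interior_subset by blast
    have "\<forall>i\<in>idx. \<exists>B. \<forall>\<^sub>F n in sequentially. \<forall>x. \<bar>x - a\<bar> \<le> r \<longrightarrow> \<bar>gtrans (P n) (f i) (Suc (\<mu> a)) x\<bar> \<le> B"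
      unfolding f_def[abs_def] using A(2) r
      by (intro ballI gtrans_dgauss_eventually_bounded[OF P, of M X]) (auto simp: idx_iff)
    from bchoice[OF this] obtain B where B: "\<And>i. i \<in> idx \<Longrightarrow> \<forall>\<^sub>F n in sequentially. \<forall>x. \<bar>x - a\<bar> \<le> r \<longrightarrow> \<bar>gtrans (P n) (f i) (Suc (\<mu> a)) x\<bar> \<le> B i"
      by blast
    have "\<forall>\<^sub>F n in sequentially. \<forall>i\<in>idx. \<bar>bn n i\<bar> < \<bar>b i\<bar> + 1"
      using finite_idx by (intro eventually_ball_finite ballI order_tendstoD[OF tendsto_rabs[OF bn]]) auto
    moreover have "\<forall>\<^sub>F n in sequentially. \<forall>i\<in>idx. \<forall>x. \<bar>x - a\<bar> \<le> r \<longrightarrow> \<bar>gtrans (P n) (f i) (Suc (\<mu> a)) x\<bar> \<le> B i"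
      using finite_idx B by (intro eventually_ball_finite) auto
    ultimately have "\<forall>\<^sub>F n in sequentially. \<forall>x. \<bar>x - a\<bar> \<le> r \<longrightarrow> \<bar>E n (Suc (\<mu> a)) x\<bar> \<le> (\<Sum>i\<in>idx. (\<bar>b i\<bar> + 1) * B i)"
    proof eventually_elim
      case (elim n)
      show ?case
      proof (intro allI impI)
        fix x assume x: "\<bar>x - a\<bar> \<le> r"
        have "\<bar>E n (Suc (\<mu> a)) x\<bar> = \<bar>\<Sum>i\<in>idx. bn n i * gtrans (P n) (f i) (Suc (\<mu> a)) x\<bar>"
          by (simp add: E_def combP)
        also have "\<dots> \<le> (\<Sum>i\<in>idx. \<bar>bn n i\<bar> * \<bar>gtrans (P n) (f i) (Suc (\<mu> a)) x\<bar>)"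
          by (rule order_trans[OF sum_abs]) (simp add: abs_mult)
        also have "\<dots> \<le> (\<Sum>i\<in>idx. (\<bar>b i\<bar> + 1) * B i)"
          using elim x by (intro sum_mono mult_mono) force+
        finally show "\<bar>E n (Suc (\<mu> a)) x\<bar> \<le> (\<Sum>i\<in>idx. (\<bar>b i\<bar> + 1) * B i)" .
      qed
    qed
    moreover have "\<forall>\<^sub>F n in sequentially. \<forall>i<\<mu> a. E n i a = 0"
      using ev
    proof eventually_elim
      case (elim n)
      have "gtrans (P n) (comb (bn n)) i a = (if i = 0 then 1 else 0)" if "i < \<mu> a" for i
        using elim a that by (auto simp: idx_iff dest!: bspec[of _ _ "(a, i)"])
      then show ?case by (simp add: E_def)
    qed
    moreover have "(\<lambda>n. E n (\<mu> a) a) \<longlonglongrightarrow> 0 - gtrans lborel (comb b) (\<mu> a) a"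
      using \<mu>[OF a] unfolding E_def by (auto intro!: tendsto_diff tendsto_minus lim_deriv A(1) a)
    ultimately have "\<exists>\<delta>>0. \<forall>\<^sub>F n in sequentially. \<forall>x. 0 < \<bar>x - a\<bar> \<and> \<bar>x - a\<bar> < \<delta> \<longrightarrow> E n 0 x > 0"
      using \<mu>[OF a] r(1) cert(2)[OF a] by (intro eventually_even_zero_positive[OF E, where e = "0 - gtrans lborel (comb b) (\<mu> a) a" and r = r]) auto
    then show ?thesis by (simp add: E_def)
  qed
  have "\<forall>a\<in>A. \<exists>\<delta>. \<delta> > 0 \<and> (\<forall>\<^sub>F n in sequentially. \<forall>x. 0 < \<bar>x - a\<bar> \<and> \<bar>x - a\<bar> < \<delta> \<longrightarrow> gtrans (P n) (comb (bn n)) 0 x < 1)"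
    using local by blast
  from bchoice[OF this] obtain \<delta> where \<delta>: "\<And>a. a \<in> A \<Longrightarrow> \<delta> a > 0"
    "\<And>a. a \<in> A \<Longrightarrow> \<forall>\<^sub>F n in sequentially. \<forall>x. 0 < \<bar>x - a\<bar> \<and> \<bar>x - a\<bar> < \<delta> a \<longrightarrow> gtrans (P n) (comb (bn n)) 0 x < 1"
    by blast
  have near: "\<forall>\<^sub>F n in sequentially. \<forall>a\<in>A. \<forall>x. 0 < \<bar>x - a\<bar> \<and> \<bar>x - a\<bar> < \<delta> a \<longrightarrow> gtrans (P n) (comb (bn n)) 0 x < 1"
    using finite_A \<delta>(2) by (intro eventually_ball_finite) auto
  have "continuous_on UNIV \<eta>"
    unfolding \<eta>_def using gtrans_deriv[OF integrable_comb sets_lborel] DERIV_continuous_on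
    by (metis has_field_derivative_at_within)
  then obtain e where e: "e > 0" "\<And>x. (\<forall>a\<in>A. \<delta> a \<le> \<bar>x - a\<bar>) \<Longrightarrow> \<eta> x \<le> 1 - e"
    using below_one_outside_nbhds[of \<eta> A \<delta>] cert(1) \<delta>(1) gtrans_comb_tendsto_0[of b] unfolding \<eta>_def by blast
  have "\<forall>\<^sub>F n in sequentially. \<forall>x\<in>X. dist (gtrans (P n) (comb (bn n)) 0 x) (\<eta> x) < e"
    using uniform_limitD[OF unif e(1)] .
  then have "\<forall>\<^sub>F n in sequentially. \<forall>x\<in>X - A. gtrans (P n) (comb (bn n)) 0 x < 1"
    using near
  proof eventually_elim
    case (elim n)
    show ?case
    proof
      fix x assume x: "x \<in> X - A"
      show "gtrans (P n) (comb (bn n)) 0 x < 1"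
      proof (cases "\<forall>a\<in>A. \<delta> a \<le> \<bar>x - a\<bar>")
        case True
        then have "\<eta> x \<le> 1 - e" by (rule e(2))
        then show ?thesis using elim(1) x by (force simp: dist_real_def)
      next
        case False
        then obtain a where "a \<in> A" "\<bar>x - a\<bar> < \<delta> a" by auto
        moreover have "0 < \<bar>x - a\<bar>" using x \<open>a \<in> A\<close> by auto
        ultimately show ?thesis using elim(2) by blast
      qed
    qed
  qed
  then show ?thesis
    using ev neg by eventually_elim blast
qed

end


section \<open>The nondegeneracy conditions\<close>

text \<open>A connected set that is not a singleton has no isolated points, endpoints included, so
  derivatives relative to \<open>X\<close> are unique everywhere on \<open>X\<close>.\<close>

lemma interval_at_within_neq_bot:
  fixes X :: "real set"
  assumes "is_interval X" "interior X \<noteq> {}" "x \<in> X"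
  shows "at x within X \<noteq> bot"
proof -
  have "\<nexists>y. X = {y}" using assms(2) interior_singleton by metis
  then have "x islimpt X" using assms by (intro connected_imp_perfect is_interval_connected) auto
  then show ?thesis by (simp add: trivial_limit_within)
qed

context gauss_nodes
begin

lemma comb_diff: "comb (\<lambda>i. e i - e' i) s = comb e s - comb e' s"
  by (simp add: comb_def left_diff_distrib sum_subtractf)

lemma comb_L2:
  assumes "finite_measure Q" "sets Q = sets borel"
  shows "comb b \<in> L2 Q"
  unfolding comb_def[abs_def] by (intro L2_sum L2_cmult dgauss_L2[OF assms])

text \<open>A combination that vanishes almost everywhere has zero transforms, so its coefficients
  lie in the kernel of the Gram matrix. This is the source of full rank.\<close>

lemma L2_eq_comb_imp_eq:
  assumes Q: "finite_measure Q" "sets Q = sets borel"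
    and ker: "\<forall>e. (\<forall>i\<in>idx. gtrans Q (comb e) (snd i) (fst i) = 0) \<longrightarrow> (\<forall>i\<in>idx. e i = 0)"
    and eq: "L2_eq Q (comb e) (comb e')" and i: "i \<in> idx"
  shows "e i = e' i"
proof -
  have "AE s in Q. comb (\<lambda>i. e i - e' i) s = 0"
    using eq unfolding L2_eq_def by eventually_elim (simp add: comb_diff)
  then have "gtrans Q (comb (\<lambda>i. e i - e' i)) k x = 0" for k x
    unfolding gtrans_def by (intro integral_eq_zero_AE) (auto elim: eventually_mono)
  then have "e i - e' i = 0" using ker i by blast
  then show ?thesis by simp
qed

text \<open>The interpolating combination lies in the span of the constraint functions, so it is the
  minimal norm element almost everywhere, and the transforms of all orders coincide.\<close>

lemma higher_deriv_min_norm: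
  assumes Q: "finite_measure Q" "sets Q = sets borel"
    and b: "\<forall>i\<in>idx. gtrans Q (comb b) (snd i) (fst i) = v i"
    and R: "\<And>p. R p \<longleftrightarrow> p \<in> L2 Q \<and> (\<forall>i\<in>idx. gtrans Q p (snd i) (fst i) = v i)"
  shows "(deriv ^^ k) (Phi_adj Q gauss (arg_min (L2_norm Q) R)) = gtrans Q (comb b) k"
proof -
  have inner: "L2_inner Q (\<lambda>s. dgauss k (x - s)) p = gtrans Q p k x" for p k x
    by (simp add: L2_inner_def gtrans_def)
  have *: "arg_min (L2_norm Q) R \<in> L2 Q \<and> L2_eq Q (arg_min (L2_norm Q) R) (comb b)"
    using b R dgauss_L2[OF Q]
    by (intro arg_min_L2_norm[of idx "\<lambda>i s. dgauss (snd i) (fst i - s)" Q _ b v]) (auto simp: inner comb_def)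
  let ?p = "arg_min (L2_norm Q) R"
  have [measurable_cong]: "sets Q = sets borel" by fact
  have [measurable]: "?p \<in> borel_measurable Q" "comb b \<in> borel_measurable Q"
    using * comb_L2[OF Q] L2_measurable by auto
  have "gtrans Q ?p k x = gtrans Q (comb b) k x" for x
    unfolding gtrans_def
  proof (rule integral_cong_AE)
    show "AE s in Q. dgauss k (x - s) * ?p s = dgauss k (x - s) * comb b s"
      using * unfolding L2_eq_def by (auto elim: eventually_mono)
  qed measurable
  then show ?thesis using higher_deriv_Phi_adj[OF Q] * by auto
qed

end

lemma source_condition_eventually:
  assumes M: "1 \<le> M" and X: "is_interval X"
    and P: "\<And>n. sets (P n) = sets borel" "\<And>n. finite_measure (P n)"
    and x: "strict_mono_on {1..M} x" "\<forall>i\<in>{1..M}. x i \<in> interior X" and a: "\<forall>i\<in>{1..M}. 0 < a i"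
    and conv: "\<forall>i\<in>{1..M}. moments_converge M X P (x i)"
  shows "\<forall>\<^sub>F n in sequentially. nondegenerate_source_condition X (P n) gauss (spike_measure M a x)"
proof -
  have inj: "inj_on x {1..M}" using x(1) by (rule strict_mono_on_imp_inj_on)
  interpret gauss_nodes "x ` {1..M}" "\<lambda>_. 2" by unfold_locales auto
  have "interior X \<noteq> {}" using x(2) M by force
  then have lim: "at y within X \<noteq> bot" if "y \<in> X" for y
    using interval_at_within_neq_bot[OF X _ that] by blast
  have idx: "idx = (\<Union>i\<in>{1..M}. {(x i, 0), (x i, 1)})"
    unfolding idx_def by (auto simp: less_2_cases_iff)
  have mem: "(x i, 0) \<in> idx" "(x i, 1) \<in> idx" if "i \<in> {1..M}" for i
    unfolding idx using that by auto
  \<comment> \<open>Translates the numbering of R^(2M) used by \<open>Gamma\<close>: node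
    \<open>x i\<close> with derivative order \<open>k\<close> has position
    \<open>2 * i - 1 + k\<close>.\<close>
  define e where "e b p = b (2 * the_inv_into {1..M} x (fst p) - 1 + snd p)" for b :: "nat \<Rightarrow> real" and p :: "real \<times> nat"
  have e: "e b (x i, 0) = b (2 * i - 1)" "e b (x i, 1) = b (2 * i)" if "i \<in> {1..M}" for b i
    using that unfolding e_def fst_conv snd_conv the_inv_into_f_f[OF inj that] by simp_all
  have comb_e: "comb (e b) s = (\<Sum>i=1..M. b (2 * i - 1) * dgauss 0 (x i - s) + b (2 * i) * dgauss (Suc 0) (x i - s))" for b s
  proof -
    have "comb (e b) s = (\<Sum>y\<in>x ` {1..M}. \<Sum>k<2. e b (y, k) * dgauss k (y - s))"
      unfolding comb_def idx_def by (simp add: sum.cartesian_product')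
    also have "\<dots> = (\<Sum>i=1..M. \<Sum>k<2. e b (x i, k) * dgauss k (x i - s))"
      by (subst sum.reindex[OF inj]) simp
    also have "\<dots> = (\<Sum>i=1..M. b (2 * i - 1) * dgauss 0 (x i - s) + b (2 * i) * dgauss (Suc 0) (x i - s))"
      using e by (intro sum.cong refl) (simp add: numeral_2_eq_2)
    finally show ?thesis .
  qed
  have "\<forall>\<^sub>F n in sequentially.
     (\<forall>e. (\<forall>i\<in>idx. gtrans (P n) (comb e) (snd i) (fst i) = 0) \<longrightarrow> (\<forall>i\<in>idx. e i = 0)) \<and>
     (\<exists>b. (\<forall>i\<in>idx. gtrans (P n) (comb b) (snd i) (fst i) = (if snd i = 0 then 1 else 0)) \<and>
          (\<forall>y\<in>X - x ` {1..M}. gtrans (P n) (comb b) 0 y < 1) \<and>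
          (\<forall>y\<in>x ` {1..M}. gtrans (P n) (comb b) 2 y < 0))"
    using x(2) conv M by (intro eventually_certificate[OF P, of X M]) auto
  then show ?thesis
  proof eventually_elim
    case (elim n)
    note Q = P(2)[of n] P(1)[of n]
    obtain b where b: "\<forall>i\<in>idx. gtrans (P n) (comb b) (snd i) (fst i) = (if snd i = 0 then 1 else 0)"
      "\<forall>y\<in>X - x ` {1..M}. gtrans (P n) (comb b) 0 y < 1" "\<forall>y\<in>x ` {1..M}. gtrans (P n) (comb b) 2 y < 0"
      using elim by blast
    have Gamma: "AE s in P n. Gamma X (P n) gauss M x c s = comb (e c) s" for c
    proof -
      have "AE s in P n. \<forall>i\<in>{1..M}. L2_deriv (P n) X gauss (x i) s = dgauss (Suc 0) (x i - s)"
      proof (intro AE_finite_allI)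
        fix i assume "i \<in> {1..M}"
        then have "x i \<in> X" using x(2) interior_subset by blast
        then show "AE s in P n. L2_deriv (P n) X gauss (x i) s = dgauss (Suc 0) (x i - s)"
          using L2_deriv_gauss[OF Q lim, of "x i" 1] by (simp add: L2_eq_def)
      qed simp
      then show ?thesis unfolding Gamma_def comb_e gauss_eq_dgauss by eventually_elim simp
    qed
    have rank: "full_rank (P n) (2 * M) (Gamma X (P n) gauss M x)"
      unfolding full_rank_def
    proof (intro allI impI ballI)
      fix c d j
      assume *: "L2_eq (P n) (Gamma X (P n) gauss M x c) (Gamma X (P n) gauss M x d)" and j: "j \<in> {1..2 * M}"
      have "L2_eq (P n) (comb (e c)) (comb (e d))"
        using *[unfolded L2_eq_def] Gamma[of c] Gamma[of d] unfolding L2_eq_def by eventually_elim simp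
      then have eq: "e c i = e d i" if "i \<in> idx" for i
        using L2_eq_comb_imp_eq[OF Q] elim that by blast
      show "c j = d j"
      proof (cases "even j")
        case True
        then obtain i where i: "j = 2 * i" by blast
        then have "i \<in> {1..M}" using j by auto
        then show ?thesis using eq[OF mem(2)] e(2) i by metis
      next
        case False
        then obtain i where i: "j = 2 * i + 1" by (rule oddE)
        then have "Suc i \<in> {1..M}" "j = 2 * Suc i - 1" using j by auto
        then show ?thesis using eq[OF mem(1)] e(1) by metis
      qed
    qed
    have R: "p \<in> L2 (P n) \<and> (\<forall>i\<in>{1..M}. Phi_adj (P n) gauss p (x i) = 1 \<and> deriv (Phi_adj (P n) gauss p) (x i) = 0)
      \<longleftrightarrow> p \<in> L2 (P n) \<and> (\<forall>i\<in>idx. gtrans (P n) p (snd i) (fst i) = (if snd i = 0 then 1 else 0))" for p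
    proof (cases "p \<in> L2 (P n)")
      case True
      have "Phi_adj (P n) gauss p y = gtrans (P n) p 0 y" "deriv (Phi_adj (P n) gauss p) y = gtrans (P n) p 1 y" for y
        using higher_deriv_Phi_adj[OF Q True, of 0] higher_deriv_Phi_adj[OF Q True, of 1] by (auto simp: fun_eq_iff)
      then show ?thesis using True unfolding idx by auto
    qed simp
    have eta: "(deriv ^^ k) (eta_V (P n) gauss M x) = gtrans (P n) (comb b) k" for k
      unfolding eta_V_def p_V_def by (rule higher_deriv_min_norm[OF Q b(1) R])
    show ?case
      unfolding nondegenerate_source_condition_def
      using x a rank b(2,3) eta[of 0] eta[of 2]
      by (intro exI[of _ M] exI[of _ a] exI[of _ x]) auto
  qed
qed

lemma nondegenerate_point_eventually:
  assumes M: "1 \<le> M" and X: "is_interval X"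
    and P: "\<And>n. sets (P n) = sets borel" "\<And>n. finite_measure (P n)"
    and adm: "\<And>n. admissible_framework X (P n) gauss"
    and x0: "x0 \<in> interior X" and conv: "moments_converge M X P x0"
  shows "\<forall>\<^sub>F n in sequentially. nondegenerate_point X (P n) gauss M x0"
proof -
  interpret gauss_nodes "{x0}" "\<lambda>_. 2 * M" using M by unfold_locales auto
  have x0X: "x0 \<in> X" using x0 interior_subset by blast
  have lim: "at y within X \<noteq> bot" if "y \<in> X" for y
    using interval_at_within_neq_bot[OF X _ that] x0 by blast
  have idx: "idx = {x0} \<times> {..<2 * M}" by (auto simp: idx_def)
  \<comment> \<open>\<open>F_map\<close> numbers its coefficients from 1, derivative orders start at
    0.\<close>
  define e where "e b p = b (snd p + 1)" for b :: "nat \<Rightarrow> real" and p :: "real \<times> nat"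
  have comb_e: "comb (e b) s = (\<Sum>k=0..2 * M - 1. b (k + 1) * dgauss k (x0 - s))" for b s
  proof -
    have "comb (e b) s = (\<Sum>k<2 * M. b (k + 1) * dgauss k (x0 - s))"
      unfolding comb_def idx by (simp add: sum.cartesian_product' e_def)
    \<comment> \<open>\<open>M\<close> being positive matters: at 0 the truncated subtraction would
      leave the index 0 on the right.\<close>
    also have "{..<2 * M} = {0..2 * M - 1}" using M by auto
    finally show ?thesis .
  qed
  have "\<forall>\<^sub>F n in sequentially.
     (\<forall>e. (\<forall>i\<in>idx. gtrans (P n) (comb e) (snd i) (fst i) = 0) \<longrightarrow> (\<forall>i\<in>idx. e i = 0)) \<and>
     (\<exists>b. (\<forall>i\<in>idx. gtrans (P n) (comb b) (snd i) (fst i) = (if snd i = 0 then 1 else 0)) \<and>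
          (\<forall>y\<in>X - {x0}. gtrans (P n) (comb b) 0 y < 1) \<and>
          (\<forall>y\<in>{x0}. gtrans (P n) (comb b) (2 * M) y < 0))"
    using x0 conv by (intro eventually_certificate[OF P, of X M]) auto
  then show ?thesis
  proof eventually_elim
    case (elim n)
    note Q = P(2)[of n] P(1)[of n]
    obtain b where b: "\<forall>i\<in>idx. gtrans (P n) (comb b) (snd i) (fst i) = (if snd i = 0 then 1 else 0)"
      "\<forall>y\<in>X - {x0}. gtrans (P n) (comb b) 0 y < 1" "gtrans (P n) (comb b) (2 * M) x0 < 0"
      using elim by blast
    have F_map: "AE s in P n. F_map X (P n) gauss M x0 c s = comb (e c) s" for c
    proof -
      have "AE s in P n. \<forall>k\<in>{0..2 * M - 1}. (L2_deriv (P n) X ^^ k) gauss x0 s = dgauss k (x0 - s)"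
        using L2_deriv_gauss[OF Q lim x0X] by (intro AE_finite_allI) (auto simp: L2_eq_def)
      then show ?thesis by eventually_elim (simp add: F_map_def comb_e)
    qed
    have rank: "full_rank (P n) (2 * M) (F_map X (P n) gauss M x0)"
      unfolding full_rank_def
    proof (intro allI impI ballI)
      fix c d j
      assume *: "L2_eq (P n) (F_map X (P n) gauss M x0 c) (F_map X (P n) gauss M x0 d)" and j: "j \<in> {1..2 * M}"
      have "L2_eq (P n) (comb (e c)) (comb (e d))"
        using *[unfolded L2_eq_def] F_map[of c] F_map[of d] unfolding L2_eq_def by eventually_elim simp
      then have "e c i = e d i" if "i \<in> idx" for i
        using L2_eq_comb_imp_eq[OF Q] elim that by blast
      moreover have "j - 1 < 2 * M" using j by auto
      ultimately show "c j = d j" using j by (force simp: e_def idx)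
    qed
    have R: "p \<in> L2 (P n) \<and> Phi_adj (P n) gauss p x0 = 1 \<and> (\<forall>k\<in>{1..2 * M - 1}. (deriv ^^ k) (Phi_adj (P n) gauss p) x0 = 0)
      \<longleftrightarrow> p \<in> L2 (P n) \<and> (\<forall>i\<in>idx. gtrans (P n) p (snd i) (fst i) = (if snd i = 0 then 1 else 0))" for p
    proof (cases "p \<in> L2 (P n)")
      case True
      note adj = higher_deriv_Phi_adj[OF Q True]
      have a0: "Phi_adj (P n) gauss p x0 = gtrans (P n) p 0 x0" using adj[of 0] by simp
      have "Phi_adj (P n) gauss p x0 = 1 \<and> (\<forall>k\<in>{1..2 * M - 1}. (deriv ^^ k) (Phi_adj (P n) gauss p) x0 = 0)
        \<longleftrightarrow> gtrans (P n) p 0 x0 = 1 \<and> (\<forall>k\<in>{1..2 * M - 1}. gtrans (P n) p k x0 = 0)"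
        unfolding adj a0 ..
      also have "\<dots> \<longleftrightarrow> (\<forall>k\<in>{..<2 * M}. gtrans (P n) p k x0 = (if k = 0 then 1 else 0))"
      proof -
        have "{..<2 * M} = insert 0 {1..2 * M - 1}" using M by auto
        moreover have "(\<forall>k\<in>{1..2 * M - 1}. gtrans (P n) p k x0 = 0)
            \<longleftrightarrow> (\<forall>k\<in>{1..2 * M - 1}. gtrans (P n) p k x0 = (if k = 0 then 1 else 0))"
          by (intro ball_cong refl) simp
        ultimately show ?thesis by simp
      qed
      also have "\<dots> \<longleftrightarrow> (\<forall>i\<in>idx. gtrans (P n) p (snd i) (fst i) = (if snd i = 0 then 1 else 0))"
        unfolding idx by simp
      finally show ?thesis using True by blast
    qed simp
    have eta: "(deriv ^^ k) (eta_W (P n) gauss M x0) = gtrans (P n) (comb b) k" for k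
      unfolding eta_W_def p_W_def by (rule higher_deriv_min_norm[OF Q b(1) R])
    show ?case
      unfolding nondegenerate_point_def
      using rank b(2,3) eta[of 0] eta[of "2 * M"] gauss_in_K_space[OF Q lim adm] by auto
  qed
qed

theorem proposition4:
  fixes M :: nat and X :: "real set" and P :: "nat \<Rightarrow> real measure"
  assumes "1 \<le> M"
    and "is_interval X"
    and "\<And>n. sets (P n) = sets borel"
    and "\<And>n. finite_measure (P n)"
    and "\<And>n. admissible_framework X (P n) gauss"
  shows "(\<forall>a x. strict_mono_on {1..M} x \<and> (\<forall>i\<in>{1..M}. x i \<in> interior X) \<and>
             (\<forall>i\<in>{1..M}. 0 < a i) \<and> (\<forall>i\<in>{1..M}. moments_converge M X P (x i)) \<longrightarrow>
           (\<forall>\<^sub>F n in sequentially.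
             nondegenerate_source_condition X (P n) gauss (spike_measure M a x)))
       \<and> (\<forall>x0\<in>interior X. moments_converge M X P x0 \<longrightarrow>
           (\<forall>\<^sub>F n in sequentially. nondegenerate_point X (P n) gauss M x0))"
proof (intro conjI allI impI ballI)
  fix a x :: "nat \<Rightarrow> real"
  assume *: "strict_mono_on {1..M} x \<and> (\<forall>i\<in>{1..M}. x i \<in> interior X) \<and>
    (\<forall>i\<in>{1..M}. 0 < a i) \<and> (\<forall>i\<in>{1..M}. moments_converge M X P (x i))"
  show "\<forall>\<^sub>F n in sequentially. nondegenerate_source_condition X (P n) gauss (spike_measure M a x)"
    by (rule source_condition_eventually[OF assms(1-4)]) (use * in auto)
next
  fix x0 assume "x0 \<in> interior X" "moments_converge M X P x0"
  then show "\<forall>\<^sub>F n in sequentially. nondegenerate_point X (P n) gauss M x0"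
    by (rule nondegenerate_point_eventually[OF assms])
qed

end
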